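(* Let $\Gamma$ be a countable sofic group. Let $\alpha\in\mathrm{Aut}(\Gamma\times\Gamma)$ be the flip automorphism given by $\alpha((g,h))=(h,g)$. The following are equivalent: (1) $\Gamma$ is amenable; (2) for any universal sofic group $\mathcal S$, any two sofic representations $\pi_1,\pi_2:\Gamma\to\mathcal S$ are conjugate; (3) for any universal sofic group $\mathcal S$ and any sofic representation $\pi:\Gamma\times\Gamma\to\mathcal S$, $\pi$ and $\pi\circ\alpha$ are conjugate; (4) for any universal sofic group $\mathcal S$ and any sofic representation $\pi:\Gamma\times\Gamma\to\mathcal S$, the restrictions $\pi|_{\Gamma\times1}$ and $\pi\circ\alpha|_{\Gamma\times1}$ are conjugate.
   Context: Let $\mathcal U$ be a free ultrafilter on $\mathbb N$. Let $\mathbb S_n$ be the symmetric group on $n$ letters with normalized Hamming distance $d_n(\sigma_1,\sigma_2)=n^{-1}|\{j\in\{1,\dots,n\}:\sigma_1(j)\ne\sigma_2(j)\}|$. For a sequence $\{n_k\}_{k\ge1}$ of positive integers, the associated universal sofic group is the metric ultraproduct $\mathcal S=\prod_{k\to\mathcal U}\mathbb S_{n_k}$, i.e. the product group $\prod_k\mathbb S_{n_k}$ modulo the normal subgroup of sequences $(g_k)$ with $\lim_{k\to\mathcal U}d_{n_k}(g_k,1)=0$; the class of $(g_k)$ is $(g_k)_{\mathcal U}$. An injective homomorphism $\pi:\Lambda\to\mathcal S$ from a countable group $\Lambda$ is a sofic representation if $\lim_{k\to\mathcal U}d_{n_k}(g_k,1_{\mathbb S_{n_k}})=1$ for every $g\in\Lambda$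 with $g\ne1$, where $\pi(g)=(g_k)_{\mathcal U}$. A countable group is sofic if it admits a sofic representation into some universal sofic group. (For a finitely generated group with finite symmetric generating set $S$ this is equivalent to: for every $r\ge1$ there is a finite $S$-edge-labeled directed graph $G$ and a set $W$ of more than $(1-1/r)|V(G)|$ vertices, each having $r$-neighborhood rooted-isomorphic, as an edge-labeled graph, to the $r$-neighborhood of a vertex in the Cayley graph of the group with respect to $S$.) Two homomorphisms $\pi_1,\pi_2$ into $\mathcal S$ are conjugate if there is $s\in\mathcal S$ with $\pi_2(g)=s\pi_1(g)s^{-1}$ for all $g$. The restrictions to $\Gamma\times1$ are regarded as representations of $\Gamma$: $g\mapsto\pi(g,1)$ and $g\mapsto\pi(1,g)$. *)

theory Defs
  imports "HOL-Analysis.Analysis" "HOL-Algebra.Algebra"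
begin

subsection \<open>Universal sofic groups\<close>

definition free_ultrafilter :: "nat filter \<Rightarrow> bool" where
  "free_ultrafilter U \<longleftrightarrow>
     U \<noteq> bot \<and>
     (\<forall>P. eventually P U \<or> eventually (\<lambda>k. \<not> P k) U) \<and>
     (\<forall>m. eventually (\<lambda>k. k \<noteq> m) U)"

definition hamming_dist :: "nat \<Rightarrow> (nat \<Rightarrow> nat) \<Rightarrow> (nat \<Rightarrow> nat) \<Rightarrow> real" where
  "hamming_dist n \<sigma> \<tau> = real (card {j \<in> {1..n}. \<sigma> j \<noteq> \<tau> j}) / real n"

definition sym_product :: "(nat \<Rightarrow> nat) \<Rightarrow> (nat \<Rightarrow> nat \<Rightarrow> nat) monoid" where
  "sym_product n = product_group UNIV (\<lambda>k. sym_group (n k))"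

definition null_sequences :: "nat filter \<Rightarrow> (nat \<Rightarrow> nat) \<Rightarrow> (nat \<Rightarrow> nat \<Rightarrow> nat) set" where
  "null_sequences U n =
     {g \<in> carrier (sym_product n). ((\<lambda>k. hamming_dist (n k) (g k) \<one>\<^bsub>sym_group (n k)\<^esub>) \<longlongrightarrow> 0) U}"

definition universal_sofic :: "nat filter \<Rightarrow> (nat \<Rightarrow> nat) \<Rightarrow> (nat \<Rightarrow> nat \<Rightarrow> nat) set monoid" where
  "universal_sofic U n = sym_product n Mod null_sequences U n"

definition useq_class :: "nat filter \<Rightarrow> (nat \<Rightarrow> nat) \<Rightarrow> (nat \<Rightarrow> nat \<Rightarrow> nat) \<Rightarrow> (nat \<Rightarrow> nat \<Rightarrow> nat) set" where
  "useq_class U n g = null_sequences U n #>\<^bsub>sym_product n\<^esub> g"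

lemma group_sym_product: "group (sym_product n)"
  unfolding sym_product_def by (intro product_group sym_group_is_group)

lemma hamming_dist_comp_le:
  "hamming_dist n (\<sigma> \<circ> \<tau>) id \<le> hamming_dist n \<sigma> id + hamming_dist n \<tau> id"
proof -
  have "card {j \<in> {1..n}. (\<sigma> \<circ> \<tau>) j \<noteq> id j}
      \<le> card ({j \<in> {1..n}. \<sigma> j \<noteq> id j} \<union> {j \<in> {1..n}. \<tau> j \<noteq> id j})"
    by (rule card_mono) auto
  also have "\<dots> \<le> card {j \<in> {1..n}. \<sigma> j \<noteq> id j} + card {j \<in> {1..n}. \<tau> j \<noteq> id j}"
    by (rule card_Un_le)
  finally show ?thesis
    unfolding hamming_dist_def add_divide_distrib[symmetric]
    by (intro divide_right_mono) (auto simp flip: of_nat_add)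
qed

lemma hamming_dist_inv:
  assumes "\<sigma> permutes {1..n}"
  shows "hamming_dist n (inv' \<sigma>) id = hamming_dist n \<sigma> id"
proof -
  have "{j \<in> {1..n}. inv' \<sigma> j \<noteq> id j} = {j \<in> {1..n}. \<sigma> j \<noteq> id j}"
    using permutes_inverses[OF assms] by (auto, metis+)
  then show ?thesis unfolding hamming_dist_def by simp
qed

lemma hamming_dist_conj:
  assumes "\<tau> permutes {1..n}"
  shows "hamming_dist n (\<tau> \<circ> \<sigma> \<circ> inv' \<tau>) id = hamming_dist n \<sigma> id"
proof -
  note inv = permutes_inverses[OF assms] and mem = permutes_in_image[OF assms]
  have "{j \<in> {1..n}. (\<tau> \<circ> \<sigma> \<circ> inv' \<tau>) j \<noteq> id j} = \<tau> ` {j \<in> {1..n}. \<sigma> j \<noteq> id j}" (is "?L = ?R")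
  proof (intro equalityI subsetI)
    fix j assume j: "j \<in> ?L"
    then have "inv' \<tau> j \<in> {j \<in> {1..n}. \<sigma> j \<noteq> id j}"
      using inv mem[of "inv' \<tau> j"] by auto
    then show "j \<in> ?R" using inv(1)[of j] by (metis imageI)
  next
    fix j assume "j \<in> ?R"
    then obtain i where i: "i \<in> {1..n}" "\<sigma> i \<noteq> i" "j = \<tau> i" by auto
    moreover have "\<tau> (\<sigma> i) \<noteq> \<tau> i"
      using i(2) inv(2) by metis
    ultimately show "j \<in> ?L" using mem[of i] inv by simp
  qed
  then have "card {j \<in> {1..n}. (\<tau> \<circ> \<sigma> \<circ> inv' \<tau>) j \<noteq> id j} = card {j \<in> {1..n}. \<sigma> j \<noteq> id j}"
    using card_image[OF inj_on_subset[OF permutes_inj[OF assms] subset_UNIV]] by simp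
  then show ?thesis unfolding hamming_dist_def by simp
qed

lemma hamming_dist_nonneg: "hamming_dist n \<sigma> \<tau> \<ge> 0"
  unfolding hamming_dist_def by simp

lemma inv_sym_group:
  assumes "p permutes {1..n}"
  shows "inv\<^bsub>sym_group n\<^esub> p = inv' p"
proof (rule group.inv_equality[OF sym_group_is_group])
  show "inv' p \<otimes>\<^bsub>sym_group n\<^esub> p = \<one>\<^bsub>sym_group n\<^esub>"
    using permutes_inv_o(2)[OF assms] by (simp add: sym_group_mult sym_group_one)
qed (use assms permutes_inv in \<open>auto simp: sym_group_carrier\<close>)

lemma inv_sym_product:
  assumes "g \<in> carrier (sym_product n)"
  shows "inv\<^bsub>sym_product n\<^esub> g = (\<lambda>k. inv' (g k))"
  using assms
  by (auto simp: sym_product_def inv_product_group sym_group_is_group inv_sym_group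
      sym_group_carrier PiE_iff)

lemma null_sequences_normal: "null_sequences U n \<lhd> sym_product n"
proof -
  interpret P: group "sym_product n" by (rule group_sym_product)
  have car: "g k permutes {1..n k}" if "g \<in> carrier (sym_product n)" for g k
    using that by (auto simp: sym_product_def sym_group_carrier PiE_iff)
  have mult: "(g \<otimes>\<^bsub>sym_product n\<^esub> h) k = g k \<circ> h k" for g h k
    by (simp add: sym_product_def sym_group_mult)
  have one: "\<one>\<^bsub>sym_product n\<^esub> k = id" for k
    by (simp add: sym_product_def sym_group_one)
  note [simp] = mult one sym_group_one
  have "subgroup (null_sequences U n) (sym_product n)"
  proof (rule P.subgroupI)
    show "null_sequences U n \<subseteq> carrier (sym_product n)"
      by (auto simp: null_sequences_def)
    have "\<one>\<^bsub>sym_product n\<^esub> \<in> null_sequences U n"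
      by (simp add: null_sequences_def hamming_dist_def)
    then show "null_sequences U n \<noteq> {}" by auto
  next
    fix g assume g: "g \<in> null_sequences U n"
    then have gc: "g \<in> carrier (sym_product n)" by (simp add: null_sequences_def)
    show "inv\<^bsub>sym_product n\<^esub> g \<in> null_sequences U n"
      using g P.inv_closed[OF gc] hamming_dist_inv[OF car[OF gc]]
      by (simp add: null_sequences_def inv_sym_product[OF gc])
  next
    fix g h assume g: "g \<in> null_sequences U n" and h: "h \<in> null_sequences U n"
    have "((\<lambda>k. hamming_dist (n k) (g k) id + hamming_dist (n k) (h k) id) \<longlongrightarrow> 0) U"
      using g h tendsto_add[of _ "0::real" U _ 0] by (simp add: null_sequences_def)
    then have "((\<lambda>k. hamming_dist (n k) (g k \<circ> h k) id) \<longlongrightarrow> 0) U"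
      by (rule Lim_null_comparison[rotated])
         (auto simp: hamming_dist_nonneg hamming_dist_comp_le)
    then show "g \<otimes>\<^bsub>sym_product n\<^esub> h \<in> null_sequences U n"
      using g h by (simp add: null_sequences_def)
  qed
  moreover have "s \<otimes>\<^bsub>sym_product n\<^esub> g \<otimes>\<^bsub>sym_product n\<^esub> inv\<^bsub>sym_product n\<^esub> s \<in> null_sequences U n"
    if "s \<in> carrier (sym_product n)" "g \<in> null_sequences U n" for s g
  proof -
    have gc: "g \<in> carrier (sym_product n)" using that by (simp add: null_sequences_def)
    have "s \<otimes>\<^bsub>sym_product n\<^esub> g \<otimes>\<^bsub>sym_product n\<^esub> inv\<^bsub>sym_product n\<^esub> s \<in> carrier (sym_product n)"
      using that(1) gc by (intro P.m_closed P.inv_closed)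
    moreover have "(s \<otimes>\<^bsub>sym_product n\<^esub> g \<otimes>\<^bsub>sym_product n\<^esub> inv\<^bsub>sym_product n\<^esub> s) k = s k \<circ> g k \<circ> inv' (s k)" for k
      by (simp only: mult inv_sym_product[OF that(1)])
    ultimately show ?thesis
      using that(2) hamming_dist_conj[OF car[OF that(1)]]
      by (simp add: null_sequences_def del: mult)
  qed
  ultimately show ?thesis unfolding P.normal_inv_iff by blast
qed

lemma group_universal_sofic: "group (universal_sofic U n)"
  unfolding universal_sofic_def by (rule normal.factorgroup_is_group[OF null_sequences_normal])


subsection \<open>Sofic representations\<close>

definition sofic_rep ::
  "nat filter \<Rightarrow> (nat \<Rightarrow> nat) \<Rightarrow> ('a, 'b) monoid_scheme \<Rightarrow> ('a \<Rightarrow> (nat \<Rightarrow> nat \<Rightarrow> nat) set) \<Rightarrow> bool" where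
  "sofic_rep U n \<Lambda> \<pi> \<longleftrightarrow>
     \<pi> \<in> hom \<Lambda> (universal_sofic U n) \<and> inj_on \<pi> (carrier \<Lambda>) \<and>
     (\<forall>x\<in>carrier \<Lambda>. x \<noteq> \<one>\<^bsub>\<Lambda>\<^esub> \<longrightarrow>
        (\<forall>g\<in>carrier (sym_product n). \<pi> x = useq_class U n g \<longrightarrow>
           ((\<lambda>k. hamming_dist (n k) (g k) \<one>\<^bsub>sym_group (n k)\<^esub>) \<longlongrightarrow> 1) U))"

definition sofic_group :: "nat filter \<Rightarrow> ('a, 'b) monoid_scheme \<Rightarrow> bool" where
  "sofic_group U \<Lambda> \<longleftrightarrow>
     group \<Lambda> \<and> countable (carrier \<Lambda>) \<and> (\<exists>n \<pi>. (\<forall>k. n k > 0) \<and> sofic_rep U n \<Lambda> \<pi>)"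

definition conjugate_homs ::
  "('c, 'd) monoid_scheme \<Rightarrow> ('a, 'b) monoid_scheme \<Rightarrow> ('a \<Rightarrow> 'c) \<Rightarrow> ('a \<Rightarrow> 'c) \<Rightarrow> bool" where
  "conjugate_homs S \<Lambda> \<pi>\<^sub>1 \<pi>\<^sub>2 \<longleftrightarrow>
     (\<exists>s\<in>carrier S. \<forall>x\<in>carrier \<Lambda>. \<pi>\<^sub>2 x = s \<otimes>\<^bsub>S\<^esub> \<pi>\<^sub>1 x \<otimes>\<^bsub>S\<^esub> inv\<^bsub>S\<^esub> s)"

definition flip :: "'a \<times> 'a \<Rightarrow> 'a \<times> 'a" where
  "flip = (\<lambda>(g, h). (h, g))"

lemma flip_iso: "group \<Gamma> \<Longrightarrow> flip \<in> iso (\<Gamma> \<times>\<times> \<Gamma>) (\<Gamma> \<times>\<times> \<Gamma>)"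
  by (auto simp: flip_def iso_def hom_def bij_betw_def inj_on_def)

definition restrict_fst :: "('a, 'b) monoid_scheme \<Rightarrow> ('a \<times> 'a \<Rightarrow> 'c) \<Rightarrow> 'a \<Rightarrow> 'c" where
  "restrict_fst \<Gamma> \<pi> = (\<lambda>g. \<pi> (g, \<one>\<^bsub>\<Gamma>\<^esub>))"


subsection \<open>Amenability\<close>

text \<open>A (discrete) group is amenable if it carries a left-invariant finitely additive
  probability measure defined on all of its subsets.\<close>

definition amenable :: "('a, 'b) monoid_scheme \<Rightarrow> bool" where
  "amenable \<Gamma> \<longleftrightarrow>
     (\<exists>\<mu> :: 'a set \<Rightarrow> real.
        (\<forall>A. A \<subseteq> carrier \<Gamma> \<longrightarrow> 0 \<le> \<mu> A) \<and>
        \<mu> (carrier \<Gamma>) = 1 \<and>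
        (\<forall>A B. A \<subseteq> carrier \<Gamma> \<and> B \<subseteq> carrier \<Gamma> \<and> A \<inter> B = {} \<longrightarrow> \<mu> (A \<union> B) = \<mu> A + \<mu> B) \<and>
        (\<forall>g\<in>carrier \<Gamma>. \<forall>A. A \<subseteq> carrier \<Gamma> \<longrightarrow> \<mu> (g <#\<^bsub>\<Gamma>\<^esub> A) = \<mu> A))"

end

(*
Given two approximate actions of an amenable group on a finite set V, an almost equivariant
bijection is built greedily from tiles {(t x, t y) | t : T} with T a Folner set, from the largest scale
to the smallest. When no further tile fits, then on one of the two sides every translate of T meets the
matched part in a definite proportion, so each scale matches a fixed fraction of what was left over. A
diagonal argument along the ultrafilter turns this into conjugacy.

If the group is not amenable, let it act on {1..a} x {1..b} by the product of a sofic approximation on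
{1..a} and one on {1..b} that is good up to radius a. A conjugacy between the two factors would
partition most of the second approximation into sets of size at most a with small boundary. Such
sets embed in the Cayley graph, so this would produce Folner sets. An invariant mean yields Folner
sets because otherwise Hall's theorem gives a paradoxical decomposition.
*)
theory Submission
  imports Defs
begin

subsection \<open>Hall's theorem\<close>

text \<open>Conjugacy is tested on finite sets of group elements, one index at a time, so both
  directions become statements about finite sets, and Folner sets are the form of amenability that
  fits. A maximal family of tiles of one shape need not cover nearly everything, because a tile is
  refused once a proportion of order \<epsilon> of it is occupied; one shape is only guaranteed to
  shrink the uncovered part by the factor \<open>1 - \<epsilon> / 4\<close>, up to an error of order
  \<epsilon>. A further shape gains as much on the remainder only if few of its translates straddle
  the border of what is already matched. Hence the order of choice is the reverse of the order of
  use: the smallest tile is fixed first, and the larger ones must be almost invariant under its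
  inverses. Similarly, in the non-amenable case \<open>b\<close> is chosen after \<open>a\<close>.
  Of the four conditions the last is the weakest, since (2) and (3) imply it by restriction; so it
  is enough that amenability gives (2) and (3), and that (4) fails without it.\<close>

lemma hall_marriage:
  fixes A :: "'i \<Rightarrow> 'b set"
  assumes fin: "\<And>i. i \<in> I \<Longrightarrow> finite (A i)"
    and hall: "\<And>J. finite J \<Longrightarrow> J \<subseteq> I \<Longrightarrow> card J \<le> card (\<Union>(A ` J))"
  obtains f where "inj_on f I" and "\<And>i. i \<in> I \<Longrightarrow> f i \<in> A i"
proof -
  \<comment> \<open>\<open>D\<close> collects deleted edges. Hall's condition is imposed on the
    complement so that Zorn's lemma, which yields maximal sets, produces a minimal relation. The
    argument covers infinite \<open>I\<close>, as two copies of an infinite group require.\<close>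
  define H where "H D \<longleftrightarrow> (\<forall>J. finite J \<and> J \<subseteq> I \<longrightarrow> card J \<le> card ((Sigma I A - D) `` J))" for D
  have finI: "finite ((Sigma I A - D) `` J)" if "finite J" for D J
  proof (rule finite_subset)
    show "(Sigma I A - D) `` J \<subseteq> (\<Union>i\<in>J \<inter> I. A i)" by auto
    show "finite (\<Union>i\<in>J \<inter> I. A i)" using that fin by auto
  qed
  let ?DD = "{D. D \<subseteq> Sigma I A \<and> H D}"
  have H0: "H {}"
    unfolding H_def
  proof (intro allI impI)
    fix J assume J: "finite J \<and> J \<subseteq> I"
    then have "(Sigma I A - {}) `` J = \<Union>(A ` J)" by auto
    then show "card J \<le> card ((Sigma I A - {}) `` J)" using hall J by simp
  qed
  \<comment> \<open>Rado's argument: a minimal subrelation that still satisfies Hall's condition is a function.\<close>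
  have "\<exists>D\<in>?DD. \<forall>D'\<in>?DD. D \<subseteq> D' \<longrightarrow> D' = D"
  proof (rule subset_Zorn')
    fix C assume C: "subset.chain ?DD C"
    show "\<Union>C \<in> ?DD"
    proof (cases "C = {}")
      case True
      then show ?thesis using H0 by simp
    next
      case False
      have "H (\<Union>C)"
        unfolding H_def
      proof (intro allI impI)
        fix J assume J: "finite J \<and> J \<subseteq> I"
        \<comment> \<open>Hall's condition for one finite \<open>J\<close> sees only the edges over
          \<open>J\<close>, finitely many because each \<open>A i\<close> is finite. So those
          deleted by the union are all deleted by one member of the chain.\<close>
        have "finite (\<Union>C \<inter> Sigma J A)"
          using J fin by (intro finite_Int disjI2 finite_SigmaI) auto
        moreover have "\<Union>C \<inter> Sigma J A \<subseteq> \<Union>C" by blast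
        ultimately obtain D where D: "D \<in> C" "\<Union>C \<inter> Sigma J A \<subseteq> D"
          by (rule finite_subset_Union_chain[OF _ _ False C])
        have "(Sigma I A - \<Union>C) `` J = (Sigma I A - D) `` J"
          using D J by auto
        moreover have "H D" using D C by (auto simp: subset.chain_def)
        ultimately show "card J \<le> card ((Sigma I A - \<Union>C) `` J)"
          using J by (simp add: H_def)
      qed
      moreover have "\<Union>C \<subseteq> Sigma I A" using C by (auto simp: subset.chain_def)
      ultimately show ?thesis by simp
    qed
  qed
  then obtain D where D: "D \<subseteq> Sigma I A" "H D"
    and max: "\<And>D'. D' \<subseteq> Sigma I A \<Longrightarrow> H D' \<Longrightarrow> D \<subseteq> D' \<Longrightarrow> D' = D" by auto
  define R where "R = Sigma I A - D"
  have hallR: "card J \<le> card (R `` J)" if "finite J" "J \<subseteq> I" for J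
    using D that by (simp add: H_def R_def)
  have uniq: "x1 = x2" if i: "i \<in> I" and x: "(i, x1) \<in> R" "(i, x2) \<in> R" for i x1 x2
  proof (rule ccontr)
    assume ne: "x1 \<noteq> x2"
    \<comment> \<open>By maximality no further edge can be deleted. The set that then violates
      Hall's condition contains \<open>i\<close>, as otherwise its neighbours would be
      unchanged.\<close>
    have ex: "\<exists>J. finite J \<and> J \<subseteq> I \<and> i \<in> J \<and> card ((R - {(i, x)}) `` J) < card J" if "(i, x) \<in> R" for x
    proof -
      have "\<not> H (insert (i, x) D)"
        using max[of "insert (i, x) D"] that D by (auto simp: R_def)
      moreover have "Sigma I A - insert (i, x) D = R - {(i, x)}" by (auto simp: R_def)
      ultimately obtain J where J: "finite J" "J \<subseteq> I" "card ((R - {(i, x)}) `` J) < card J"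
        by (auto simp: H_def not_le)
      have "i \<in> J"
      proof (rule ccontr)
        assume "i \<notin> J"
        then have "(R - {(i, x)}) `` J = R `` J" by auto
        then show False using hallR[OF J(1,2)] J(3) by simp
      qed
      then show ?thesis using J by blast
    qed
    obtain J1 where J1: "finite J1" "J1 \<subseteq> I" "i \<in> J1" "card ((R - {(i, x1)}) `` J1) < card J1"
      using ex x by blast
    obtain J2 where J2: "finite J2" "J2 \<subseteq> I" "i \<in> J2" "card ((R - {(i, x2)}) `` J2) < card J2"
      using ex x by blast
    let ?P1 = "(R - {(i, x1)}) `` J1" and ?P2 = "(R - {(i, x2)}) `` J2"
    have f: "finite ?P1" "finite ?P2"
    proof -
      show "finite ?P1" by (rule finite_subset[OF _ finI[OF J1(1), of D]]) (auto simp: R_def)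
      show "finite ?P2" by (rule finite_subset[OF _ finI[OF J2(1), of D]]) (auto simp: R_def)
    qed
    \<comment> \<open>Submodularity. The edge to \<open>x1\<close> survives in \<open>?P2\<close>
      and that to \<open>x2\<close> in \<open>?P1\<close>, so the union keeps all neighbours of
      \<open>J1 \<union> J2\<close>; the intersection keeps those of
      \<open>J1 \<inter> J2 - {i}\<close>. Hall's condition bounds the two cardinalities below by
      \<open>card J1 + card J2 - 1\<close> in total, while the two violations bound them above by
      \<open>card J1 + card J2 - 2\<close>.\<close>
    have "card (J1 \<union> J2) \<le> card (?P1 \<union> ?P2)"
    proof (rule order_trans[OF hallR])
      show "card (R `` (J1 \<union> J2)) \<le> card (?P1 \<union> ?P2)"
        using f J1(3) J2(3) x ne by (intro card_mono) auto
    qed (use J1 J2 in auto)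
    moreover have "card (J1 \<inter> J2 - {i}) \<le> card (?P1 \<inter> ?P2)"
    proof (rule order_trans[OF hallR])
      show "card (R `` (J1 \<inter> J2 - {i})) \<le> card (?P1 \<inter> ?P2)"
        using f by (intro card_mono) auto
    qed (use J1 J2 in auto)
    moreover have "card (J1 \<inter> J2 - {i}) = card (J1 \<inter> J2) - 1" "card (J1 \<inter> J2) > 0"
      using J1 J2 by (auto simp: card_gt_0_iff)
    moreover have "card (?P1 \<union> ?P2) + card (?P1 \<inter> ?P2) = card ?P1 + card ?P2"
      using f by (rule card_Un_Int[symmetric])
    moreover have "card (J1 \<union> J2) + card (J1 \<inter> J2) = card J1 + card J2"
      using J1(1) J2(1) by (rule card_Un_Int[symmetric])
    ultimately show False using J1(4) J2(4) by linarith
  qed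
  have ex: "\<exists>x. (i, x) \<in> R" if "i \<in> I" for i
  proof (rule ccontr)
    assume "\<nexists>x. (i, x) \<in> R"
    then have "R `` {i} = {}" by auto
    then show False using hallR[of "{i}"] that by simp
  qed
  define f where "f i = (SOME x. (i, x) \<in> R)" for i
  have f: "(i, f i) \<in> R" if "i \<in> I" for i
    unfolding f_def using someI_ex[OF ex[OF that]] .
  have "inj_on f I"
  proof (rule inj_onI, rule ccontr)
    fix i j assume ij: "i \<in> I" "j \<in> I" "f i = f j" "i \<noteq> j"
    have "y = f i" if "y \<in> R `` {i, j}" for y
      using that uniq[OF ij(1) _ f[OF ij(1)]] uniq[OF ij(2) _ f[OF ij(2)]] ij(3) by auto
    then have "card (R `` {i, j}) \<le> card {f i}" by (intro card_mono) auto
    then show False using hallR[of "{i, j}"] ij by simp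
  qed
  moreover have "f i \<in> A i" if "i \<in> I" for i
    using f[OF that] by (simp add: R_def)
  ultimately show thesis by (rule that)
qed

subsection \<open>Folner sets\<close>

definition folner :: "('a, 'b) monoid_scheme \<Rightarrow> bool" where
  "folner G \<longleftrightarrow>
     (\<forall>K \<delta>. finite K \<and> K \<subseteq> carrier G \<and> \<delta> > 0 \<longrightarrow>
        (\<exists>T. finite T \<and> T \<noteq> {} \<and> T \<subseteq> carrier G \<and>
           real (card {t \<in> T. \<exists>g\<in>K. g \<otimes>\<^bsub>G\<^esub> t \<notin> T}) \<le> \<delta> * real (card T)))"

lemma folnerE:
  assumes "folner G" "finite K" "K \<subseteq> carrier G" "\<delta> > 0"
  obtains T where "finite T" "T \<noteq> {}" "T \<subseteq> carrier G"
    "real (card {t \<in> T. \<exists>g\<in>K. g \<otimes>\<^bsub>G\<^esub> t \<notin> T}) \<le> \<delta> * real (card T)"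
  using assms unfolding folner_def by meson

lemma not_folnerE:
  assumes "\<not> folner G"
  obtains K \<delta> where "finite K" "K \<subseteq> carrier G" "\<delta> > 0"
    "\<And>T. finite T \<Longrightarrow> T \<noteq> {} \<Longrightarrow> T \<subseteq> carrier G \<Longrightarrow>
        \<delta> * real (card T) < real (card {t \<in> T. \<exists>g\<in>K. g \<otimes>\<^bsub>G\<^esub> t \<notin> T})"
proof -
  obtain K \<delta> where K: "finite K \<and> K \<subseteq> carrier G \<and> \<delta> > 0" and
    n: "\<not> (\<exists>T. finite T \<and> T \<noteq> {} \<and> T \<subseteq> carrier G \<and>
           real (card {t \<in> T. \<exists>g\<in>K. g \<otimes>\<^bsub>G\<^esub> t \<notin> T}) \<le> \<delta> * real (card T))"
    using assms unfolding folner_def not_all not_imp by (elim exE conjE) (rule that; simp)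
  show thesis
  proof (rule that[of K \<delta>])
    show "\<delta> * real (card T) < real (card {t \<in> T. \<exists>g\<in>K. g \<otimes>\<^bsub>G\<^esub> t \<notin> T})"
      if "finite T" "T \<noteq> {}" "T \<subseteq> carrier G" for T
    proof (rule ccontr)
      assume "\<not> ?thesis"
      then have "real (card {t \<in> T. \<exists>g\<in>K. g \<otimes>\<^bsub>G\<^esub> t \<notin> T}) \<le> \<delta> * real (card T)" by (rule leI)
      then show False using n that by blast
    qed
  qed (use K in auto)
qed

text \<open>Balls of the Cayley graph for left multiplication by \<open>K\<close>. Adjoining the
  identity at each step makes them increase with the radius.\<close>

primrec kpow :: "('a, 'b) monoid_scheme \<Rightarrow> 'a set \<Rightarrow> nat \<Rightarrow> 'a set" where
  "kpow G K 0 = {\<one>\<^bsub>G\<^esub>}"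
| "kpow G K (Suc j) = insert \<one>\<^bsub>G\<^esub> K <#>\<^bsub>G\<^esub> kpow G K j"

context group begin

lemma finite_set_mult: "finite A \<Longrightarrow> finite B \<Longrightarrow> finite (A <#> B)"
  unfolding set_mult_def by simp

lemma subset_set_mult: "\<one> \<in> L \<Longrightarrow> T \<subseteq> carrier G \<Longrightarrow> T \<subseteq> L <#> T"
proof
  fix x assume "\<one> \<in> L" "T \<subseteq> carrier G" "x \<in> T"
  then have "x = \<one> \<otimes> x" by auto
  then show "x \<in> L <#> T" unfolding set_mult_def using \<open>\<one> \<in> L\<close> \<open>x \<in> T\<close> by blast
qed

lemma kpow_closed: "K \<subseteq> carrier G \<Longrightarrow> kpow G K j \<subseteq> carrier G"
  by (induction j) (simp_all add: set_mult_closed)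

lemma finite_kpow: "finite K \<Longrightarrow> finite (kpow G K j)"
  by (induction j) (auto intro: finite_set_mult)

lemma kpow_Suc_subset: "K \<subseteq> carrier G \<Longrightarrow> kpow G K j \<subseteq> kpow G K (Suc j)"
  by (simp add: subset_set_mult kpow_closed)

lemma kpow_mono: "K \<subseteq> carrier G \<Longrightarrow> i \<le> j \<Longrightarrow> kpow G K i \<subseteq> kpow G K j"
  by (rule lift_Suc_mono_le[of "kpow G K"]) (auto simp del: kpow.simps intro: subsetD[OF kpow_Suc_subset])

lemma kpow_SucI: "g \<in> K \<Longrightarrow> x \<in> kpow G K j \<Longrightarrow> g \<otimes> x \<in> kpow G K (Suc j)"
  by (auto simp: set_mult_def)

text \<open>A point of \<open>T\<close> that some element of \<open>K\<close> moves out of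
  \<open>T\<close> is charged to the new point it produces, and each new point is charged at most
  \<open>card K\<close> times. So one multiplication by \<open>insert \<one> K\<close> enlarges a
  finite set by at least the factor \<open>1 + \<delta> / card K\<close>, and iteration reaches the
  factor 2 needed to match two copies of the group into one.\<close>

lemma not_folner_growth:
  assumes K: "finite K" "K \<subseteq> carrier G" and \<delta>: "\<delta> > 0"
    and bd: "\<And>T. finite T \<Longrightarrow> T \<noteq> {} \<Longrightarrow> T \<subseteq> carrier G \<Longrightarrow>
        \<delta> * real (card T) < real (card {t \<in> T. \<exists>g\<in>K. g \<otimes> t \<notin> T})"
  obtains m where "\<And>T. finite T \<Longrightarrow> T \<subseteq> carrier G \<Longrightarrow> 2 * card T \<le> card (kpow G K m <#> T)"
proof -
  have "K \<noteq> {}" using bd[of "{\<one>}"] \<delta> by auto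
  then have k0: "real (card K) > 0" using K by (simp add: card_gt_0_iff)
  define c where "c = \<delta> / real (card K)"
  have c: "c > 0" using \<delta> k0 by (simp add: c_def)
  have step: "(1 + c) * real (card T) \<le> real (card (insert \<one> K <#> T))"
    if T: "finite T" "T \<subseteq> carrier G" for T
  proof (cases "T = {}")
    case True then show ?thesis by simp
  next
    case False
    let ?L = "insert \<one> K <#> T"
    have TL: "T \<subseteq> ?L" using T by (intro subset_set_mult) auto
    have fL: "finite ?L" using finite_set_mult[of "insert \<one> K" T] K(1) T(1) by simp
    let ?I = "{t \<in> T. \<exists>g\<in>K. g \<otimes> t \<notin> T}"
    have "\<forall>t\<in>?I. \<exists>g. g \<in> K \<and> g \<otimes> t \<notin> T" by blast
    then obtain w where w: "\<forall>t\<in>?I. w t \<in> K \<and> w t \<otimes> t \<notin> T" by (rule bchoice[THEN exE])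
    have "card ?I \<le> card (K \<times> (?L - T))"
    proof (rule card_inj_on_le[of "\<lambda>t. (w t, w t \<otimes> t)"])
      show "inj_on (\<lambda>t. (w t, w t \<otimes> t)) ?I"
      proof (rule inj_onI)
        fix x y assume xy: "x \<in> ?I" "y \<in> ?I" "(w x, w x \<otimes> x) = (w y, w y \<otimes> y)"
        then have "w x \<in> carrier G" "x \<in> carrier G" "y \<in> carrier G" using w K(2) T(2) by auto
        moreover have "w x \<otimes> x = w x \<otimes> y" using xy(3) by (metis prod.inject)
        ultimately show "x = y" by (metis l_cancel)
      qed
      show "(\<lambda>t. (w t, w t \<otimes> t)) ` ?I \<subseteq> K \<times> (?L - T)"
      proof (intro image_subsetI SigmaI DiffI)
        fix t assume t: "t \<in> ?I"
        then show "w t \<in> K" "w t \<otimes> t \<notin> T" using w by auto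
        then show "w t \<otimes> t \<in> ?L" using t unfolding set_mult_def by blast
      qed
      show "finite (K \<times> (?L - T))" using K(1) fL by simp
    qed
    also have "\<dots> = card K * (card ?L - card T)"
      using TL fL T by (simp add: card_cartesian_product card_Diff_subset)
    finally have "real (card ?I) \<le> real (card K) * (real (card ?L) - real (card T))"
      unfolding of_nat_diff[OF card_mono[OF fL TL], symmetric] of_nat_mult[symmetric] of_nat_le_iff .
    then have "\<delta> * real (card T) \<le> real (card K) * (real (card ?L) - real (card T))"
      using bd[OF T(1) False T(2)] by linarith
    then have "c * real (card T) \<le> real (card ?L) - real (card T)"
      using k0 by (simp add: c_def field_simps)
    then show ?thesis by (simp add: algebra_simps)
  qed
  have pow: "(1 + c) ^ j * real (card T) \<le> real (card (kpow G K j <#> T))"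
    if T: "finite T" "T \<subseteq> carrier G" for T j
  proof (induction j)
    case 0
    have "{\<one>} <#> T = T" using T by (force simp: set_mult_def)
    then show ?case by simp
  next
    case (Suc j)
    have "(1 + c) ^ Suc j * real (card T) \<le> (1 + c) * real (card (kpow G K j <#> T))"
      using Suc c by (simp add: mult_left_mono mult.assoc)
    also have "\<dots> \<le> real (card (insert \<one> K <#> (kpow G K j <#> T)))"
      using K T by (intro step finite_set_mult finite_kpow set_mult_closed kpow_closed) auto
    also have "insert \<one> K <#> (kpow G K j <#> T) = kpow G K (Suc j) <#> T"
      using K T by (simp add: set_mult_assoc kpow_closed)
    finally show ?case .
  qed
  obtain m where m: "2 < (1 + c) ^ m" using real_arch_pow[of "1 + c" 2] c by auto
  show thesis
  proof (rule that[of m])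
    fix T assume T: "finite T" "T \<subseteq> carrier G"
    have "2 * real (card T) \<le> (1 + c) ^ m * real (card T)" using m by (intro mult_right_mono) auto
    also have "\<dots> \<le> real (card (kpow G K m <#> T))" using pow T by blast
    finally show "2 * card T \<le> card (kpow G K m <#> T)" by linarith
  qed
qed

text \<open>Doubling of finite sets is Hall's condition for matching two copies of the group into
  one copy by left multiplications from the finite set \<open>S\<close>. Cutting each copy according
  to the multiplier used shows that its image has mean 1; two disjoint sets of mean 1 contradict
  total mass 1.\<close>

lemma amenable_imp_folner:
  assumes "amenable G"
  shows "folner G"
proof (rule ccontr)
  assume "\<not> folner G"
  then obtain K \<delta> where K: "finite K" "K \<subseteq> carrier G" and \<delta>: "\<delta> > 0"
    and bd: "\<And>T. finite T \<Longrightarrow> T \<noteq> {} \<Longrightarrow> T \<subseteq> carrier G \<Longrightarrow>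
        \<delta> * real (card T) < real (card {t \<in> T. \<exists>g\<in>K. g \<otimes> t \<notin> T})"
    by (rule not_folnerE) (rule that, assumption+)
  obtain m where m: "\<And>T. finite T \<Longrightarrow> T \<subseteq> carrier G \<Longrightarrow> 2 * card T \<le> card (kpow G K m <#> T)"
    using not_folner_growth[OF K \<delta> bd] by blast
  define S where "S = kpow G K m"
  have S: "finite S" "S \<subseteq> carrier G" using K by (auto simp: S_def finite_kpow kpow_closed)
  let ?I = "carrier G \<times> (UNIV :: bool set)"
  obtain f where finj: "inj_on f ?I" and fS: "\<And>i. i \<in> ?I \<Longrightarrow> f i \<in> (\<lambda>s. s \<otimes> fst i) ` S"
  proof (rule hall_marriage[of ?I "\<lambda>i. (\<lambda>s. s \<otimes> fst i) ` S"])
    fix J :: "('a \<times> bool) set" assume J: "finite J" "J \<subseteq> ?I"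
    have "card J \<le> card (fst ` J \<times> (UNIV :: bool set))"
      using J by (intro card_mono) (auto simp: rev_image_eqI)
    also have "\<dots> = 2 * card (fst ` J)" by (simp add: card_cartesian_product)
    also have "\<dots> \<le> card (S <#> fst ` J)" unfolding S_def using J by (intro m) auto
    also have "S <#> fst ` J = (\<Union>i\<in>J. (\<lambda>s. s \<otimes> fst i) ` S)" by (auto simp: set_mult_def)
    finally show "card J \<le> card (\<Union>i\<in>J. (\<lambda>s. s \<otimes> fst i) ` S)" .
  next
    show "finite ((\<lambda>s. s \<otimes> fst i) ` S)" for i :: "'a \<times> bool" using S by simp
  qed (rule that)
  from assms obtain \<mu> :: "'a set \<Rightarrow> real" where
    \<mu>: "(\<forall>A. A \<subseteq> carrier G \<longrightarrow> 0 \<le> \<mu> A) \<and> \<mu> (carrier G) = 1 \<and>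
      (\<forall>A B. A \<subseteq> carrier G \<and> B \<subseteq> carrier G \<and> A \<inter> B = {} \<longrightarrow> \<mu> (A \<union> B) = \<mu> A + \<mu> B) \<and>
      (\<forall>g\<in>carrier G. \<forall>A. A \<subseteq> carrier G \<longrightarrow> \<mu> (g <# A) = \<mu> A)"
    unfolding amenable_def by (rule exE)
  have pos: "0 \<le> \<mu> A" if "A \<subseteq> carrier G" for A using \<mu> that by blast
  have one: "\<mu> (carrier G) = 1" using \<mu> by blast
  have add: "\<mu> (A \<union> B) = \<mu> A + \<mu> B" if "A \<subseteq> carrier G" "B \<subseteq> carrier G" "A \<inter> B = {}" for A B
    using \<mu> that by blast
  have inv: "\<mu> (g <# A) = \<mu> A" if "g \<in> carrier G" "A \<subseteq> carrier G" for g A using \<mu> that by blast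
  have empty: "\<mu> {} = 0" using add[of "{}" "{}"] by simp
  have UN: "\<mu> (\<Union>i\<in>F. B i) = (\<Sum>i\<in>F. \<mu> (B i))"
    if "finite F" "\<And>i. i \<in> F \<Longrightarrow> B i \<subseteq> carrier G" "\<And>i j. i \<in> F \<Longrightarrow> j \<in> F \<Longrightarrow> i \<noteq> j \<Longrightarrow> B i \<inter> B j = {}"
    for F :: "'a set" and B
    using that
  proof (induction F rule: finite_induct)
    case empty
    then show ?case using \<open>\<mu> {} = 0\<close> by simp
  next
    case (insert i F)
    have sub: "B j \<subseteq> carrier G" if "j \<in> insert i F" for j using insert.prems(1) that .
    have "B i \<inter> B j = {}" if "j \<in> F" for j
      using insert.prems(2)[of i j] insert.hyps(2) that by blast
    then have disj: "B i \<inter> (\<Union>i\<in>F. B i) = {}" by blast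
    have IH: "\<mu> (\<Union>i\<in>F. B i) = (\<Sum>i\<in>F. \<mu> (B i))"
      by (rule insert.IH; (rule insert.prems)?) simp_all
    have "\<mu> (B i \<union> (\<Union>i\<in>F. B i)) = \<mu> (B i) + \<mu> (\<Union>i\<in>F. B i)"
      by (rule add) (use sub disj in blast)+
    then show ?case using IH insert.hyps by simp
  qed
  have "\<forall>i\<in>?I. \<exists>s. s \<in> S \<and> f i = s \<otimes> fst i" using fS by blast
  then obtain c where c: "\<forall>i\<in>?I. c i \<in> S \<and> f i = c i \<otimes> fst i" by (rule bchoice[THEN exE])
  have fc: "f ` (carrier G \<times> {b}) \<subseteq> carrier G" for b
  proof (intro image_subsetI)
    fix i assume "i \<in> carrier G \<times> {b}"
    then have i: "i \<in> ?I" "fst i \<in> carrier G" by auto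
    then have "c i \<in> carrier G" "f i = c i \<otimes> fst i" using c S(2) by blast+
    then show "f i \<in> carrier G" using i by simp
  qed
  have full: "\<mu> (f ` (carrier G \<times> {b})) = 1" for b
  proof -
    \<comment> \<open>\<open>B s\<close> is the piece of the copy \<open>b\<close> that the matching
      multiplies by \<open>s\<close>. The translated pieces stay disjoint because \<open>f\<close>
      is injective.\<close>
    define B where "B s = {x \<in> carrier G. c (x, b) = s}" for s
    have cov: "carrier G = (\<Union>s\<in>S. B s)" using c by (auto simp: B_def)
    have img: "s <# B s = f ` (B s \<times> {b})" for s
    proof -
      have "f ` (B s \<times> {b}) = (\<lambda>x. f (x, b)) ` B s" by auto
      also have "\<dots> = (\<lambda>x. s \<otimes> x) ` B s" using c by (intro image_cong) (auto simp: B_def)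
      finally show ?thesis by (auto simp: l_coset_def)
    qed
    have "f ` (carrier G \<times> {b}) = (\<Union>s\<in>S. s <# B s)"
    proof -
      have "carrier G \<times> {b} = (\<Union>s\<in>S. B s \<times> {b})" using cov by blast
      then have "f ` (carrier G \<times> {b}) = (\<Union>s\<in>S. f ` (B s \<times> {b}))" by (simp only: image_UN)
      then show ?thesis by (simp only: img)
    qed
    also have "\<mu> \<dots> = (\<Sum>s\<in>S. \<mu> (s <# B s))"
    proof (rule UN)
      show "s <# B s \<subseteq> carrier G" if "s \<in> S" for s
      proof (rule l_coset_subset_G)
        show "B s \<subseteq> carrier G" by (auto simp: B_def)
        show "s \<in> carrier G" using S(2) that by blast
      qed
      show "(s <# B s) \<inter> (t <# B t) = {}" if "s \<in> S" "t \<in> S" "s \<noteq> t" for s t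
      proof -
        have "(B s \<times> {b}) \<inter> (B t \<times> {b}) = {}" using that(3) unfolding B_def by blast
        moreover have "f ` (B s \<times> {b}) \<inter> f ` (B t \<times> {b}) = f ` ((B s \<times> {b}) \<inter> (B t \<times> {b}))"
          by (rule inj_on_image_Int[OF finj, symmetric]; unfold B_def; blast)
        ultimately show ?thesis unfolding img[of s] img[of t] by simp
      qed
    qed (rule S(1))
    also have "\<dots> = (\<Sum>s\<in>S. \<mu> (B s))"
    proof (rule sum.cong[OF refl])
      fix s assume "s \<in> S"
      then show "\<mu> (s <# B s) = \<mu> (B s)" by (intro inv subsetD[OF S(2)]) (auto simp: B_def)
    qed
    also have "\<dots> = \<mu> (\<Union>s\<in>S. B s)"
      by (rule UN[symmetric]) (use S in \<open>auto simp: B_def\<close>)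
    also have "\<dots> = 1" using cov one by simp
    finally show ?thesis .
  qed
  let ?R = "f ` (carrier G \<times> {True}) \<union> f ` (carrier G \<times> {False})"
  have "\<mu> ?R = 2"
  proof -
    have "f ` (carrier G \<times> {True}) \<inter> f ` (carrier G \<times> {False})
        = f ` (carrier G \<times> {True} \<inter> carrier G \<times> {False})"
      by (rule inj_on_image_Int[OF finj, symmetric]) auto
    also have "carrier G \<times> {True} \<inter> carrier G \<times> {False} = {}" by blast
    finally show ?thesis using add[OF fc fc, of True False] full by simp
  qed
  moreover have "\<mu> (?R \<union> (carrier G - ?R)) = \<mu> ?R + \<mu> (carrier G - ?R)"
    using fc by (intro add) auto
  moreover have "?R \<union> (carrier G - ?R) = carrier G" using fc by blast
  ultimately show False using one pos[of "carrier G - ?R"] by simp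
qed

end

section \<open>Limits along an ultrafilter and invariant means\<close>

lemma ultrafilter_convergent:
  fixes f :: "nat \<Rightarrow> real"
  assumes U: "free_ultrafilter U" and bd: "\<And>k. 0 \<le> f k \<and> f k \<le> 1"
  shows "\<exists>l. (f \<longlongrightarrow> l) U"
proof -
  have ne: "filtermap f U \<noteq> bot" using U by (simp add: free_ultrafilter_def filtermap_bot_iff)
  have "eventually (\<lambda>x. x \<in> {0..1}) (filtermap f U)" using bd by (simp add: eventually_filtermap)
  then obtain l where l: "inf (nhds l) (filtermap f U) \<noteq> bot"
    using compact_Icc[of "0::real" 1] ne unfolding compact_filter by blast
  \<comment> \<open>A cluster point of an ultrafilter is a limit: a neighbourhood of
    \<open>l\<close> that is not eventually entered would eventually be avoided.\<close>
  have "(f \<longlongrightarrow> l) U"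
  proof (rule topological_tendstoI, rule ccontr)
    fix S assume S: "open S" "l \<in> S" and "\<not> (\<forall>\<^sub>F k in U. f k \<in> S)"
    then have "\<forall>\<^sub>F k in U. f k \<notin> S" using U by (auto simp: free_ultrafilter_def)
    then have "\<forall>\<^sub>F x in filtermap f U. x \<notin> S" by (simp add: eventually_filtermap)
    moreover have "\<forall>\<^sub>F x in nhds l. x \<in> S" using S by (rule eventually_nhds_in_open)
    ultimately have "\<forall>\<^sub>F x in inf (nhds l) (filtermap f U). False"
      unfolding eventually_inf by blast
    then show False using l by (simp add: trivial_limit_def)
  qed
  then show ?thesis ..
qed

lemma free_ultrafilter_ge:
  assumes "free_ultrafilter U"
  shows "eventually (\<lambda>k. k \<ge> (m::nat)) U"
proof -
  have "eventually (\<lambda>k. \<forall>i\<in>{..<m}. k \<noteq> i) U"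
    using assms by (intro eventually_ball_finite) (auto simp: free_ultrafilter_def)
  then show ?thesis by eventually_elim (auto simp: not_less[symmetric])
qed

lemma free_ultrafilter_le_sequentially: "free_ultrafilter U \<Longrightarrow> U \<le> sequentially"
  unfolding filter_leD le_filter_def eventually_sequentially
  using free_ultrafilter_ge by (metis (mono_tags, lifting) eventually_mono)

text \<open>The mean of \<open>A\<close> is the limit along \<open>U\<close> of the proportion of
  \<open>A\<close> in \<open>T k\<close>, where the Folner set \<open>T k\<close> serves an initial
  segment of an enumeration that grows with \<open>k\<close>. The ultrafilter makes all these limits
  exist at once, and a fixed element is eventually among those served.\<close>

lemma (in group) folner_imp_amenable:
  assumes fol: "folner G" and cnt: "countable (carrier G)" and U: "free_ultrafilter U"
  shows "amenable G"
proof -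
  define e where "e = from_nat_into (carrier G)"
  have ne: "carrier G \<noteq> {}" by auto
  have e: "e i \<in> carrier G" for i unfolding e_def by (rule from_nat_into[OF ne])
  have "\<exists>T. finite T \<and> T \<noteq> {} \<and> T \<subseteq> carrier G \<and>
      real (card {t \<in> T. \<exists>g\<in>e ` {..k}. g \<otimes> t \<notin> T}) \<le> (1 / real (Suc k)) * real (card T)" for k
    by (rule folnerE[OF fol, of "e ` {..k}" "1 / real (Suc k)"]) (use e in auto)
  then have "\<exists>T. \<forall>k. finite (T k) \<and> T k \<noteq> {} \<and> T k \<subseteq> carrier G \<and>
      real (card {t \<in> T k. \<exists>g\<in>e ` {..k}. g \<otimes> t \<notin> T k}) \<le> (1 / real (Suc k)) * real (card (T k))"
    by (intro choice allI)
  then obtain T where T: "\<And>k. finite (T k)" "\<And>k. T k \<noteq> {}" "\<And>k. T k \<subseteq> carrier G"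
    and small: "\<And>k. real (card {t \<in> T k. \<exists>g\<in>e ` {..k}. g \<otimes> t \<notin> T k}) \<le> (1 / real (Suc k)) * real (card (T k))"
    by blast
  have T0: "real (card (T k)) > 0" for k using T by (simp add: card_gt_0_iff)
  define r where "r A k = real (card (A \<inter> T k)) / real (card (T k))" for A k
  have Ub: "U \<noteq> bot" using U by (simp add: free_ultrafilter_def)
  have "\<exists>l. (r A \<longlongrightarrow> l) U" for A
    unfolding r_def using T T0 by (intro ultrafilter_convergent[OF U]) (simp add: card_mono)
  then obtain \<mu> where \<mu>: "\<And>A. (r A \<longlongrightarrow> \<mu> A) U" by metis
  have inner: "((\<lambda>k. real (card {t \<in> T k. g \<otimes> t \<notin> T k}) / real (card (T k))) \<longlongrightarrow> 0) U"
    if g: "g \<in> carrier G" for g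
  proof -
    obtain i where i: "g = e i" using g cnt by (metis e_def from_nat_into_surj)
    have "((\<lambda>k. 1 / real (Suc k)) \<longlongrightarrow> 0) U"
      by (rule tendsto_mono[OF free_ultrafilter_le_sequentially[OF U]])
         (use LIMSEQ_inverse_real_of_nat in \<open>simp add: inverse_eq_divide\<close>)
    moreover have "\<forall>\<^sub>F k in U. norm (real (card {t \<in> T k. g \<otimes> t \<notin> T k}) / real (card (T k))) \<le> 1 / real (Suc k)"
      using free_ultrafilter_ge[OF U, of i]
    proof eventually_elim
      case (elim k)
      have "real (card {t \<in> T k. g \<otimes> t \<notin> T k}) \<le> real (card {t \<in> T k. \<exists>g\<in>e ` {..k}. g \<otimes> t \<notin> T k})"
        unfolding of_nat_le_iff using T i elim by (intro card_mono) auto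
      also note small[of k]
      finally show ?case using T0[of k] by (simp add: field_simps)
    qed
    ultimately show ?thesis by (rule Lim_null_comparison[rotated])
  qed
  \<comment> \<open>The points of \<open>A \<inter> T k\<close> that \<open>g\<close> keeps inside
    \<open>T k\<close> are mapped injectively into the translate of \<open>A\<close>; the others lie
    in the boundary of \<open>T k\<close>, whose proportion tends to 0. One inequality is enough,
    since its instance for the inverse of \<open>g\<close> and the translate of \<open>A\<close> is
    the reverse one.\<close>
  have shift: "r A k \<le> r (g <# A) k + real (card {t \<in> T k. g \<otimes> t \<notin> T k}) / real (card (T k))"
    if g: "g \<in> carrier G" for g A k
  proof -
    have "card (A \<inter> T k) \<le> card {t \<in> A \<inter> T k. g \<otimes> t \<in> T k} + card {t \<in> T k. g \<otimes> t \<notin> T k}"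
      using T by (intro order_trans[OF card_mono card_Un_le]) auto
    also have "card {t \<in> A \<inter> T k. g \<otimes> t \<in> T k} \<le> card ((g <# A) \<inter> T k)"
    proof (rule card_inj_on_le[of "\<lambda>t. g \<otimes> t"])
      show "inj_on (\<lambda>t. g \<otimes> t) {t \<in> A \<inter> T k. g \<otimes> t \<in> T k}"
        using T g by (auto intro!: inj_onI simp: subset_iff)
    qed (use T in \<open>auto simp: l_coset_def\<close>)
    finally show ?thesis using T0[of k]
      by (simp add: r_def field_simps flip: of_nat_add)
  qed
  have le: "\<mu> A \<le> \<mu> (g <# A)" if "g \<in> carrier G" for g A
  proof (rule tendsto_le[OF Ub _ \<mu>])
    show "((\<lambda>k. r (g <# A) k + real (card {t \<in> T k. g \<otimes> t \<notin> T k}) / real (card (T k))) \<longlongrightarrow> \<mu> (g <# A)) U"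
      using tendsto_add[OF \<mu> inner[OF that]] by simp
  qed (use shift that in auto)
  show ?thesis
    unfolding amenable_def
  proof (intro exI[of _ \<mu>] conjI allI impI ballI)
    show "0 \<le> \<mu> A" for A
      by (rule tendsto_lowerbound[OF \<mu> _ Ub]) (simp add: r_def)
    have "r (carrier G) = (\<lambda>k. 1)"
      using T T0 by (auto simp: r_def fun_eq_iff Int_absorb1)
    then show "\<mu> (carrier G) = 1"
      using \<mu>[of "carrier G"] tendsto_unique[OF Ub] tendsto_const by metis
    show "\<mu> (A \<union> B) = \<mu> A + \<mu> B" if AB: "A \<subseteq> carrier G \<and> B \<subseteq> carrier G \<and> A \<inter> B = {}" for A B
    proof (rule tendsto_unique[OF Ub \<mu>])
      have "r (A \<union> B) = (\<lambda>k. r A k + r B k)"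
      proof
        fix k
        have "card ((A \<union> B) \<inter> T k) = card (A \<inter> T k) + card (B \<inter> T k)"
          unfolding Int_Un_distrib2 using T AB by (intro card_Un_disjoint) auto
        then show "r (A \<union> B) k = r A k + r B k" by (simp add: r_def add_divide_distrib)
      qed
      then show "(r (A \<union> B) \<longlongrightarrow> \<mu> A + \<mu> B) U" using tendsto_add[OF \<mu> \<mu>] by simp
    qed
    show "\<mu> (g <# A) = \<mu> A" if g: "g \<in> carrier G" and A: "A \<subseteq> carrier G" for g A
    proof (rule antisym)
      have "inv g <# (g <# A) = A" using g A by (simp add: lcos_m_assoc lcos_mult_one)
      then show "\<mu> (g <# A) \<le> \<mu> A" using le[of "inv g" "g <# A"] g by simp
    qed (use le g in auto)
  qed
qed

text \<open>A product set is left only by leaving one of its factors, so the two proportions add up;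
  hence the halves of \<delta>. This serves condition (3), where the acting group is the
  square.\<close>

lemma folner_DirProd:
  assumes G: "group G" "group H" and fol: "folner G" "folner H"
  shows "folner (G \<times>\<times> H)"
  unfolding folner_def
proof (intro allI impI, elim conjE)
  fix K and \<delta> :: real
  assume K: "finite K" "K \<subseteq> carrier (G \<times>\<times> H)" and \<delta>: "\<delta> > 0"
  obtain T1 where T1: "finite T1" "T1 \<noteq> {}" "T1 \<subseteq> carrier G"
    "real (card {t \<in> T1. \<exists>g\<in>fst ` K. g \<otimes>\<^bsub>G\<^esub> t \<notin> T1}) \<le> \<delta> / 2 * real (card T1)" (is "real (card ?I1) \<le> _")
    by (rule folnerE[OF fol(1), of "fst ` K" "\<delta> / 2"]) (use K \<delta> in auto)
  obtain T2 where T2: "finite T2" "T2 \<noteq> {}" "T2 \<subseteq> carrier H"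
    "real (card {t \<in> T2. \<exists>g\<in>snd ` K. g \<otimes>\<^bsub>H\<^esub> t \<notin> T2}) \<le> \<delta> / 2 * real (card T2)" (is "real (card ?I2) \<le> _")
    by (rule folnerE[OF fol(2), of "snd ` K" "\<delta> / 2"]) (use K \<delta> in auto)
  have "card {t \<in> T1 \<times> T2. \<exists>g\<in>K. g \<otimes>\<^bsub>G \<times>\<times> H\<^esub> t \<notin> T1 \<times> T2} \<le> card (?I1 \<times> T2 \<union> T1 \<times> ?I2)"
  proof (intro card_mono subsetI)
    fix p assume p: "p \<in> {t \<in> T1 \<times> T2. \<exists>g\<in>K. g \<otimes>\<^bsub>G \<times>\<times> H\<^esub> t \<notin> T1 \<times> T2}"
    then obtain g where g: "g \<in> K" "g \<otimes>\<^bsub>G \<times>\<times> H\<^esub> p \<notin> T1 \<times> T2" by blast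
    obtain t1 t2 g1 g2 where eq: "p = (t1, t2)" "g = (g1, g2)" by (metis surj_pair)
    then have "g1 \<in> fst ` K" "g2 \<in> snd ` K" using g by force+
    then show "p \<in> ?I1 \<times> T2 \<union> T1 \<times> ?I2" using p g eq by auto
  qed (use T1 T2 in auto)
  also have "\<dots> \<le> card ?I1 * card T2 + card T1 * card ?I2"
    by (rule order_trans[OF card_Un_le]) (simp add: card_cartesian_product)
  finally have "real (card {t \<in> T1 \<times> T2. \<exists>g\<in>K. g \<otimes>\<^bsub>G \<times>\<times> H\<^esub> t \<notin> T1 \<times> T2})
      \<le> real (card ?I1) * real (card T2) + real (card T1) * real (card ?I2)"
    unfolding of_nat_mult[symmetric] of_nat_add[symmetric] of_nat_le_iff .
  also have "\<dots> \<le> (\<delta> / 2 * real (card T1)) * real (card T2) + real (card T1) * (\<delta> / 2 * real (card T2))"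
    using T1 T2 by (intro add_mono mult_right_mono mult_left_mono) auto
  also have "\<dots> = \<delta> * real (card (T1 \<times> T2))" by (simp add: card_cartesian_product)
  finally show "\<exists>T. finite T \<and> T \<noteq> {} \<and> T \<subseteq> carrier (G \<times>\<times> H) \<and>
      real (card {t \<in> T. \<exists>g\<in>K. g \<otimes>\<^bsub>G \<times>\<times> H\<^esub> t \<notin> T}) \<le> \<delta> * real (card T)"
    using T1(1-3) T2(1-3) by (intro exI[of _ "T1 \<times> T2"] conjI) (simp_all add: Sigma_mono)
qed

subsection \<open>Approximate actions\<close>

text \<open>Near \<open>x\<close> the map \<open>g \<mapsto> \<rho> g x\<close> is a copy of left
  multiplication: injective on \<open>E\<close>, and compatible with products of two elements of
  \<open>E\<close>, whether or not the product lies in \<open>E\<close>.\<close>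

definition good_pt :: "('a, 'b) monoid_scheme \<Rightarrow> ('a \<Rightarrow> 'x \<Rightarrow> 'x) \<Rightarrow> 'a set \<Rightarrow> 'x \<Rightarrow> bool" where
  "good_pt G \<rho> E x \<longleftrightarrow>
     \<rho> \<one>\<^bsub>G\<^esub> x = x \<and> (\<forall>g\<in>E. \<forall>h\<in>E. \<rho> g (\<rho> h x) = \<rho> (g \<otimes>\<^bsub>G\<^esub> h) x) \<and> inj_on (\<lambda>g. \<rho> g x) E"

text \<open>Only the group law and freeness are approximate; each group element acts by an exact
  permutation of \<open>V\<close>, as representatives in a symmetric group do. Exact bijectivity
  lets exceptional sets be moved around without growing.\<close>

definition approx_action ::
  "('a, 'b) monoid_scheme \<Rightarrow> ('a \<Rightarrow> 'x \<Rightarrow> 'x) \<Rightarrow> 'x set \<Rightarrow> 'a set \<Rightarrow> real \<Rightarrow> bool" where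
  "approx_action G \<rho> V E \<eta> \<longleftrightarrow>
     finite V \<and> (\<forall>g\<in>carrier G. bij_betw (\<rho> g) V V) \<and>
     real (card {x \<in> V. \<not> good_pt G \<rho> E x}) \<le> \<eta> * real (card V)"

lemma good_pt_mono: "good_pt G \<rho> E x \<Longrightarrow> E' \<subseteq> E \<Longrightarrow> good_pt G \<rho> E' x"
  unfolding good_pt_def by (meson inj_on_subset subsetD)

lemma approx_action_mono:
  assumes "approx_action G \<rho> V E \<eta>" "E' \<subseteq> E" "\<eta> \<le> \<eta>'"
  shows "approx_action G \<rho> V E' \<eta>'"
proof -
  have "card {x \<in> V. \<not> good_pt G \<rho> E' x} \<le> card {x \<in> V. \<not> good_pt G \<rho> E x}"
    using assms(1,2) good_pt_mono[of G \<rho> E] by (intro card_mono) (auto simp: approx_action_def)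
  moreover have "\<eta> * real (card V) \<le> \<eta>' * real (card V)"
    using assms(3) by (intro mult_right_mono) auto
  ultimately show ?thesis using assms(1) by (simp add: approx_action_def)
qed

subsection \<open>Equivariant partial matchings\<close>

text \<open>Count the pairs \<open>(t, x)\<close> with \<open>f t x \<in> A\<close>: each
  \<open>x\<close> of \<open>Y\<close> occurs in at least \<open>c * card T\<close> of them, and
  each \<open>t\<close>, by injectivity, in at most \<open>card A\<close>.\<close>

lemma double_count:
  fixes c :: real
  assumes fin: "finite T" "T \<noteq> {}" "finite Y" "finite A"
    and inj: "\<And>t. t \<in> T \<Longrightarrow> inj_on (f t) Y"
    and many: "\<And>x. x \<in> Y \<Longrightarrow> c * real (card T) \<le> real (card {t \<in> T. f t x \<in> A})"
  shows "c * real (card Y) \<le> real (card A)"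
proof -
  have T0: "real (card T) > 0" using fin by (simp add: card_gt_0_iff)
  have "real (card Y) * (c * real (card T)) \<le> (\<Sum>x\<in>Y. real (card {t \<in> T. f t x \<in> A}))"
    using many by (intro sum_bounded_below)
  also have "\<dots> = (\<Sum>x\<in>Y. \<Sum>t\<in>T. if f t x \<in> A then 1 else 0)"
    using fin(1) by (intro sum.cong refl) (simp add: sum.If_cases Int_def)
  also have "\<dots> = (\<Sum>t\<in>T. \<Sum>x\<in>Y. if f t x \<in> A then 1 else 0)" by (rule sum.swap)
  also have "\<dots> = (\<Sum>t\<in>T. real (card {x \<in> Y. f t x \<in> A}))"
    using fin(3) by (intro sum.cong refl) (simp add: sum.If_cases Int_def)
  also have "\<dots> \<le> real (card T) * real (card A)"
  proof (rule sum_bounded_above)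
    fix t assume "t \<in> T"
    then have "card {x \<in> Y. f t x \<in> A} \<le> card A"
      using fin(4) by (intro card_inj_on_le[of "f t"] inj_on_subset[OF inj]) auto
    then show "real (card {x \<in> Y. f t x \<in> A}) \<le> real (card A)" by simp
  qed
  finally have "real (card T) * (c * real (card Y)) \<le> real (card T) * real (card A)"
    by (simp add: ac_simps)
  then show ?thesis using T0 by simp
qed

text \<open>The set \<open>Q\<close> collects the pairs that a tile had to give up because one of their coordinates was already
  matched. Invariance is only asked of \<open>M \<union> Q\<close>, which is a union of complete tiles, so
  that the errors made at different scales do not accumulate.\<close>

definition tiled ::
  "('a \<Rightarrow> 'x \<Rightarrow> 'x) \<Rightarrow> ('a \<Rightarrow> 'x \<Rightarrow> 'x) \<Rightarrow> 'x set \<Rightarrow> 'a set \<Rightarrow> real \<Rightarrow> real \<Rightarrow> ('x \<times> 'x) set \<Rightarrow> ('x \<times> 'x) set \<Rightarrow> bool" where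
  "tiled \<rho>\<^sub>1 \<rho>\<^sub>2 V K \<epsilon> \<beta> M Q \<longleftrightarrow>
     M \<subseteq> V \<times> V \<and> Q \<subseteq> V \<times> V \<and> inj_on fst M \<and> inj_on snd M \<and> real (card Q) \<le> \<epsilon> * real (card M) \<and>
     real (card {p \<in> M. \<exists>g\<in>K. map_prod (\<rho>\<^sub>1 g) (\<rho>\<^sub>2 g) p \<notin> M \<union> Q}) \<le> \<beta>"

lemma tiled_card_le: "tiled \<rho>\<^sub>1 \<rho>\<^sub>2 V K \<epsilon> \<beta> M Q \<Longrightarrow> finite V \<Longrightarrow> card M \<le> card V"
  unfolding tiled_def by (intro card_inj_on_le[of fst]) auto

lemma tiled_mono:
  assumes t: "tiled \<rho>\<^sub>1 \<rho>\<^sub>2 V K \<epsilon> \<beta> M Q" and V: "finite V" and le: "K' \<subseteq> K" "\<beta> \<le> \<beta>'"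
  shows "tiled \<rho>\<^sub>1 \<rho>\<^sub>2 V K' \<epsilon> \<beta>' M Q"
proof -
  have "finite M" using t V unfolding tiled_def by (meson finite_SigmaI finite_subset)
  then have "card {p \<in> M. \<exists>g\<in>K'. map_prod (\<rho>\<^sub>1 g) (\<rho>\<^sub>2 g) p \<notin> M \<union> Q}
      \<le> card {p \<in> M. \<exists>g\<in>K. map_prod (\<rho>\<^sub>1 g) (\<rho>\<^sub>2 g) p \<notin> M \<union> Q}"
    using le by (intro card_mono) auto
  then show ?thesis using t le unfolding tiled_def by linarith
qed

text \<open>At most an \<open>\<epsilon> / 2\<close> part of the tile collides with
  \<open>M\<close>. That part goes into \<open>Q\<close>, so the whole tile lies in
  \<open>M' \<union> Q'\<close> and only its own Folner boundary can violate invariance. As at least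
  half of the tile is new, this boundary costs at most \<open>2 * \<delta>\<close> per newly matched
  pair. Expressed per new pair, the costs of successive tiles telescope, with total at most
  \<open>2 * \<delta> * card V\<close>.\<close>

lemma add_tile:
  fixes G :: "('a, 'b) monoid_scheme" and V :: "'x set"
  assumes tiled: "tiled \<rho>\<^sub>1 \<rho>\<^sub>2 V K \<epsilon> \<beta> M Q" and V: "finite V" and \<epsilon>: "0 < \<epsilon>" "\<epsilon> \<le> 1" and \<delta>: "0 \<le> \<delta>"
    and T: "finite T" "T \<noteq> {}"
    and inner: "real (card {t \<in> T. \<exists>g\<in>K. g \<otimes>\<^bsub>G\<^esub> t \<notin> T}) \<le> \<delta> * real (card T)"
    and tV: "\<And>t. t \<in> T \<Longrightarrow> \<rho>\<^sub>1 t x \<in> V \<and> \<rho>\<^sub>2 t y \<in> V"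
    and mult: "\<And>g t. g \<in> K \<Longrightarrow> t \<in> T \<Longrightarrow> \<rho>\<^sub>1 g (\<rho>\<^sub>1 t x) = \<rho>\<^sub>1 (g \<otimes>\<^bsub>G\<^esub> t) x \<and> \<rho>\<^sub>2 g (\<rho>\<^sub>2 t y) = \<rho>\<^sub>2 (g \<otimes>\<^bsub>G\<^esub> t) y"
    and inj: "inj_on (\<lambda>t. \<rho>\<^sub>1 t x) T" "inj_on (\<lambda>t. \<rho>\<^sub>2 t y) T"
    and few: "real (card {t \<in> T. \<rho>\<^sub>1 t x \<in> fst ` M \<or> \<rho>\<^sub>2 t y \<in> snd ` M}) \<le> \<epsilon> / 2 * real (card T)"
  obtains M' Q' where "M \<subseteq> M'" "Q \<subseteq> Q'" "card M < card M'"
    "tiled \<rho>\<^sub>1 \<rho>\<^sub>2 V K \<epsilon> (\<beta> + 2 * \<delta> * (real (card M') - real (card M))) M' Q'"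
proof -
  define D where "D = {t \<in> T. \<rho>\<^sub>1 t x \<in> fst ` M \<or> \<rho>\<^sub>2 t y \<in> snd ` M}"
  define pt where "pt t = (\<rho>\<^sub>1 t x, \<rho>\<^sub>2 t y)" for t
  define M' where "M' = M \<union> pt ` (T - D)"
  define Q' where "Q' = Q \<union> pt ` D"
  have tM: "M \<subseteq> V \<times> V" "Q \<subseteq> V \<times> V" "inj_on fst M" "inj_on snd M" "real (card Q) \<le> \<epsilon> * real (card M)"
    "real (card {p \<in> M. \<exists>g\<in>K. map_prod (\<rho>\<^sub>1 g) (\<rho>\<^sub>2 g) p \<notin> M \<union> Q}) \<le> \<beta>"
    using tiled unfolding tiled_def by auto
  have finV: "finite (V \<times> V)" using V by simp
  have fin: "finite M" "finite Q" using tM finite_subset[OF _ finV] by auto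
  have DT: "D \<subseteq> T" "finite D" using T unfolding D_def by auto
  have injpt: "inj_on pt T" using inj(1) unfolding pt_def inj_on_def by auto
  have disj: "M \<inter> pt ` (T - D) = {}" unfolding D_def pt_def by force
  have cN: "card (pt ` (T - D)) = card (T - D)"
    by (rule card_image) (rule inj_on_subset[OF injpt], auto)
  have cM: "card M' = card M + card (T - D)"
    unfolding M'_def using fin disj T cN by (simp add: card_Un_disjoint)
  have cT: "real (card T) = real (card (T - D)) + real (card D)"
    using DT T by (simp add: card_Diff_subset card_mono of_nat_diff)
  have dT: "real (card D) \<le> \<epsilon> / 2 * real (card T)" using few unfolding D_def .
  have T0: "real (card T) > 0" using T by (simp add: card_gt_0_iff)
  have "\<epsilon> / 2 * real (card T) \<le> 1 / 2 * real (card T)" using \<epsilon> by (intro mult_right_mono) auto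
  then have half: "real (card T) \<le> 2 * real (card (T - D))" using cT dT by linarith
  show thesis
  proof (rule that[of M' Q'])
    show "M \<subseteq> M'" "Q \<subseteq> Q'" unfolding M'_def Q'_def by auto
    show "card M < card M'" using cM half T0 by linarith
    show "tiled \<rho>\<^sub>1 \<rho>\<^sub>2 V K \<epsilon> (\<beta> + 2 * \<delta> * (real (card M') - real (card M))) M' Q'"
      unfolding tiled_def
    proof (intro conjI)
      have ptV: "pt ` T \<subseteq> V \<times> V" using tV unfolding pt_def by auto
      show "M' \<subseteq> V \<times> V" using tM(1) ptV unfolding M'_def by blast
      show "Q' \<subseteq> V \<times> V" using tM(2) ptV DT unfolding Q'_def by blast
      have "inj_on fst (pt ` (T - D))" "inj_on snd (pt ` (T - D))"
        using inj unfolding pt_def inj_on_def by auto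
      moreover have avoid: "A \<inter> f ` (T - {t \<in> T. f t \<in> A \<or> h t \<in> B}) = {}"
        "B \<inter> h ` (T - {t \<in> T. f t \<in> A \<or> h t \<in> B}) = {}" for f h and A B :: "'x set"
        by auto
      have "fst ` M \<inter> fst ` pt ` (T - D) = {}"
        unfolding image_image pt_def fst_conv D_def by (rule avoid)
      then have "fst ` (M - pt ` (T - D)) \<inter> fst ` (pt ` (T - D) - M) = {}" by blast
      moreover have "snd ` M \<inter> snd ` pt ` (T - D) = {}"
        unfolding image_image pt_def snd_conv D_def by (rule avoid)
      then have "snd ` (M - pt ` (T - D)) \<inter> snd ` (pt ` (T - D) - M) = {}" by blast
      ultimately show "inj_on fst M'" "inj_on snd M'"
        using tM(3,4) unfolding M'_def by (simp_all add: inj_on_Un)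
      have "real (card Q') \<le> real (card Q) + real (card D)"
      proof -
        have "card Q' \<le> card Q + card (pt ` D)" unfolding Q'_def by (rule card_Un_le)
        also have "card (pt ` D) \<le> card D" using DT(2) by (rule card_image_le)
        finally show ?thesis by simp
      qed
      \<comment> \<open>The collisions are at most \<open>\<epsilon> / 2\<close> of the whole tile,
        hence at most \<epsilon> of its new part, which is at least half. This keeps
        \<open>Q\<close> below \<epsilon> times the size of \<open>M\<close>.\<close>
      also have "real (card D) \<le> \<epsilon> * real (card (T - D))"
      proof -
        have "\<epsilon> * real (card T) \<le> \<epsilon> * (2 * real (card (T - D)))"
          using half \<epsilon> by (intro mult_left_mono) auto
        then show ?thesis using dT by simp
      qed
      finally show "real (card Q') \<le> \<epsilon> * real (card M')"
        using tM(5) cM by (simp add: algebra_simps)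
      let ?I = "{t \<in> T. \<exists>g\<in>K. g \<otimes>\<^bsub>G\<^esub> t \<notin> T}"
      let ?old = "{p \<in> M. \<exists>g\<in>K. map_prod (\<rho>\<^sub>1 g) (\<rho>\<^sub>2 g) p \<notin> M \<union> Q}"
      have MQ: "M \<union> Q \<subseteq> M' \<union> Q'" "pt ` T \<subseteq> M' \<union> Q'" unfolding M'_def Q'_def by auto
      \<comment> \<open>A pair of \<open>M\<close> cannot become worse, because
        \<open>M \<union> Q\<close> only grows. A new pair \<open>pt t\<close> is carried to
        \<open>pt (g t)\<close>, which can be missing only if \<open>g t\<close> leaves
        \<open>T\<close>.\<close>
      have "{p \<in> M'. \<exists>g\<in>K. map_prod (\<rho>\<^sub>1 g) (\<rho>\<^sub>2 g) p \<notin> M' \<union> Q'} \<subseteq> ?old \<union> pt ` ?I"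
      proof
        fix p assume "p \<in> {p \<in> M'. \<exists>g\<in>K. map_prod (\<rho>\<^sub>1 g) (\<rho>\<^sub>2 g) p \<notin> M' \<union> Q'}"
        then obtain g where g: "p \<in> M'" "g \<in> K" "map_prod (\<rho>\<^sub>1 g) (\<rho>\<^sub>2 g) p \<notin> M' \<union> Q'" by blast
        show "p \<in> ?old \<union> pt ` ?I"
        proof (cases "p \<in> M")
          case True
          then show ?thesis using g MQ(1) by blast
        next
          case False
          then obtain t where t: "t \<in> T" "p = pt t" using g(1) unfolding M'_def by blast
          have "map_prod (\<rho>\<^sub>1 g) (\<rho>\<^sub>2 g) p = pt (g \<otimes>\<^bsub>G\<^esub> t)"
            using mult[OF g(2) t(1)] t(2) unfolding pt_def by simp
          then have "g \<otimes>\<^bsub>G\<^esub> t \<notin> T" using g(3) MQ(2) by auto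
          then show ?thesis using t g(2) by blast
        qed
      qed
      then have "card {p \<in> M'. \<exists>g\<in>K. map_prod (\<rho>\<^sub>1 g) (\<rho>\<^sub>2 g) p \<notin> M' \<union> Q'} \<le> card (?old \<union> pt ` ?I)"
        using fin(1) T(1) by (intro card_mono) auto
      also have "\<dots> \<le> card ?old + card (pt ` ?I)" by (rule card_Un_le)
      also have "card (pt ` ?I) \<le> card ?I" using T(1) by (intro card_image_le) auto
      finally have "real (card {p \<in> M'. \<exists>g\<in>K. map_prod (\<rho>\<^sub>1 g) (\<rho>\<^sub>2 g) p \<notin> M' \<union> Q'}) \<le> real (card ?old) + real (card ?I)"
        by simp
      also have "\<dots> \<le> \<beta> + \<delta> * real (card T)" using tM(6) inner by linarith
      also have "\<dots> \<le> \<beta> + \<delta> * (2 * real (card (T - D)))" using half \<delta> by (intro add_mono mult_left_mono) auto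
      finally show "real (card {p \<in> M'. \<exists>g\<in>K. map_prod (\<rho>\<^sub>1 g) (\<rho>\<^sub>2 g) p \<notin> M' \<union> Q'})
          \<le> \<beta> + 2 * \<delta> * (real (card M') - real (card M))"
        using cM by simp
    qed
  qed
qed

text \<open>Let \<open>Y\<close> be the points whose whole \<open>T\<close>-translate avoids the old
  matching \<open>M0\<close>. For them every hit of \<open>M\<close> is a hit of
  \<open>M - M0\<close>, so double counting makes the gain at least \<open>c * card Y\<close>. A
  point outside \<open>Y\<close> lies in \<open>N\<close>, or under \<open>M0\<close> or
  \<open>Q0\<close>, or is taken into \<open>M0\<close> by some \<open>t\<close> from outside
  \<open>M0\<close> and \<open>Q0\<close>. In the last case the element undoing \<open>t\<close>
  violates the invariance of \<open>M0\<close>, which leaves at most \<open>b\<close> such points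
  for each \<open>t\<close>. The projection is abstract because either side of the matching may be
  the one that makes progress.\<close>

lemma side_progress:
  fixes prj :: "'p \<Rightarrow> 'x" and act :: "'a \<Rightarrow> 'p \<Rightarrow> 'p" and c :: real
  assumes V: "finite V" and bij: "\<And>t. t \<in> T \<Longrightarrow> inj_on (\<rho> t) V" and T: "finite T" "T \<noteq> {}"
    and prj: "\<And>g p. prj (act g p) = \<rho> g (prj p)" and fin: "finite Q0" "finite M" and c: "0 \<le> c"
    and ret: "\<And>x t. x \<in> V - N \<Longrightarrow> t \<in> T \<Longrightarrow> \<exists>g\<in>K. \<rho> g (\<rho> t x) = x"
    and bad: "real (card {p \<in> M0. \<exists>g\<in>K. act g p \<notin> M0 \<union> Q0}) \<le> b"
    and M: "M0 \<subseteq> M" "inj_on prj M" and N: "N \<subseteq> V"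
    and many: "\<And>x. x \<in> V - N \<Longrightarrow> c * real (card T) \<le> real (card {t \<in> T. \<rho> t x \<in> prj ` M})"
  shows "c * (real (card V) - real (card N) - real (card M0) - real (card Q0) - real (card T) * b)
    \<le> real (card M) - real (card M0)"
proof -
  let ?B = "{p \<in> M0. \<exists>g\<in>K. act g p \<notin> M0 \<union> Q0}"
  define Y where "Y = {x \<in> V - N. \<forall>t\<in>T. \<rho> t x \<notin> prj ` M0}"
  define R where "R t = {x \<in> V - N. x \<notin> prj ` M0 \<union> prj ` Q0 \<and> \<rho> t x \<in> prj ` M0}" for t
  have finM0: "finite M0" using fin M by (meson finite_subset)
  have finR: "finite (R t)" for t unfolding R_def using V by simp
  have RB: "card (R t) \<le> card ?B" if t: "t \<in> T" for t
  proof -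
    have "card (R t) \<le> card (prj ` ?B)"
    proof (rule card_inj_on_le[of "\<rho> t"])
      show "inj_on (\<rho> t) (R t)" by (rule inj_on_subset[OF bij[OF t]]) (auto simp: R_def)
      show "\<rho> t ` R t \<subseteq> prj ` ?B"
      proof (rule image_subsetI)
        fix x assume x: "x \<in> R t"
        then obtain p where p: "p \<in> M0" "\<rho> t x = prj p" unfolding R_def by blast
        obtain g where g: "g \<in> K" "\<rho> g (\<rho> t x) = x" using ret[of x t] x t unfolding R_def by blast
        then have "prj (act g p) = x" using prj p by simp
        then have "act g p \<notin> M0 \<union> Q0" using x unfolding R_def by blast
        then show "\<rho> t x \<in> prj ` ?B" using p g by blast
      qed
      show "finite (prj ` ?B)" using finM0 by simp
    qed
    also have "\<dots> \<le> card ?B" using finM0 by (intro card_image_le) auto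
    finally show ?thesis .
  qed
  have "V \<subseteq> Y \<union> (N \<union> (prj ` M0 \<union> (prj ` Q0 \<union> (\<Union>t\<in>T. R t))))"
    unfolding Y_def R_def by blast
  then have "card V \<le> card (Y \<union> (N \<union> (prj ` M0 \<union> (prj ` Q0 \<union> (\<Union>t\<in>T. R t)))))"
    using V T fin finM0 finR N by (intro card_mono) (auto simp: Y_def intro: finite_subset)
  also have "\<dots> \<le> card Y + (card N + (card (prj ` M0) + (card (prj ` Q0) + card (\<Union>t\<in>T. R t))))"
    by (intro order_trans[OF card_Un_le] add_left_mono order_refl)
  also have "card (\<Union>t\<in>T. R t) \<le> (\<Sum>t\<in>T. card (R t))" using T by (intro card_UN_le)
  also have "(\<Sum>t\<in>T. card (R t)) \<le> card T * card ?B"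
    using RB sum_bounded_above[of T "\<lambda>t. card (R t)" "card ?B"] by simp
  also have "card (prj ` M0) \<le> card M0" using finM0 by (rule card_image_le)
  also have "card (prj ` Q0) \<le> card Q0" using fin by (intro card_image_le)
  finally have "real (card V) \<le> real (card Y) + (real (card N) + (real (card M0) + (real (card Q0) + real (card T) * real (card ?B))))"
    unfolding of_nat_mult[symmetric] of_nat_add[symmetric] of_nat_le_iff by simp
  also have "real (card T) * real (card ?B) \<le> real (card T) * b" using bad by (intro mult_left_mono) auto
  finally have Y: "real (card V) - real (card N) - real (card M0) - real (card Q0) - real (card T) * b \<le> real (card Y)"
    by simp
  have "c * real (card Y) \<le> real (card (prj ` (M - M0)))"
  proof (rule double_count[where f = \<rho>, OF T])
    show "finite Y" "finite (prj ` (M - M0))" using V fin by (auto simp: Y_def)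
    show "inj_on (\<rho> t) Y" if "t \<in> T" for t
      by (rule inj_on_subset[OF bij[OF that]]) (auto simp: Y_def)
    fix x assume x: "x \<in> Y"
    then have "{t \<in> T. \<rho> t x \<in> prj ` M} \<subseteq> {t \<in> T. \<rho> t x \<in> prj ` (M - M0)}" unfolding Y_def by blast
    then have "card {t \<in> T. \<rho> t x \<in> prj ` M} \<le> card {t \<in> T. \<rho> t x \<in> prj ` (M - M0)}"
      using T by (intro card_mono) auto
    moreover have "c * real (card T) \<le> real (card {t \<in> T. \<rho> t x \<in> prj ` M})"
      using x by (intro many) (simp add: Y_def)
    ultimately show "c * real (card T) \<le> real (card {t \<in> T. \<rho> t x \<in> prj ` (M - M0)})" by linarith
  qed
  also have "card (prj ` (M - M0)) \<le> card (M - M0)" using fin by (intro card_image_le) auto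
  also have "card (M - M0) = card M - card M0" using M finM0 by (intro card_Diff_subset)
  finally have "c * real (card Y) \<le> real (card M) - real (card M0)"
    using card_mono[OF fin(2) M(1)] by (simp add: of_nat_diff)
  moreover have "c * (real (card V) - real (card N) - real (card M0) - real (card Q0) - real (card T) * b) \<le> c * real (card Y)"
    using Y c by (rule mult_left_mono)
  ultimately show ?thesis by linarith
qed


text \<open>A largest matching that extends \<open>M0\<close> by tiles admits no further tile. If on
  each side some good point met \<open>M\<close> in less than \<open>\<epsilon> / 4\<close> of its
  translates, the two points would give a tile with less than \<open>\<epsilon> / 2\<close>
  collisions. So on one side all good points meet \<open>M\<close> in at least that proportion, and
  \<open>side_progress\<close> applies. The slack \<open>2 * \<epsilon>\<close> consists of
  \<open>\<epsilon> / 2\<close> for bad points, \<epsilon> for \<open>Q0\<close>, and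
  \<open>\<epsilon> / 2\<close> for the points lost at the border of \<open>M0\<close>, by the bound
  on \<open>card T * \<gamma>\<close>.\<close>

lemma tiled_extend:
  fixes G :: "('a, 'b) monoid_scheme" and V :: "'x set"
  assumes G: "group G" and tiled: "tiled \<rho>\<^sub>1 \<rho>\<^sub>2 V (K \<union> m_inv G ` T) \<epsilon> (\<gamma> * real (card V)) M0 Q0"
    and act: "approx_action G \<rho>\<^sub>1 V E (\<epsilon> / 2)" "approx_action G \<rho>\<^sub>2 V E (\<epsilon> / 2)"
    and E: "K \<union> T \<union> m_inv G ` T \<subseteq> E"
    and \<epsilon>: "0 < \<epsilon>" "\<epsilon> \<le> 1" and \<delta>: "0 \<le> \<delta>" and \<gamma>: "real (card T) * \<gamma> \<le> \<epsilon> / 2"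
    and T: "finite T" "T \<noteq> {}" "T \<subseteq> carrier G"
    and inner: "real (card {t \<in> T. \<exists>g\<in>K. g \<otimes>\<^bsub>G\<^esub> t \<notin> T}) \<le> \<delta> * real (card T)"
  obtains M Q where "tiled \<rho>\<^sub>1 \<rho>\<^sub>2 V K \<epsilon> ((\<gamma> + 2 * \<delta>) * real (card V)) M Q"
    "real (card V) - real (card M) - 2 * \<epsilon> * real (card V)
      \<le> (1 - \<epsilon> / 4) * (real (card V) - real (card M0) - 2 * \<epsilon> * real (card V))"
proof -
  interpret group G by (rule G)
  have V: "finite V" using act(1) unfolding approx_action_def by blast
  have bij: "bij_betw (\<rho>\<^sub>1 t) V V" "bij_betw (\<rho>\<^sub>2 t) V V" if "t \<in> carrier G" for t
    using act that unfolding approx_action_def by blast+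
  have finV: "finite (V \<times> V)" using V by simp
  let ?act = "\<lambda>g. map_prod (\<rho>\<^sub>1 g) (\<rho>\<^sub>2 g)"
  \<comment> \<open>Size is maximized among pairs that keep the error budget of
    \<open>add_tile\<close>, counted from \<open>M0\<close>, so that the largest one is still
    tiled.\<close>
  define P where "P MQ \<longleftrightarrow> M0 \<subseteq> fst MQ \<and> Q0 \<subseteq> snd MQ \<and>
    tiled \<rho>\<^sub>1 \<rho>\<^sub>2 V K \<epsilon> (\<gamma> * real (card V) + 2 * \<delta> * (real (card (fst MQ)) - real (card M0))) (fst MQ) (snd MQ)"
    for MQ :: "('x \<times> 'x) set \<times> ('x \<times> 'x) set"
  have "tiled \<rho>\<^sub>1 \<rho>\<^sub>2 V K \<epsilon> (\<gamma> * real (card V)) M0 Q0"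
    by (rule tiled_mono[OF tiled V]) auto
  then have P0: "P (M0, Q0)" unfolding P_def by simp
  have "\<exists>MQ. P MQ \<and> (\<forall>y. P y \<longrightarrow> card (fst y) \<le> card (fst MQ))"
  proof (rule ex_has_greatest_nat[where P = P, OF P0])
    show "\<forall>y. P y \<longrightarrow> card (fst y) < Suc (card V)"
    proof (intro allI impI)
      fix y assume "P y"
      then show "card (fst y) < Suc (card V)"
        unfolding P_def using tiled_card_le[OF _ V] by (auto simp: less_Suc_eq_le)
    qed
  qed
  then obtain M Q where PM: "P (M, Q)" and max: "\<And>M' Q'. P (M', Q') \<Longrightarrow> card M' \<le> card M"
    by (metis fst_conv surj_pair)
  have sub: "M0 \<subseteq> M" "Q0 \<subseteq> Q"
    and tM: "tiled \<rho>\<^sub>1 \<rho>\<^sub>2 V K \<epsilon> (\<gamma> * real (card V) + 2 * \<delta> * (real (card M) - real (card M0))) M Q"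
    using PM unfolding P_def by auto
  have Minj: "inj_on fst M" "inj_on snd M" and MV: "M \<subseteq> V \<times> V" "finite M"
    using tM finite_subset[OF _ finV] unfolding tiled_def by blast+
  have M0Q0: "real (card Q0) \<le> \<epsilon> * real (card M0)" "finite Q0"
    "real (card {p \<in> M0. \<exists>g\<in>K \<union> m_inv G ` T. ?act g p \<notin> M0 \<union> Q0}) \<le> \<gamma> * real (card V)"
    using tiled finite_subset[OF _ finV] unfolding tiled_def by blast+
  have cM: "card M \<le> card V" using tM V by (rule tiled_card_le)
  have cM0: "card M0 \<le> card V" using tiled V by (rule tiled_card_le)
  define N1 where "N1 = {x \<in> V. \<not> good_pt G \<rho>\<^sub>1 E x}"
  define N2 where "N2 = {x \<in> V. \<not> good_pt G \<rho>\<^sub>2 E x}"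
  have N: "real (card N1) \<le> \<epsilon> / 2 * real (card V)" "real (card N2) \<le> \<epsilon> / 2 * real (card V)"
    using act unfolding approx_action_def N1_def N2_def by auto
  have step: "real (card V) - real (card M) - 2 * \<epsilon> * real (card V)
      \<le> (1 - \<epsilon> / 4) * (real (card V) - real (card M0) - 2 * \<epsilon> * real (card V))"
    if "real n \<le> \<epsilon> / 2 * real (card V)"
      and "\<epsilon> / 4 * (real (card V) - real n - real (card M0) - real (card Q0) - real (card T) * (\<gamma> * real (card V)))
        \<le> real (card M) - real (card M0)" for n
  proof -
    have "\<epsilon> * real (card M0) \<le> \<epsilon> * real (card V)" using cM0 \<epsilon> by (intro mult_left_mono) auto
    then have "real (card Q0) \<le> \<epsilon> * real (card V)" using M0Q0(1) by linarith
    moreover have "real (card T) * (\<gamma> * real (card V)) \<le> \<epsilon> / 2 * real (card V)"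
      using \<gamma> by (metis mult.assoc mult_right_mono of_nat_0_le_iff)
    ultimately have "real (card V) - real (card M0) - 2 * \<epsilon> * real (card V)
        \<le> real (card V) - real n - real (card M0) - real (card Q0) - real (card T) * (\<gamma> * real (card V))"
      using that(1) by linarith
    then have "\<epsilon> / 4 * (real (card V) - real (card M0) - 2 * \<epsilon> * real (card V)) \<le> real (card M) - real (card M0)"
      using that(2) \<epsilon> by (meson divide_nonneg_pos less_imp_le mult_left_mono order_trans zero_less_numeral)
    then show ?thesis by (simp add: algebra_simps)
  qed
  \<comment> \<open>The reason for demanding that the old matching be almost invariant under the
    inverses of \<open>T\<close>: at a good point they undo the action of \<open>T\<close>.\<close>
  have ret: "\<exists>g\<in>K \<union> m_inv G ` T. \<rho> g (\<rho> t x) = x" if "good_pt G \<rho> E x" "t \<in> T" for \<rho> :: "'a \<Rightarrow> 'x \<Rightarrow> 'x" and t x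
  proof
    have "t \<in> carrier G" using that T by blast
    moreover have "inv\<^bsub>G\<^esub> t \<in> E" "t \<in> E" using that E by auto
    ultimately show "\<rho> (inv\<^bsub>G\<^esub> t) (\<rho> t x) = x" using that(1) unfolding good_pt_def by simp
    show "inv\<^bsub>G\<^esub> t \<in> K \<union> m_inv G ` T" using that by blast
  qed
  have "(\<forall>x\<in>V - N1. \<epsilon> / 4 * real (card T) \<le> real (card {t \<in> T. \<rho>\<^sub>1 t x \<in> fst ` M}))
      \<or> (\<forall>y\<in>V - N2. \<epsilon> / 4 * real (card T) \<le> real (card {t \<in> T. \<rho>\<^sub>2 t y \<in> snd ` M}))"
  proof (rule ccontr)
    assume "\<not> ?thesis"
    then obtain x y where x: "x \<in> V - N1" "real (card {t \<in> T. \<rho>\<^sub>1 t x \<in> fst ` M}) < \<epsilon> / 4 * real (card T)"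
      and y: "y \<in> V - N2" "real (card {t \<in> T. \<rho>\<^sub>2 t y \<in> snd ` M}) < \<epsilon> / 4 * real (card T)"
      by (auto simp: not_le)
    have good: "good_pt G \<rho>\<^sub>1 E x" "good_pt G \<rho>\<^sub>2 E y" using x y unfolding N1_def N2_def by auto
    have KE: "K \<subseteq> E" "T \<subseteq> E" using E by auto
    have "{t \<in> T. \<rho>\<^sub>1 t x \<in> fst ` M \<or> \<rho>\<^sub>2 t y \<in> snd ` M} = {t \<in> T. \<rho>\<^sub>1 t x \<in> fst ` M} \<union> {t \<in> T. \<rho>\<^sub>2 t y \<in> snd ` M}"
      by blast
    then have "card {t \<in> T. \<rho>\<^sub>1 t x \<in> fst ` M \<or> \<rho>\<^sub>2 t y \<in> snd ` M}
        \<le> card {t \<in> T. \<rho>\<^sub>1 t x \<in> fst ` M} + card {t \<in> T. \<rho>\<^sub>2 t y \<in> snd ` M}"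
      by (simp add: card_Un_le)
    then have few: "real (card {t \<in> T. \<rho>\<^sub>1 t x \<in> fst ` M \<or> \<rho>\<^sub>2 t y \<in> snd ` M}) \<le> \<epsilon> / 2 * real (card T)"
      using x(2) y(2) by linarith
    have tV: "\<rho>\<^sub>1 t x \<in> V \<and> \<rho>\<^sub>2 t y \<in> V" if "t \<in> T" for t
      using bij[of t] that T(3) x(1) y(1) by (meson DiffD1 bij_betwE subsetD)
    have mlt: "\<rho>\<^sub>1 g (\<rho>\<^sub>1 t x) = \<rho>\<^sub>1 (g \<otimes>\<^bsub>G\<^esub> t) x \<and> \<rho>\<^sub>2 g (\<rho>\<^sub>2 t y) = \<rho>\<^sub>2 (g \<otimes>\<^bsub>G\<^esub> t) y"
      if "g \<in> K" "t \<in> T" for g t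
      using good KE that unfolding good_pt_def by blast
    have inj: "inj_on (\<lambda>t. \<rho>\<^sub>1 t x) T" "inj_on (\<lambda>t. \<rho>\<^sub>2 t y) T"
      using good KE(2) inj_on_subset unfolding good_pt_def by blast+
    obtain M' Q' where MQ: "M \<subseteq> M'" "Q \<subseteq> Q'" "card M < card M'"
      "tiled \<rho>\<^sub>1 \<rho>\<^sub>2 V K \<epsilon> (\<gamma> * real (card V) + 2 * \<delta> * (real (card M) - real (card M0))
          + 2 * \<delta> * (real (card M') - real (card M))) M' Q'"
      by (rule add_tile[OF tM V \<epsilon> \<delta> T(1,2) inner tV mlt inj few])
    have "P (M', Q')"
      using MQ(1,2,4) sub unfolding P_def by (auto simp: algebra_simps)
    then show False using max MQ(3) by fastforce
  qed
  then have "real (card V) - real (card M) - 2 * \<epsilon> * real (card V)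
      \<le> (1 - \<epsilon> / 4) * (real (card V) - real (card M0) - 2 * \<epsilon> * real (card V))"
  proof
    assume many: "\<forall>x\<in>V - N1. \<epsilon> / 4 * real (card T) \<le> real (card {t \<in> T. \<rho>\<^sub>1 t x \<in> fst ` M})"
    show ?thesis
    proof (rule step[OF N(1)], rule side_progress[where \<rho> = \<rho>\<^sub>1 and prj = fst and act = ?act, OF V _ T(1,2) _ M0Q0(2) MV(2) _ _ M0Q0(3) sub(1) Minj(1)])
      show "inj_on (\<rho>\<^sub>1 t) V" if "t \<in> T" for t using bij(1) that T(3) by (meson bij_betw_def subsetD)
      show "fst (?act g p) = \<rho>\<^sub>1 g (fst p)" for g p by simp
      show "0 \<le> \<epsilon> / 4" using \<epsilon> by simp
      show "\<exists>g\<in>K \<union> m_inv G ` T. \<rho>\<^sub>1 g (\<rho>\<^sub>1 t x) = x" if "x \<in> V - N1" "t \<in> T" for x t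
        using that by (intro ret) (auto simp: N1_def)
      show "N1 \<subseteq> V" by (auto simp: N1_def)
    qed (use many in blast)
  next
    assume many: "\<forall>y\<in>V - N2. \<epsilon> / 4 * real (card T) \<le> real (card {t \<in> T. \<rho>\<^sub>2 t y \<in> snd ` M})"
    show ?thesis
    proof (rule step[OF N(2)], rule side_progress[where \<rho> = \<rho>\<^sub>2 and prj = snd and act = ?act, OF V _ T(1,2) _ M0Q0(2) MV(2) _ _ M0Q0(3) sub(1) Minj(2)])
      show "inj_on (\<rho>\<^sub>2 t) V" if "t \<in> T" for t using bij(2) that T(3) by (meson bij_betw_def subsetD)
      show "snd (?act g p) = \<rho>\<^sub>2 g (snd p)" for g p by simp
      show "0 \<le> \<epsilon> / 4" using \<epsilon> by simp
      show "\<exists>g\<in>K \<union> m_inv G ` T. \<rho>\<^sub>2 g (\<rho>\<^sub>2 t x) = x" if "x \<in> V - N2" "t \<in> T" for x t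
        using that by (intro ret) (auto simp: N2_def)
      show "N2 \<subseteq> V" by (auto simp: N2_def)
    qed (use many in blast)
  qed
  moreover have "tiled \<rho>\<^sub>1 \<rho>\<^sub>2 V K \<epsilon> ((\<gamma> + 2 * \<delta>) * real (card V)) M Q"
  proof (rule tiled_mono[OF tM V order_refl])
    have "2 * \<delta> * (real (card M) - real (card M0)) \<le> 2 * \<delta> * real (card V)"
      using cM \<delta> by (intro mult_left_mono) auto
    then show "\<gamma> * real (card V) + 2 * \<delta> * (real (card M) - real (card M0)) \<le> (\<gamma> + 2 * \<delta>) * real (card V)"
      by (simp add: algebra_simps)
  qed
  ultimately show thesis by (rule that[rotated])
qed

text \<open>Induction on the number of scales. The tile chosen in a step is applied last: the
  induction hypothesis, used with the inverses of \<open>T\<close> added to \<open>K\<close>,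
  provides a matching by larger tiles on which \<open>T\<close> can make progress. Each scale
  multiplies the uncovered part, less the fixed slack \<open>2 * \<epsilon>\<close>, by
  \<open>1 - \<epsilon> / 4\<close>; the slack itself does not accumulate.\<close>

lemma folner_tiling:
  fixes G :: "('a, 'b) monoid_scheme" and K :: "'a set"
  assumes G: "group G" and fol: "folner G" and \<epsilon>: "0 < \<epsilon>" "\<epsilon> \<le> 1"
    and K: "finite K" "K \<subseteq> carrier G" and \<gamma>: "0 < \<gamma>"
  shows "\<exists>E \<eta>. finite E \<and> E \<subseteq> carrier G \<and> \<eta> > 0 \<and>
    (\<forall>(V :: 'x set) \<rho>\<^sub>1 \<rho>\<^sub>2. approx_action G \<rho>\<^sub>1 V E \<eta> \<and> approx_action G \<rho>\<^sub>2 V E \<eta> \<longrightarrow>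
      (\<exists>M Q. tiled \<rho>\<^sub>1 \<rho>\<^sub>2 V K \<epsilon> (\<gamma> * real (card V)) M Q \<and>
        real (card V) - real (card M) - 2 * \<epsilon> * real (card V) \<le> (1 - \<epsilon> / 4) ^ n * real (card V)))"
  using K \<gamma>
proof (induction n arbitrary: K \<gamma>)
  case 0
  have "tiled \<rho>\<^sub>1 \<rho>\<^sub>2 V K \<epsilon> (\<gamma> * real (card V)) {} {}" for \<rho>\<^sub>1 \<rho>\<^sub>2 and V :: "'x set"
    using 0 by (simp add: tiled_def)
  moreover have "real (card V) - real (card {}) - 2 * \<epsilon> * real (card V) \<le> (1 - \<epsilon> / 4) ^ 0 * real (card V)"
    for V :: "'x set" using \<epsilon> by simp
  ultimately show ?case by (intro exI[of _ "{}"] exI[of _ "1::real"] conjI allI impI) (blast | simp)+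
next
  case (Suc n)
  interpret group G by (rule G)
  obtain T where T: "finite T" "T \<noteq> {}" "T \<subseteq> carrier G"
    and inner: "real (card {t \<in> T. \<exists>g\<in>K. g \<otimes>\<^bsub>G\<^esub> t \<notin> T}) \<le> \<gamma> / 4 * real (card T)"
    by (rule folnerE[OF fol Suc.prems(1,2), of "\<gamma> / 4"]) (use Suc.prems(3) in auto)
  have T0: "real (card T) > 0" using T by (simp add: card_gt_0_iff)
  \<comment> \<open>Half of \<gamma> is left to the larger scales; the other half is
    \<open>2 * (\<gamma> / 4)\<close>, the cost of the tiles \<open>T\<close>. The second bound
    makes \<open>card T * \<gamma>'\<close> at most \<open>\<epsilon> / 2\<close>, as
    \<open>tiled_extend\<close> demands.\<close>
  define \<gamma>' where "\<gamma>' = min (\<gamma> / 2) (\<epsilon> / (2 * real (card T)))"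
  have \<gamma>': "0 < \<gamma>'" "\<gamma>' \<le> \<gamma> / 2" "real (card T) * \<gamma>' \<le> \<epsilon> / 2"
  proof -
    show "0 < \<gamma>'" "\<gamma>' \<le> \<gamma> / 2" using Suc.prems(3) \<epsilon> T0 by (auto simp: \<gamma>'_def)
    have "real (card T) * \<gamma>' \<le> real (card T) * (\<epsilon> / (2 * real (card T)))"
      by (intro mult_left_mono) (auto simp: \<gamma>'_def)
    then show "real (card T) * \<gamma>' \<le> \<epsilon> / 2" using T0 by simp
  qed
  have Tinv: "m_inv G ` T \<subseteq> carrier G" using T(3) by blast
  have K': "finite (K \<union> m_inv G ` T)" "K \<union> m_inv G ` T \<subseteq> carrier G"
    using Suc.prems(1,2) T(1) Tinv by auto
  obtain E \<eta> where E: "finite E" "E \<subseteq> carrier G" "\<eta> > 0"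
    and IH: "\<forall>(V :: 'x set) \<rho>\<^sub>1 \<rho>\<^sub>2. approx_action G \<rho>\<^sub>1 V E \<eta> \<and> approx_action G \<rho>\<^sub>2 V E \<eta> \<longrightarrow>
      (\<exists>M Q. tiled \<rho>\<^sub>1 \<rho>\<^sub>2 V (K \<union> m_inv G ` T) \<epsilon> (\<gamma>' * real (card V)) M Q \<and>
        real (card V) - real (card M) - 2 * \<epsilon> * real (card V) \<le> (1 - \<epsilon> / 4) ^ n * real (card V))"
    using Suc.IH[OF K' \<gamma>'(1)] by (elim exE conjE) (rule that, assumption+)
  let ?E = "E \<union> (K \<union> T \<union> m_inv G ` T)" and ?\<eta> = "min \<eta> (\<epsilon> / 2)"
  show ?case
  proof (intro exI[of _ ?E] exI[of _ ?\<eta>] conjI allI impI; (elim conjE)?)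
    show "finite ?E" "?E \<subseteq> carrier G" using E K' T Suc.prems by simp_all
    show "0 < ?\<eta>" using E \<epsilon> by simp
    fix V :: "'x set" and \<rho>\<^sub>1 \<rho>\<^sub>2
    assume act: "approx_action G \<rho>\<^sub>1 V ?E ?\<eta>" "approx_action G \<rho>\<^sub>2 V ?E ?\<eta>"
    have "approx_action G \<rho>\<^sub>1 V E \<eta>" "approx_action G \<rho>\<^sub>2 V E \<eta>"
      by (rule approx_action_mono[OF act(1)] approx_action_mono[OF act(2)]; simp)+
    then obtain M0 Q0 where M0: "tiled \<rho>\<^sub>1 \<rho>\<^sub>2 V (K \<union> m_inv G ` T) \<epsilon> (\<gamma>' * real (card V)) M0 Q0"
      "real (card V) - real (card M0) - 2 * \<epsilon> * real (card V) \<le> (1 - \<epsilon> / 4) ^ n * real (card V)"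
      using IH by blast
    have act': "approx_action G \<rho>\<^sub>1 V ?E (\<epsilon> / 2)" "approx_action G \<rho>\<^sub>2 V ?E (\<epsilon> / 2)"
      by (rule approx_action_mono[OF act(1)] approx_action_mono[OF act(2)]; simp)+
    have \<delta>: "0 \<le> \<gamma> / 4" using Suc.prems(3) by simp
    obtain M Q where M: "tiled \<rho>\<^sub>1 \<rho>\<^sub>2 V K \<epsilon> ((\<gamma>' + 2 * (\<gamma> / 4)) * real (card V)) M Q"
      "real (card V) - real (card M) - 2 * \<epsilon> * real (card V)
        \<le> (1 - \<epsilon> / 4) * (real (card V) - real (card M0) - 2 * \<epsilon> * real (card V))"
      by (rule tiled_extend[OF G M0(1) act' Un_upper2 \<epsilon> \<delta> \<gamma>'(3) T inner])
    have V: "finite V" using act unfolding approx_action_def by blast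
    have "tiled \<rho>\<^sub>1 \<rho>\<^sub>2 V K \<epsilon> (\<gamma> * real (card V)) M Q"
      by (rule tiled_mono[OF M(1) V order_refl], rule mult_right_mono) (use \<gamma>' in auto)
    moreover have "(1 - \<epsilon> / 4) * (real (card V) - real (card M0) - 2 * \<epsilon> * real (card V))
        \<le> (1 - \<epsilon> / 4) * ((1 - \<epsilon> / 4) ^ n * real (card V))"
      using M0(2) \<epsilon> by (intro mult_left_mono) auto
    then have "real (card V) - real (card M) - 2 * \<epsilon> * real (card V) \<le> (1 - \<epsilon> / 4) ^ Suc n * real (card V)"
      using M(2) by (simp add: mult.assoc)
    ultimately show "\<exists>M Q. tiled \<rho>\<^sub>1 \<rho>\<^sub>2 V K \<epsilon> (\<gamma> * real (card V)) M Q \<and>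
        real (card V) - real (card M) - 2 * \<epsilon> * real (card V) \<le> (1 - \<epsilon> / 4) ^ Suc n * real (card V)" by blast
  qed
qed

text \<open>The partial matching is completed by an arbitrary bijection between the uncovered points
  of the two sides. Equivariance then fails on a proportion of at most 5\<epsilon>: 3\<epsilon> for
  uncovered points, namely the slack \<open>2 * \<epsilon>\<close> plus
  \<open>(1 - \<epsilon> / 4) ^ n < \<epsilon>\<close>, one \<epsilon> for pairs carried outside
  \<open>M \<union> Q\<close>, and one for pairs carried into \<open>Q\<close>.\<close>

lemma folner_near_conjugate:
  fixes G :: "('a, 'b) monoid_scheme" and K :: "'a set"
  assumes G: "group G" and fol: "folner G" and K: "finite K" "K \<subseteq> carrier G" and \<theta>: "0 < \<theta>"
  obtains E \<eta> where "finite E" "E \<subseteq> carrier G" "\<eta> > 0"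
    "\<And>(V :: 'x set) \<rho>\<^sub>1 \<rho>\<^sub>2. approx_action G \<rho>\<^sub>1 V E \<eta> \<Longrightarrow> approx_action G \<rho>\<^sub>2 V E \<eta> \<Longrightarrow>
      \<exists>s. bij_betw s V V \<and> (\<forall>g\<in>K. real (card {x \<in> V. s (\<rho>\<^sub>1 g x) \<noteq> \<rho>\<^sub>2 g (s x)}) \<le> \<theta> * real (card V))"
proof -
  define \<epsilon> where "\<epsilon> = min 1 (\<theta> / 5)"
  have \<epsilon>: "0 < \<epsilon>" "\<epsilon> \<le> 1" "5 * \<epsilon> \<le> \<theta>" using \<theta> by (auto simp: \<epsilon>_def)
  have "\<exists>n. (1 - \<epsilon> / 4) ^ n < \<epsilon>" using \<epsilon> by (intro real_arch_pow_inv) auto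
  then obtain n where n: "(1 - \<epsilon> / 4) ^ n < \<epsilon>" by blast
  obtain E \<eta> where E: "finite E" "E \<subseteq> carrier G" "\<eta> > 0"
    and ex: "\<forall>(V :: 'x set) \<rho>\<^sub>1 \<rho>\<^sub>2. approx_action G \<rho>\<^sub>1 V E \<eta> \<and> approx_action G \<rho>\<^sub>2 V E \<eta> \<longrightarrow>
      (\<exists>M Q. tiled \<rho>\<^sub>1 \<rho>\<^sub>2 V K \<epsilon> (\<epsilon> * real (card V)) M Q \<and>
        real (card V) - real (card M) - 2 * \<epsilon> * real (card V) \<le> (1 - \<epsilon> / 4) ^ n * real (card V))"
    using folner_tiling[OF G fol \<epsilon>(1,2) K \<epsilon>(1), where n = n and ?'x = 'x]
    by (elim exE conjE) (rule that, assumption+)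
  show thesis
  proof (rule that[OF E])
    fix V :: "'x set" and \<rho>\<^sub>1 \<rho>\<^sub>2
    assume act: "approx_action G \<rho>\<^sub>1 V E \<eta>" "approx_action G \<rho>\<^sub>2 V E \<eta>"
    then have V: "finite V" and bij: "\<And>g. g \<in> carrier G \<Longrightarrow> bij_betw (\<rho>\<^sub>1 g) V V" "\<And>g. g \<in> carrier G \<Longrightarrow> bij_betw (\<rho>\<^sub>2 g) V V"
      unfolding approx_action_def by blast+
    obtain M Q where t: "tiled \<rho>\<^sub>1 \<rho>\<^sub>2 V K \<epsilon> (\<epsilon> * real (card V)) M Q"
      and cov: "real (card V) - real (card M) - 2 * \<epsilon> * real (card V) \<le> (1 - \<epsilon> / 4) ^ n * real (card V)"
      using ex act by blast
    have M: "M \<subseteq> V \<times> V" "Q \<subseteq> V \<times> V" "inj_on fst M" "inj_on snd M" "real (card Q) \<le> \<epsilon> * real (card M)"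
      "real (card {p \<in> M. \<exists>g\<in>K. map_prod (\<rho>\<^sub>1 g) (\<rho>\<^sub>2 g) p \<notin> M \<union> Q}) \<le> \<epsilon> * real (card V)"
      using t unfolding tiled_def by auto
    have finV: "finite (V \<times> V)" using V by simp
    have fin: "finite M" "finite Q" using finite_subset[OF _ finV] M(1,2) by blast+
    have sub: "fst ` M \<subseteq> V" "snd ` M \<subseteq> V" using M(1) by auto
    have "card (V - fst ` M) = card (V - snd ` M)"
      using sub V M(3,4) fin by (simp add: card_Diff_subset card_image finite_imageI)
    then obtain r where r: "bij_betw r (V - fst ` M) (V - snd ` M)"
      using finite_same_card_bij[of "V - fst ` M" "V - snd ` M"] V by blast
    define m where "m = snd \<circ> inv_into M fst"
    have m: "bij_betw m (fst ` M) (snd ` M)"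
      unfolding m_def
      by (rule bij_betw_trans[of _ _ M]) (use M(3,4) in \<open>auto simp: inj_on_imp_bij_betw bij_betw_inv_into\<close>)
    have mM: "m (fst p) = snd p" if "p \<in> M" for p using that M(3) by (simp add: m_def)
    define s where "s x = (if x \<in> fst ` M then m x else r x)" for x
    have "bij_betw s (fst ` M \<union> (V - fst ` M)) (snd ` M \<union> (V - snd ` M))"
    proof (rule bij_betw_combine)
      show "bij_betw s (fst ` M) (snd ` M)"
        using m by (rule bij_betw_cong[THEN iffD1, rotated]) (simp add: s_def)
      show "bij_betw s (V - fst ` M) (V - snd ` M)"
        using r by (rule bij_betw_cong[THEN iffD1, rotated]) (simp add: s_def)
    qed blast
    moreover have "fst ` M \<union> (V - fst ` M) = V" "snd ` M \<union> (V - snd ` M) = V" using sub by blast+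
    ultimately have s: "bij_betw s V V" by simp
    have sM: "s (fst p) = snd p" if "p \<in> M" for p using mM[OF that] that by (simp add: s_def)
    have "real (card {x \<in> V. s (\<rho>\<^sub>1 g x) \<noteq> \<rho>\<^sub>2 g (s x)}) \<le> \<theta> * real (card V)" if g: "g \<in> K" for g
    proof -
      let ?a = "map_prod (\<rho>\<^sub>1 g) (\<rho>\<^sub>2 g)"
      let ?B = "{p \<in> M. \<exists>g\<in>K. map_prod (\<rho>\<^sub>1 g) (\<rho>\<^sub>2 g) p \<notin> M \<union> Q}"
      let ?C = "{p \<in> M. ?a p \<in> Q}"
      have gc: "g \<in> carrier G" using g K by blast
      have "inj_on ?a (V \<times> V)"
        using bij[OF gc] by (auto simp: bij_betw_def map_prod_def inj_on_def)
      then have "card ?C \<le> card Q"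
        using M(1) fin by (intro card_inj_on_le[of ?a]) (auto intro: inj_on_subset)
      moreover have "real (card Q) \<le> \<epsilon> * real (card V)"
      proof -
        have "\<epsilon> * real (card M) \<le> \<epsilon> * real (card V)"
          using tiled_card_le[OF t V] \<epsilon> by (intro mult_left_mono) auto
        then show ?thesis using M(5) by linarith
      qed
      moreover have "card {x \<in> V. s (\<rho>\<^sub>1 g x) \<noteq> \<rho>\<^sub>2 g (s x)} \<le> card ((V - fst ` M) \<union> (fst ` ?B \<union> fst ` ?C))"
      proof (intro card_mono subsetI)
        show "finite ((V - fst ` M) \<union> (fst ` ?B \<union> fst ` ?C))" using V fin by simp
        fix x assume x: "x \<in> {x \<in> V. s (\<rho>\<^sub>1 g x) \<noteq> \<rho>\<^sub>2 g (s x)}"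
        show "x \<in> (V - fst ` M) \<union> (fst ` ?B \<union> fst ` ?C)"
        proof (cases "x \<in> fst ` M")
          case False then show ?thesis using x by blast
        next
          case True
          then obtain p where p: "p \<in> M" "x = fst p" by blast
          have "?a p \<notin> M"
          proof
            assume "?a p \<in> M"
            from sM[OF this] sM[OF p(1)] show False using x p by simp
          qed
          then have "p \<in> ?B \<union> ?C" using p g by blast
          then show ?thesis using p by blast
        qed
      qed
      moreover have "\<dots> \<le> card (V - fst ` M) + (card ?B + card ?C)"
        using fin by (intro order_trans[OF card_Un_le] add_mono card_image_le order_refl) auto
      moreover have "real (card (V - fst ` M)) = real (card V) - real (card M)"
        using sub(1) V M(3) fin tiled_card_le[OF t V] by (simp add: card_Diff_subset card_image of_nat_diff)
      moreover have "(1 - \<epsilon> / 4) ^ n * real (card V) \<le> \<epsilon> * real (card V)"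
        using n by (intro mult_right_mono) auto
      ultimately have "real (card {x \<in> V. s (\<rho>\<^sub>1 g x) \<noteq> \<rho>\<^sub>2 g (s x)}) \<le> 5 * (\<epsilon> * real (card V))"
        using cov M(6) by linarith
      also have "\<dots> = 5 * \<epsilon> * real (card V)" by simp
      also have "\<dots> \<le> \<theta> * real (card V)" using \<epsilon>(3) by (intro mult_right_mono) auto
      finally show ?thesis .
    qed
    then show "\<exists>s. bij_betw s V V \<and> (\<forall>g\<in>K. real (card {x \<in> V. s (\<rho>\<^sub>1 g x) \<noteq> \<rho>\<^sub>2 g (s x)}) \<le> \<theta> * real (card V))"
      using s by blast
  qed
qed

subsection \<open>Permutations modulo null sequences\<close>

text \<open>With \<open>P k j\<close> the equality of two permutations at \<open>j\<close>, this is
  equality of their classes in the metric ultraproduct. The predicate form allows finite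
  conjunctions and the substitution of permutations.\<close>

definition almost :: "nat filter \<Rightarrow> (nat \<Rightarrow> nat) \<Rightarrow> (nat \<Rightarrow> nat \<Rightarrow> bool) \<Rightarrow> bool" where
  "almost U n P \<longleftrightarrow> ((\<lambda>k. real (card {j \<in> {1..n k}. \<not> P k j}) / real (n k)) \<longlongrightarrow> 0) U"

lemma almost_mono:
  assumes "almost U n P" and "\<And>k j. j \<in> {1..n k} \<Longrightarrow> P k j \<Longrightarrow> Q k j"
  shows "almost U n Q"
  unfolding almost_def
proof (rule Lim_null_comparison[rotated])
  show "((\<lambda>k. real (card {j \<in> {1..n k}. \<not> P k j}) / real (n k)) \<longlongrightarrow> 0) U"
    using assms(1) unfolding almost_def .
  have "card {j \<in> {1..n k}. \<not> Q k j} \<le> card {j \<in> {1..n k}. \<not> P k j}" for k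
    using assms(2) by (intro card_mono) auto
  then show "\<forall>\<^sub>F k in U. norm (real (card {j \<in> {1..n k}. \<not> Q k j}) / real (n k))
      \<le> real (card {j \<in> {1..n k}. \<not> P k j}) / real (n k)"
    by (simp add: divide_right_mono)
qed

lemma almost_conj:
  assumes "almost U n P" "almost U n Q"
  shows "almost U n (\<lambda>k j. P k j \<and> Q k j)"
  unfolding almost_def
proof (rule Lim_null_comparison[rotated])
  show "((\<lambda>k. real (card {j \<in> {1..n k}. \<not> P k j}) / real (n k) + real (card {j \<in> {1..n k}. \<not> Q k j}) / real (n k)) \<longlongrightarrow> 0) U"
    using tendsto_add[OF assms[unfolded almost_def]] by simp
  have "card {j \<in> {1..n k}. \<not> (P k j \<and> Q k j)} \<le> card {j \<in> {1..n k}. \<not> P k j} + card {j \<in> {1..n k}. \<not> Q k j}" for k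
  proof -
    have "{j \<in> {1..n k}. \<not> (P k j \<and> Q k j)} = {j \<in> {1..n k}. \<not> P k j} \<union> {j \<in> {1..n k}. \<not> Q k j}" by blast
    then show ?thesis by (simp add: card_Un_le)
  qed
  then have "real (card {j \<in> {1..n k}. \<not> (P k j \<and> Q k j)})
      \<le> real (card {j \<in> {1..n k}. \<not> P k j}) + real (card {j \<in> {1..n k}. \<not> Q k j})" for k
    unfolding of_nat_add[symmetric] of_nat_le_iff .
  then show "\<forall>\<^sub>F k in U. norm (real (card {j \<in> {1..n k}. \<not> (P k j \<and> Q k j)}) / real (n k))
      \<le> real (card {j \<in> {1..n k}. \<not> P k j}) / real (n k) + real (card {j \<in> {1..n k}. \<not> Q k j}) / real (n k)"
    by (simp add: divide_right_mono flip: add_divide_distrib)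
qed

lemma almost_True: "almost U n (\<lambda>k j. True)"
  by (simp add: almost_def)

lemma almost_ball:
  assumes "finite I" "\<And>i. i \<in> I \<Longrightarrow> almost U n (P i)"
  shows "almost U n (\<lambda>k j. \<forall>i\<in>I. P i k j)"
  using assms
proof (induction I rule: finite_induct)
  case empty
  then show ?case by (simp add: almost_True)
next
  case (insert i I)
  have "almost U n (\<lambda>k j. P i k j \<and> (\<forall>i\<in>I. P i k j))"
    by (rule almost_conj) (use insert in auto)
  then show ?case by (rule almost_mono) simp
qed

text \<open>\<open>g k\<close> carries the exceptional points of the substituted predicate
  bijectively onto those of \<open>P\<close>, so the proportion is unchanged at every index.\<close>

lemma almost_permute:
  assumes g: "\<And>k. g k permutes {1..n k}" and P: "almost U n P"
  shows "almost U n (\<lambda>k j. P k (g k j))"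
proof -
  have "card {j \<in> {1..n k}. \<not> P k (g k j)} = card {j \<in> {1..n k}. \<not> P k j}" for k
  proof (rule bij_betw_same_card[of "g k"])
    show "bij_betw (g k) {j \<in> {1..n k}. \<not> P k (g k j)} {j \<in> {1..n k}. \<not> P k j}"
    proof (rule bij_betw_imageI)
      show "inj_on (g k) {j \<in> {1..n k}. \<not> P k (g k j)}"
        using permutes_inj[OF g] inj_on_subset by blast
      show "g k ` {j \<in> {1..n k}. \<not> P k (g k j)} = {j \<in> {1..n k}. \<not> P k j}"
      proof (intro equalityI subsetI)
        fix i assume i: "i \<in> {j \<in> {1..n k}. \<not> P k j}"
        have "g k (inv' (g k) i) = i" using permutes_inverses(1)[OF g] .
        moreover have "inv' (g k) i \<in> {1..n k}" using i permutes_in_image[OF permutes_inv[OF g]] by blast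
        ultimately have "inv' (g k) i \<in> {j \<in> {1..n k}. \<not> P k (g k j)}" using i by simp
        then show "i \<in> g k ` {j \<in> {1..n k}. \<not> P k (g k j)}"
          using \<open>g k (inv' (g k) i) = i\<close> by (metis imageI)
      next
        fix i assume "i \<in> g k ` {j \<in> {1..n k}. \<not> P k (g k j)}"
        then show "i \<in> {j \<in> {1..n k}. \<not> P k j}" using permutes_in_image[OF g] by blast
      qed
    qed
  qed
  then show ?thesis using P by (simp add: almost_def)
qed

lemma almost_eventually:
  assumes "almost U n P" "\<eta> > 0"
  shows "\<forall>\<^sub>F k in U. real (card {j \<in> {1..n k}. \<not> P k j}) \<le> \<eta> * real (n k)"
  using order_tendstoD(2)[OF assms(1)[unfolded almost_def] assms(2)]
proof eventually_elim
  case (elim k)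
  then show ?case
    by (cases "n k = 0") (auto simp: divide_less_eq intro: less_imp_le)
qed

lemma almostI:
  assumes n: "\<And>k. n k > 0"
    and ev: "\<And>\<eta>. \<eta> > 0 \<Longrightarrow> \<forall>\<^sub>F k in U. real (card {j \<in> {1..n k}. \<not> P k j}) \<le> \<eta> * real (n k)"
  shows "almost U n P"
  unfolding almost_def
proof (rule tendstoI)
  fix e :: real assume "e > 0"
  then have "e / 2 > 0" by simp
  from ev[OF this] show "\<forall>\<^sub>F k in U. dist (real (card {j \<in> {1..n k}. \<not> P k j}) / real (n k)) 0 < e"
  proof eventually_elim
    case (elim k)
    have "real (card {j \<in> {1..n k}. \<not> P k j}) / real (n k) \<le> e / 2"
      using elim n[of k] by (simp add: divide_le_eq)
    then have "real (card {j \<in> {1..n k}. \<not> P k j}) / real (n k) < e" using \<open>e > 0\<close> by linarith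
    then show ?case by (simp only: dist_real_def diff_zero abs_of_nonneg divide_nonneg_nonneg of_nat_0_le_iff)
  qed
qed

lemma not_almost_False:
  assumes "\<And>k. n k > 0" "U \<noteq> bot"
  shows "\<not> almost U n (\<lambda>k j. False)"
proof
  assume "almost U n (\<lambda>k j. False)"
  moreover have "real (card {j \<in> {1..n k}. \<not> False}) / real (n k) = 1" for k
  proof -
    have "{j \<in> {1..n k}. \<not> False} = {1..n k}" by blast
    then show ?thesis using assms(1)[of k] by (simp del: atLeastAtMost_iff)
  qed
  ultimately have "((\<lambda>k::nat. 1::real) \<longlongrightarrow> 0) U" unfolding almost_def by (simp only:)
  then show False using assms(2) tendsto_const_iff[of U "1::real" 0] by simp
qed

lemma hamming_dist_tendsto_0: "((\<lambda>k. hamming_dist (n k) (g k) (h k)) \<longlongrightarrow> 0) U \<longleftrightarrow> almost U n (\<lambda>k j. g k j = h k j)"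
  by (simp add: almost_def hamming_dist_def)

lemma hamming_dist_tendsto_1:
  assumes n: "\<And>k. n k > 0"
  shows "((\<lambda>k. hamming_dist (n k) (g k) (h k)) \<longlongrightarrow> 1) U \<longleftrightarrow> almost U n (\<lambda>k j. g k j \<noteq> h k j)"
proof -
  have "hamming_dist (n k) (g k) (h k) = 1 - real (card {j \<in> {1..n k}. \<not> g k j \<noteq> h k j}) / real (n k)" for k
  proof -
    have "card {j \<in> {1..n k}. g k j \<noteq> h k j} + card {j \<in> {1..n k}. \<not> g k j \<noteq> h k j}
        = card ({j \<in> {1..n k}. g k j \<noteq> h k j} \<union> {j \<in> {1..n k}. \<not> g k j \<noteq> h k j})"
      by (rule card_Un_disjoint[symmetric]) auto
    also have "{j \<in> {1..n k}. g k j \<noteq> h k j} \<union> {j \<in> {1..n k}. \<not> g k j \<noteq> h k j} = {1..n k}" by blast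
    finally have "real (card {j \<in> {1..n k}. g k j \<noteq> h k j}) = real (n k) - real (card {j \<in> {1..n k}. \<not> g k j \<noteq> h k j})"
      by simp
    then show ?thesis using n[of k] by (simp add: hamming_dist_def diff_divide_distrib)
  qed
  then have h: "(\<lambda>k. hamming_dist (n k) (g k) (h k))
      = (\<lambda>k. 1 - real (card {j \<in> {1..n k}. \<not> g k j \<noteq> h k j}) / real (n k))" by (rule ext)
  show ?thesis
  proof
    assume "((\<lambda>k. hamming_dist (n k) (g k) (h k)) \<longlongrightarrow> 1) U"
    from tendsto_diff[OF tendsto_const[of 1] this[unfolded h]] show "almost U n (\<lambda>k j. g k j \<noteq> h k j)"
      unfolding almost_def by simp
  next
    assume "almost U n (\<lambda>k j. g k j \<noteq> h k j)"
    from tendsto_diff[OF tendsto_const[of 1] this[unfolded almost_def]]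
    show "((\<lambda>k. hamming_dist (n k) (g k) (h k)) \<longlongrightarrow> 1) U" unfolding h by simp
  qed
qed


lemma carrier_sym_product: "g \<in> carrier (sym_product n) \<longleftrightarrow> (\<forall>k. g k permutes {1..n k})"
  by (auto simp: sym_product_def sym_group_carrier PiE_iff)

lemma mult_sym_product: "g \<otimes>\<^bsub>sym_product n\<^esub> h = (\<lambda>k. g k \<circ> h k)"
  by (simp add: sym_product_def sym_group_mult fun_eq_iff)

lemma null_sequences_iff:
  "g \<in> null_sequences U n \<longleftrightarrow> g \<in> carrier (sym_product n) \<and> almost U n (\<lambda>k j. g k j = j)"
  unfolding null_sequences_def sym_group_one mem_Collect_eq hamming_dist_tendsto_0 by simp

lemma subgroup_null_sequences: "subgroup (null_sequences U n) (sym_product n)"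
  using null_sequences_normal normal_imp_subgroup by blast

lemma useq_class_eq_iff:
  assumes g: "g \<in> carrier (sym_product n)" and h: "h \<in> carrier (sym_product n)"
  shows "useq_class U n g = useq_class U n h \<longleftrightarrow> almost U n (\<lambda>k j. g k j = h k j)"
proof -
  interpret P: group "sym_product n" by (rule group_sym_product)
  interpret N: subgroup "null_sequences U n" "sym_product n" by (rule subgroup_null_sequences)
  have hp: "h k permutes {1..n k}" for k using h by (simp add: carrier_sym_product)
  have "useq_class U n g = useq_class U n h \<longleftrightarrow> g \<in> useq_class U n h"
    unfolding useq_class_def
    using P.repr_independence[OF _ h subgroup_null_sequences] P.rcos_self[OF g subgroup_null_sequences] by blast
  also have "\<dots> \<longleftrightarrow> g \<otimes>\<^bsub>sym_product n\<^esub> inv\<^bsub>sym_product n\<^esub> h \<in> null_sequences U n"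
    unfolding useq_class_def by (rule N.rcos_module[OF group_sym_product h g])
  also have "\<dots> \<longleftrightarrow> almost U n (\<lambda>k j. g k (inv' (h k) j) = j)"
    using P.m_closed[OF g P.inv_closed[OF h]]
    unfolding null_sequences_iff inv_sym_product[OF h] mult_sym_product by simp
  also have "\<dots> \<longleftrightarrow> almost U n (\<lambda>k j. g k j = h k j)"
  proof
    assume "almost U n (\<lambda>k j. g k (inv' (h k) j) = j)"
    from almost_permute[OF hp this] show "almost U n (\<lambda>k j. g k j = h k j)"
      by (simp add: permutes_inverses(2)[OF hp])
  next
    assume "almost U n (\<lambda>k j. g k j = h k j)"
    from almost_permute[OF permutes_inv[OF hp] this] show "almost U n (\<lambda>k j. g k (inv' (h k) j) = j)"
      by (simp add: permutes_inverses(1)[OF hp])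
  qed
  finally show ?thesis .
qed

lemma carrier_universal_sofic:
  "c \<in> carrier (universal_sofic U n) \<longleftrightarrow> (\<exists>g\<in>carrier (sym_product n). c = useq_class U n g)"
  unfolding universal_sofic_def useq_class_def by (auto simp: FactGroup_def RCOSETS_def)

lemma useq_class_hom: "useq_class U n \<in> hom (sym_product n) (universal_sofic U n)"
proof -
  have "useq_class U n = (\<lambda>g. null_sequences U n #>\<^bsub>sym_product n\<^esub> g)"
    by (rule ext) (simp add: useq_class_def)
  then show ?thesis
    unfolding universal_sofic_def using normal.r_coset_hom_Mod[OF null_sequences_normal] by metis
qed

lemma group_hom_useq_class: "group_hom (sym_product n) (universal_sofic U n) (useq_class U n)"
  by (simp add: group_hom_def group_hom_axioms_def group_sym_product group_universal_sofic useq_class_hom)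

lemmas useq_class_mult = hom_mult[OF useq_class_hom]

subsection \<open>Sofic representations and approximate actions\<close>

text \<open>One choice of representatives serves every finite \<open>E\<close> and every tolerance,
  because each condition in \<open>good_pt\<close> is a finite conjunction over \<open>E\<close> of
  conditions that hold up to a vanishing proportion.\<close>

lemma sofic_rep_lift:
  assumes G: "group \<Lambda>" and n: "\<And>k. n k > 0" and rep: "sofic_rep U n \<Lambda> \<pi>"
  obtains \<sigma> where "\<And>x. x \<in> carrier \<Lambda> \<Longrightarrow> \<sigma> x \<in> carrier (sym_product n)"
    "\<And>x. x \<in> carrier \<Lambda> \<Longrightarrow> \<pi> x = useq_class U n (\<sigma> x)"
    "\<And>E \<eta>. finite E \<Longrightarrow> E \<subseteq> carrier \<Lambda> \<Longrightarrow> \<eta> > 0 \<Longrightarrow>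
      \<forall>\<^sub>F k in U. approx_action \<Lambda> (\<lambda>x. \<sigma> x k) {1..n k} E \<eta>"
proof -
  interpret G: group \<Lambda> by (rule G)
  interpret P: group "sym_product n" by (rule group_sym_product)
  have \<pi>: "\<pi> \<in> hom \<Lambda> (universal_sofic U n)"
    and free: "\<And>x g. x \<in> carrier \<Lambda> \<Longrightarrow> x \<noteq> \<one>\<^bsub>\<Lambda>\<^esub> \<Longrightarrow> g \<in> carrier (sym_product n) \<Longrightarrow> \<pi> x = useq_class U n g \<Longrightarrow>
      almost U n (\<lambda>k j. g k j \<noteq> j)"
    using rep hamming_dist_tendsto_1[OF n, where h = "\<lambda>_. id"] unfolding sofic_rep_def sym_group_one by auto
  have "\<forall>x\<in>carrier \<Lambda>. \<exists>g. g \<in> carrier (sym_product n) \<and> \<pi> x = useq_class U n g"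
    using hom_in_carrier[OF \<pi>] unfolding carrier_universal_sofic by blast
  then obtain \<sigma> where \<sigma>: "\<forall>x\<in>carrier \<Lambda>. \<sigma> x \<in> carrier (sym_product n) \<and> \<pi> x = useq_class U n (\<sigma> x)"
    by (rule bchoice[THEN exE])
  have car: "\<sigma> x \<in> carrier (sym_product n)" and cl: "\<pi> x = useq_class U n (\<sigma> x)"
    if "x \<in> carrier \<Lambda>" for x using \<sigma> that by blast+
  have perm: "\<sigma> x k permutes {1..n k}" if "x \<in> carrier \<Lambda>" for x k
    using car[OF that] by (simp add: carrier_sym_product)
  have mult: "almost U n (\<lambda>k j. \<sigma> x k (\<sigma> y k j) = \<sigma> (x \<otimes>\<^bsub>\<Lambda>\<^esub> y) k j)"
    if x: "x \<in> carrier \<Lambda>" and y: "y \<in> carrier \<Lambda>" for x y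
  proof -
    have "useq_class U n (\<sigma> x \<otimes>\<^bsub>sym_product n\<^esub> \<sigma> y) = \<pi> (x \<otimes>\<^bsub>\<Lambda>\<^esub> y)"
      using useq_class_mult[OF car[OF x] car[OF y]] hom_mult[OF \<pi> x y] cl x y by simp
    also have "\<dots> = useq_class U n (\<sigma> (x \<otimes>\<^bsub>\<Lambda>\<^esub> y))" using cl x y by simp
    finally have "almost U n (\<lambda>k j. (\<sigma> x \<otimes>\<^bsub>sym_product n\<^esub> \<sigma> y) k j = \<sigma> (x \<otimes>\<^bsub>\<Lambda>\<^esub> y) k j)"
      using useq_class_eq_iff[OF P.m_closed[OF car[OF x] car[OF y]] car[OF G.m_closed[OF x y]]] by blast
    then show ?thesis unfolding mult_sym_product by simp
  qed
  \<comment> \<open>Where \<open>\<sigma> \<one>\<close> satisfies the idempotent law at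
    \<open>j\<close>, injectivity forces it to fix \<open>j\<close>.\<close>
  have one: "almost U n (\<lambda>k j. \<sigma> \<one>\<^bsub>\<Lambda>\<^esub> k j = j)"
    using mult[OF G.one_closed G.one_closed]
  proof (rule almost_mono)
    fix k j assume "\<sigma> \<one>\<^bsub>\<Lambda>\<^esub> k (\<sigma> \<one>\<^bsub>\<Lambda>\<^esub> k j) = \<sigma> (\<one>\<^bsub>\<Lambda>\<^esub> \<otimes>\<^bsub>\<Lambda>\<^esub> \<one>\<^bsub>\<Lambda>\<^esub>) k j"
    then show "\<sigma> \<one>\<^bsub>\<Lambda>\<^esub> k j = j" using permutes_inj[OF perm[OF G.one_closed]] by (simp add: inj_eq)
  qed
  have ne: "almost U n (\<lambda>k j. \<sigma> x k j \<noteq> \<sigma> y k j)"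
    if x: "x \<in> carrier \<Lambda>" and y: "y \<in> carrier \<Lambda>" and xy: "x \<noteq> y" for x y
  proof -
    \<comment> \<open>Freeness speaks only of fixed points. Since \<open>x\<close> is the product of
      \<open>y\<close> and \<open>?z\<close>, the values of \<open>\<sigma> x\<close> and
      \<open>\<sigma> y\<close> at \<open>j\<close> agree, up to negligible sets, only where
      \<open>\<sigma> ?z\<close> fixes \<open>j\<close>.\<close>
    let ?z = "inv\<^bsub>\<Lambda>\<^esub> y \<otimes>\<^bsub>\<Lambda>\<^esub> x"
    have z: "?z \<in> carrier \<Lambda>" using x y by simp
    have yz: "y \<otimes>\<^bsub>\<Lambda>\<^esub> ?z = x" using x y by (simp add: G.m_assoc[symmetric])
    have "?z \<noteq> \<one>\<^bsub>\<Lambda>\<^esub>"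
    proof
      assume "?z = \<one>\<^bsub>\<Lambda>\<^esub>"
      then show False using yz y xy by simp
    qed
    from almost_conj[OF free[OF z this car[OF z] cl[OF z]] mult[OF y z]] show ?thesis
    proof (rule almost_mono)
      fix k j assume h: "\<sigma> ?z k j \<noteq> j \<and> \<sigma> y k (\<sigma> ?z k j) = \<sigma> (y \<otimes>\<^bsub>\<Lambda>\<^esub> ?z) k j"
      then have eq: "\<sigma> x k j = \<sigma> y k (\<sigma> ?z k j)" unfolding yz by simp
      show "\<sigma> x k j \<noteq> \<sigma> y k j" unfolding eq inj_eq[OF permutes_inj[OF perm[OF y]]] using h by blast
    qed
  qed
  show thesis
  proof (rule that[of \<sigma>, OF car cl])
    fix E and \<eta> :: real
    assume E: "finite E" "E \<subseteq> carrier \<Lambda>" and \<eta>: "\<eta> > 0"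
    have "almost U n (\<lambda>k j. \<forall>x\<in>E. \<forall>y\<in>E. \<sigma> x k (\<sigma> y k j) = \<sigma> (x \<otimes>\<^bsub>\<Lambda>\<^esub> y) k j)"
      by (intro almost_ball E(1) mult subsetD[OF E(2)])
    moreover have "almost U n (\<lambda>k j. \<forall>x\<in>E. \<forall>y\<in>E. x \<noteq> y \<longrightarrow> \<sigma> x k j \<noteq> \<sigma> y k j)"
    proof (intro almost_ball E(1))
      fix x y assume "x \<in> E" "y \<in> E"
      then have xy: "x \<in> carrier \<Lambda>" "y \<in> carrier \<Lambda>" using E(2) by blast+
      show "almost U n (\<lambda>k j. x \<noteq> y \<longrightarrow> \<sigma> x k j \<noteq> \<sigma> y k j)"
        by (cases "x = y") (use ne[OF xy] in \<open>simp_all add: almost_True\<close>)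
    qed
    ultimately have "almost U n (\<lambda>k j. \<sigma> \<one>\<^bsub>\<Lambda>\<^esub> k j = j \<and> (\<forall>x\<in>E. \<forall>y\<in>E. \<sigma> x k (\<sigma> y k j) = \<sigma> (x \<otimes>\<^bsub>\<Lambda>\<^esub> y) k j)
        \<and> (\<forall>x\<in>E. \<forall>y\<in>E. x \<noteq> y \<longrightarrow> \<sigma> x k j \<noteq> \<sigma> y k j))"
      by (intro almost_conj one)
    then have "almost U n (\<lambda>k j. good_pt \<Lambda> (\<lambda>x. \<sigma> x k) E j)"
      by (rule almost_mono) (auto simp: good_pt_def inj_on_def)
    from almost_eventually[OF this \<eta>]
    show "\<forall>\<^sub>F k in U. approx_action \<Lambda> (\<lambda>x. \<sigma> x k) {1..n k} E \<eta>"
    proof eventually_elim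
      case (elim k)
      then show ?case using perm by (simp add: approx_action_def permutes_imp_bij)
    qed
  qed
qed

text \<open>Converse of \<open>sofic_rep_lift\<close>: laws valid up to vanishing proportions become
  exact for the classes. Distance 1 is required of every representative \<open>g\<close>, hence the
  transfer from \<open>\<sigma> x\<close> to \<open>g\<close>.\<close>

lemma sofic_repI:
  assumes G: "group \<Lambda>" and U: "U \<noteq> bot" and n: "\<And>k. n k > 0"
    and car: "\<And>x. x \<in> carrier \<Lambda> \<Longrightarrow> \<sigma> x \<in> carrier (sym_product n)"
    and ev: "\<And>E \<eta>. finite E \<Longrightarrow> E \<subseteq> carrier \<Lambda> \<Longrightarrow> \<eta> > 0 \<Longrightarrow>
      \<forall>\<^sub>F k in U. approx_action \<Lambda> (\<lambda>x. \<sigma> x k) {1..n k} E \<eta>"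
  shows "sofic_rep U n \<Lambda> (\<lambda>x. useq_class U n (\<sigma> x))"
proof -
  interpret G: group \<Lambda> by (rule G)
  interpret P: group "sym_product n" by (rule group_sym_product)
  have good: "almost U n (\<lambda>k j. good_pt \<Lambda> (\<lambda>x. \<sigma> x k) E j)" if E: "finite E" "E \<subseteq> carrier \<Lambda>" for E
  proof (rule almostI[OF n])
    fix \<eta> :: real assume "\<eta> > 0"
    from ev[OF E this] show "\<forall>\<^sub>F k in U. real (card {j \<in> {1..n k}. \<not> good_pt \<Lambda> (\<lambda>x. \<sigma> x k) E j}) \<le> \<eta> * real (n k)"
      by eventually_elim (simp add: approx_action_def)
  qed
  have ne: "almost U n (\<lambda>k j. \<sigma> x k j \<noteq> \<sigma> y k j)"
    if "x \<in> carrier \<Lambda>" "y \<in> carrier \<Lambda>" "x \<noteq> y" for x y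
    by (rule almost_mono[OF good[of "{x, y}"]]) (use that in \<open>auto simp: good_pt_def inj_on_def\<close>)
  show ?thesis
    unfolding sofic_rep_def
  proof (intro conjI ballI impI)
    show "(\<lambda>x. useq_class U n (\<sigma> x)) \<in> hom \<Lambda> (universal_sofic U n)"
    proof (rule homI)
      fix x y assume x: "x \<in> carrier \<Lambda>" and y: "y \<in> carrier \<Lambda>"
      show "useq_class U n (\<sigma> x) \<in> carrier (universal_sofic U n)"
        using car[OF x] carrier_universal_sofic by blast
      have "almost U n (\<lambda>k j. \<sigma> (x \<otimes>\<^bsub>\<Lambda>\<^esub> y) k j = (\<sigma> x \<otimes>\<^bsub>sym_product n\<^esub> \<sigma> y) k j)"
        unfolding mult_sym_product
        by (rule almost_mono[OF good[of "{x, y}"]]) (use x y in \<open>auto simp: good_pt_def\<close>)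
      then have "useq_class U n (\<sigma> (x \<otimes>\<^bsub>\<Lambda>\<^esub> y)) = useq_class U n (\<sigma> x \<otimes>\<^bsub>sym_product n\<^esub> \<sigma> y)"
        using useq_class_eq_iff[OF car[OF G.m_closed[OF x y]] P.m_closed[OF car[OF x] car[OF y]]] by blast
      then show "useq_class U n (\<sigma> (x \<otimes>\<^bsub>\<Lambda>\<^esub> y)) = useq_class U n (\<sigma> x) \<otimes>\<^bsub>universal_sofic U n\<^esub> useq_class U n (\<sigma> y)"
        using useq_class_mult[OF car[OF x] car[OF y]] by simp
    qed
    show "inj_on (\<lambda>x. useq_class U n (\<sigma> x)) (carrier \<Lambda>)"
    proof (rule inj_onI, rule ccontr)
      fix x y assume x: "x \<in> carrier \<Lambda>" and y: "y \<in> carrier \<Lambda>"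
        and eq: "useq_class U n (\<sigma> x) = useq_class U n (\<sigma> y)" and "x \<noteq> y"
      from eq have "almost U n (\<lambda>k j. \<sigma> x k j = \<sigma> y k j)"
        using useq_class_eq_iff[OF car[OF x] car[OF y]] by blast
      from almost_conj[OF this ne[OF x y \<open>x \<noteq> y\<close>]] have "almost U n (\<lambda>k j. False)"
        by (rule almost_mono) blast
      then show False using not_almost_False[where n = n, OF n U] by blast
    qed
    fix x g assume x: "x \<in> carrier \<Lambda>" "x \<noteq> \<one>\<^bsub>\<Lambda>\<^esub>" and g: "g \<in> carrier (sym_product n)"
      and eq: "useq_class U n (\<sigma> x) = useq_class U n g"
    have "almost U n (\<lambda>k j. \<sigma> x k j = g k j)"
      using eq useq_class_eq_iff[OF car[OF x(1)] g] by blast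
    \<comment> \<open>Even for the empty set \<open>good_pt\<close> contains the condition on the
      identity.\<close>
    moreover have "almost U n (\<lambda>k j. \<sigma> \<one>\<^bsub>\<Lambda>\<^esub> k j = j)"
      by (rule almost_mono[OF good[of "{}"]]) (auto simp: good_pt_def)
    ultimately have "almost U n (\<lambda>k j. (\<sigma> x k j = g k j \<and> \<sigma> \<one>\<^bsub>\<Lambda>\<^esub> k j = j) \<and> \<sigma> x k j \<noteq> \<sigma> \<one>\<^bsub>\<Lambda>\<^esub> k j)"
      using ne[OF x(1) G.one_closed x(2)] by (intro almost_conj)
    then have "almost U n (\<lambda>k j. g k j \<noteq> id j)" by (rule almost_mono) auto
    then show "((\<lambda>k. hamming_dist (n k) (g k) \<one>\<^bsub>sym_group (n k)\<^esub>) \<longlongrightarrow> 1) U"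
      unfolding sym_group_one using hamming_dist_tendsto_1[where n = n and g = g and h = "\<lambda>_. id", OF n] by blast
  qed
qed

text \<open>The conjugating class is lifted to permutations \<open>s k\<close>. Substituting
  \<open>s k j\<close> for \<open>j\<close> clears the inverse and leaves the equivariance condition
  that the finite combinatorics establishes or refutes.\<close>

lemma conjugate_homs_iff:
  assumes car: "\<And>x. x \<in> carrier \<Lambda> \<Longrightarrow> \<sigma>\<^sub>1 x \<in> carrier (sym_product n)"
      "\<And>x. x \<in> carrier \<Lambda> \<Longrightarrow> \<sigma>\<^sub>2 x \<in> carrier (sym_product n)"
    and cl: "\<And>x. x \<in> carrier \<Lambda> \<Longrightarrow> \<pi>\<^sub>1 x = useq_class U n (\<sigma>\<^sub>1 x)"
      "\<And>x. x \<in> carrier \<Lambda> \<Longrightarrow> \<pi>\<^sub>2 x = useq_class U n (\<sigma>\<^sub>2 x)"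
  shows "conjugate_homs (universal_sofic U n) \<Lambda> \<pi>\<^sub>1 \<pi>\<^sub>2 \<longleftrightarrow>
    (\<exists>s\<in>carrier (sym_product n). \<forall>x\<in>carrier \<Lambda>. almost U n (\<lambda>k j. s k (\<sigma>\<^sub>1 x k j) = \<sigma>\<^sub>2 x k (s k j)))"
proof -
  interpret P: group "sym_product n" by (rule group_sym_product)
  interpret h: group_hom "sym_product n" "universal_sofic U n" "useq_class U n" by (rule group_hom_useq_class)
  have eq: "\<pi>\<^sub>2 x = useq_class U n s \<otimes>\<^bsub>universal_sofic U n\<^esub> \<pi>\<^sub>1 x \<otimes>\<^bsub>universal_sofic U n\<^esub> inv\<^bsub>universal_sofic U n\<^esub> useq_class U n s
      \<longleftrightarrow> almost U n (\<lambda>k j. s k (\<sigma>\<^sub>1 x k j) = \<sigma>\<^sub>2 x k (s k j))"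
    if s: "s \<in> carrier (sym_product n)" and x: "x \<in> carrier \<Lambda>" for s x
  proof -
    have sp: "s k permutes {1..n k}" for k using s by (simp add: carrier_sym_product)
    note c = car(1)[OF x] car(2)[OF x]
    have "useq_class U n s \<otimes>\<^bsub>universal_sofic U n\<^esub> \<pi>\<^sub>1 x \<otimes>\<^bsub>universal_sofic U n\<^esub> inv\<^bsub>universal_sofic U n\<^esub> useq_class U n s
      = useq_class U n (s \<otimes>\<^bsub>sym_product n\<^esub> \<sigma>\<^sub>1 x \<otimes>\<^bsub>sym_product n\<^esub> inv\<^bsub>sym_product n\<^esub> s)"
      using s c cl(1)[OF x] by (simp only: h.hom_mult h.hom_inv P.m_closed P.inv_closed)
    then have "\<pi>\<^sub>2 x = useq_class U n s \<otimes>\<^bsub>universal_sofic U n\<^esub> \<pi>\<^sub>1 x \<otimes>\<^bsub>universal_sofic U n\<^esub> inv\<^bsub>universal_sofic U n\<^esub> useq_class U n s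
      \<longleftrightarrow> useq_class U n (\<sigma>\<^sub>2 x) = useq_class U n (s \<otimes>\<^bsub>sym_product n\<^esub> \<sigma>\<^sub>1 x \<otimes>\<^bsub>sym_product n\<^esub> inv\<^bsub>sym_product n\<^esub> s)"
      using cl(2)[OF x] by simp
    also have "\<dots> \<longleftrightarrow> almost U n (\<lambda>k j. \<sigma>\<^sub>2 x k j = s k (\<sigma>\<^sub>1 x k (inv' (s k) j)))"
      using useq_class_eq_iff[OF c(2) P.m_closed[OF P.m_closed[OF s c(1)] P.inv_closed[OF s]]]
      unfolding mult_sym_product inv_sym_product[OF s] by simp
    also have "\<dots> \<longleftrightarrow> almost U n (\<lambda>k j. s k (\<sigma>\<^sub>1 x k j) = \<sigma>\<^sub>2 x k (s k j))"
    proof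
      assume "almost U n (\<lambda>k j. \<sigma>\<^sub>2 x k j = s k (\<sigma>\<^sub>1 x k (inv' (s k) j)))"
      from almost_permute[OF sp this] show "almost U n (\<lambda>k j. s k (\<sigma>\<^sub>1 x k j) = \<sigma>\<^sub>2 x k (s k j))"
        by (rule almost_mono) (simp add: permutes_inverses(2)[OF sp])
    next
      assume "almost U n (\<lambda>k j. s k (\<sigma>\<^sub>1 x k j) = \<sigma>\<^sub>2 x k (s k j))"
      from almost_permute[OF permutes_inv[OF sp] this] show "almost U n (\<lambda>k j. \<sigma>\<^sub>2 x k j = s k (\<sigma>\<^sub>1 x k (inv' (s k) j)))"
        by (rule almost_mono) (simp add: permutes_inverses(1)[OF sp])
    qed
    finally show ?thesis .
  qed
  show ?thesis
  proof
    assume "conjugate_homs (universal_sofic U n) \<Lambda> \<pi>\<^sub>1 \<pi>\<^sub>2"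
    then obtain c where c: "c \<in> carrier (universal_sofic U n)"
      "\<forall>x\<in>carrier \<Lambda>. \<pi>\<^sub>2 x = c \<otimes>\<^bsub>universal_sofic U n\<^esub> \<pi>\<^sub>1 x \<otimes>\<^bsub>universal_sofic U n\<^esub> inv\<^bsub>universal_sofic U n\<^esub> c"
      unfolding conjugate_homs_def by blast
    obtain s where s: "s \<in> carrier (sym_product n)" "c = useq_class U n s"
      using c(1) unfolding carrier_universal_sofic by blast
    show "\<exists>s\<in>carrier (sym_product n). \<forall>x\<in>carrier \<Lambda>. almost U n (\<lambda>k j. s k (\<sigma>\<^sub>1 x k j) = \<sigma>\<^sub>2 x k (s k j))"
      using c(2) eq[OF s(1)] s unfolding s(2) by blast
  next
    assume "\<exists>s\<in>carrier (sym_product n). \<forall>x\<in>carrier \<Lambda>. almost U n (\<lambda>k j. s k (\<sigma>\<^sub>1 x k j) = \<sigma>\<^sub>2 x k (s k j))"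
    then obtain s where s: "s \<in> carrier (sym_product n)"
      "\<forall>x\<in>carrier \<Lambda>. almost U n (\<lambda>k j. s k (\<sigma>\<^sub>1 x k j) = \<sigma>\<^sub>2 x k (s k j))" by blast
    then show "conjugate_homs (universal_sofic U n) \<Lambda> \<pi>\<^sub>1 \<pi>\<^sub>2"
      unfolding conjugate_homs_def using eq[OF s(1)] h.hom_closed[OF s(1)] by blast
  qed
qed

subsection \<open>Approximate actions of non-amenable groups\<close>

text \<open>Adding inverses to \<open>K\<close> only enlarges boundaries, so the same \<delta>
  works. Symmetry is what ensures that a piece of a small set from which \<open>K\<close> does not
  lead to the rest of the set is not entered from the rest either.\<close>

lemma not_folner_symmetricE:
  assumes G: "group G" and nf: "\<not> folner G"
  obtains K \<delta> where "finite K" "K \<subseteq> carrier G" "m_inv G ` K \<subseteq> K" "\<delta> > 0"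
    "\<And>T. finite T \<Longrightarrow> T \<noteq> {} \<Longrightarrow> T \<subseteq> carrier G \<Longrightarrow>
        \<delta> * real (card T) < real (card {t \<in> T. \<exists>g\<in>K. g \<otimes>\<^bsub>G\<^esub> t \<notin> T})"
proof -
  interpret group G by (rule G)
  obtain K \<delta> where K: "finite K" "K \<subseteq> carrier G" "\<delta> > 0"
    and bd: "\<And>T. finite T \<Longrightarrow> T \<noteq> {} \<Longrightarrow> T \<subseteq> carrier G \<Longrightarrow>
        \<delta> * real (card T) < real (card {t \<in> T. \<exists>g\<in>K. g \<otimes>\<^bsub>G\<^esub> t \<notin> T})"
    by (rule not_folnerE[OF nf]) (rule that, assumption+)
  let ?K = "K \<union> m_inv G ` K"
  show thesis
  proof (rule that[of ?K \<delta>])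
    show "finite ?K" "\<delta> > 0" using K by simp_all
    have "m_inv G ` K \<subseteq> carrier G" using K(2) by blast
    then show "?K \<subseteq> carrier G" using K(2) by blast
    have "inv\<^bsub>G\<^esub> (inv\<^bsub>G\<^esub> g) \<in> K" if "g \<in> K" for g
      using inv_inv[OF subsetD[OF K(2) that]] that by simp
    then show "m_inv G ` ?K \<subseteq> ?K" by blast
    fix T assume T: "finite T" "T \<noteq> {}" "T \<subseteq> carrier G"
    have "card {t \<in> T. \<exists>g\<in>K. g \<otimes>\<^bsub>G\<^esub> t \<notin> T} \<le> card {t \<in> T. \<exists>g\<in>?K. g \<otimes>\<^bsub>G\<^esub> t \<notin> T}"
      using T(1) by (intro card_mono) auto
    then show "\<delta> * real (card T) < real (card {t \<in> T. \<exists>g\<in>?K. g \<otimes>\<^bsub>G\<^esub> t \<notin> T})"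
      using bd[OF T] by linarith
  qed
qed

text \<open>The connected component of a point \<open>c\<close> of \<open>P\<close> has at most \<open>N\<close> elements, hence lies in the
  \<open>N\<close>-ball around \<open>c\<close>, on which the action is a copy of the Cayley graph.\<close>

lemma small_set_boundary:
  assumes G: "group G" and K: "finite K" "K \<subseteq> carrier G" "m_inv G ` K \<subseteq> K"
    and bd: "\<And>T. finite T \<Longrightarrow> T \<noteq> {} \<Longrightarrow> T \<subseteq> carrier G \<Longrightarrow>
        \<delta> * real (card T) < real (card {t \<in> T. \<exists>g\<in>K. g \<otimes>\<^bsub>G\<^esub> t \<notin> T})"
    and E: "K \<union> kpow G K (Suc N) \<subseteq> E"
    and P: "finite P" "card P \<le> N" "\<And>x. x \<in> P \<Longrightarrow> good_pt G \<rho> E x"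
  shows "\<delta> * real (card P) \<le> real (card {x \<in> P. \<exists>g\<in>K. \<rho> g x \<notin> P})"
  using P
proof (induction P rule: finite_psubset_induct)
  case (psubset P)
  interpret group G by (rule G)
  show ?case
  proof (cases "P = {}")
    case True
    then show ?thesis by simp
  next
    case False
    then obtain c where c: "c \<in> P" by blast
    have gc: "good_pt G \<rho> E c" using psubset.prems(2) c .
    have kE: "kpow G K j \<subseteq> E" if "j \<le> Suc N" for j
      using kpow_mono[OF K(2) that] E by blast
    have inj: "inj_on (\<lambda>\<gamma>. \<rho> \<gamma> c) (kpow G K j)" if "j \<le> Suc N" for j
      using gc kE[OF that] inj_on_subset unfolding good_pt_def by blast
    \<comment> \<open>Paths through the complement of \<open>P\<close> are not excluded here. What
      matters is only a radius at which the set stops growing.\<close>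
    define F where "F j = {\<gamma> \<in> kpow G K j. \<rho> \<gamma> c \<in> P}" for j
    have finF: "finite (F j)" for j unfolding F_def using finite_kpow[OF K(1)] by simp
    have Fsub: "F j \<subseteq> F (Suc j)" for j
      unfolding F_def using kpow_Suc_subset[OF K(2), of j] by blast
    \<comment> \<open>Strict growth at all stages from 0 to \<open>N\<close> would give
      \<open>N + 1\<close> elements of \<open>F (Suc N)\<close>, which embed into \<open>P\<close>,
      a set of at most \<open>N\<close> points. The radius \<open>Suc N\<close> required of
      \<open>E\<close> comes from here.\<close>
    have "\<exists>j\<le>N. F (Suc j) = F j"
    proof (rule ccontr)
      assume "\<not> ?thesis"
      then have grow: "card (F j) < card (F (Suc j))" if "j \<le> N" for j
        using Fsub[of j] finF that by (intro psubset_card_mono) auto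
      have "j \<le> card (F j)" if "j \<le> Suc N" for j
        using that
      proof (induction j)
        case (Suc j)
        then show ?case using grow[of j] by simp
      qed simp
      then have "Suc N \<le> card (F (Suc N))" by simp
      also have "\<dots> \<le> card P"
      proof (rule card_inj_on_le[of "\<lambda>\<gamma>. \<rho> \<gamma> c"])
        show "inj_on (\<lambda>\<gamma>. \<rho> \<gamma> c) (F (Suc N))"
          by (rule inj_on_subset[OF inj[OF order_refl]]) (unfold F_def, blast)
        show "(\<lambda>\<gamma>. \<rho> \<gamma> c) ` F (Suc N) \<subseteq> P" unfolding F_def by blast
      qed (rule psubset.hyps)
      finally show False using psubset.prems(1) by simp
    qed
    then obtain j where j: "j \<le> N" "F (Suc j) = F j" by blast
    define C where "C = (\<lambda>\<gamma>. \<rho> \<gamma> c) ` F j"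
    have CP: "C \<subseteq> P" unfolding C_def F_def by blast
    have one: "\<one>\<^bsub>G\<^esub> \<in> F j"
    proof -
      have "\<one>\<^bsub>G\<^esub> \<in> kpow G K j" using kpow_mono[OF K(2), of 0 j] by simp
      moreover have "\<rho> \<one>\<^bsub>G\<^esub> c \<in> P" using gc c unfolding good_pt_def by simp
      ultimately show ?thesis unfolding F_def by blast
    qed
    then have "C \<noteq> {}" unfolding C_def by blast
    have injF: "inj_on (\<lambda>\<gamma>. \<rho> \<gamma> c) (F j)"
      by (rule inj_on_subset[OF inj[OF le_SucI[OF j(1)]]]) (unfold F_def, blast)
    then have cC: "card C = card (F j)" unfolding C_def by (rule card_image)
    have FG: "F j \<subseteq> carrier G" using kpow_closed[OF K(2)] unfolding F_def by blast
    have mult: "\<rho> g (\<rho> \<gamma> c) = \<rho> (g \<otimes>\<^bsub>G\<^esub> \<gamma>) c" "g \<otimes>\<^bsub>G\<^esub> \<gamma> \<in> kpow G K (Suc j)"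
      if "g \<in> K" "\<gamma> \<in> F j" for g \<gamma>
    proof -
      have "\<gamma> \<in> kpow G K j" using that(2) unfolding F_def by blast
      then show "g \<otimes>\<^bsub>G\<^esub> \<gamma> \<in> kpow G K (Suc j)" using that(1) by (intro kpow_SucI)
      have "\<gamma> \<in> E" "g \<in> E" using kE[of j] j(1) E that(1) \<open>\<gamma> \<in> kpow G K j\<close> by auto
      then show "\<rho> g (\<rho> \<gamma> c) = \<rho> (g \<otimes>\<^bsub>G\<^esub> \<gamma>) c" using gc unfolding good_pt_def by blast
    qed
    \<comment> \<open>Since \<open>F\<close> does not grow at stage \<open>j\<close>, a step of
      \<open>K\<close> from \<open>C\<close> stays in \<open>C\<close> or leaves \<open>P\<close>.
      So the boundary of \<open>F j\<close> in the group embeds into the part of \<open>C\<close>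
      that leaves \<open>P\<close>.\<close>
    have closed: "g \<otimes>\<^bsub>G\<^esub> \<gamma> \<in> F j" if "g \<in> K" "\<gamma> \<in> F j" "\<rho> g (\<rho> \<gamma> c) \<in> P" for g \<gamma>
    proof -
      have "g \<otimes>\<^bsub>G\<^esub> \<gamma> \<in> F (Suc j)"
        unfolding F_def using mult[OF that(1,2)] that(3) by (simp del: kpow.simps)
      then show ?thesis unfolding j(2) .
    qed
    let ?BC = "{x \<in> C. \<exists>g\<in>K. \<rho> g x \<notin> P}" and ?D = "P - C"
    let ?I = "{\<gamma> \<in> F j. \<exists>g\<in>K. g \<otimes>\<^bsub>G\<^esub> \<gamma> \<notin> F j}"
    have finC: "finite C" unfolding C_def using finF by simp
    have Ile: "card ?I \<le> card ?BC"
    proof (rule card_inj_on_le[of "\<lambda>\<gamma>. \<rho> \<gamma> c"])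
      show "inj_on (\<lambda>\<gamma>. \<rho> \<gamma> c) ?I" by (rule inj_on_subset[OF injF]) blast
      show "(\<lambda>\<gamma>. \<rho> \<gamma> c) ` ?I \<subseteq> ?BC" using closed unfolding C_def by blast
      show "finite ?BC" using finC by simp
    qed
    have 1: "\<delta> * real (card C) \<le> real (card ?BC)"
    proof -
      have "F j \<noteq> {}" using one by blast
      from bd[OF finF this FG] show ?thesis unfolding cC using Ile by linarith
    qed
    have "\<delta> * real (card ?D) \<le> real (card {x \<in> ?D. \<exists>g\<in>K. \<rho> g x \<notin> ?D})"
    proof (rule psubset.IH)
      show "?D \<subset> P" using CP \<open>C \<noteq> {}\<close> by blast
      show "card ?D \<le> N" using psubset.prems(1) card_mono[OF psubset.hyps, of ?D] by auto
    qed (use psubset.prems(2) in blast)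
    \<comment> \<open>Points of the rest are not moved into \<open>C\<close>, for the inverse step
      would lead from \<open>C\<close> to a point of \<open>P\<close> outside \<open>C\<close>.
      Hence the boundary of \<open>P - C\<close> counts relative to \<open>P\<close>, and the two
      bounds add up.\<close>
    also have "{x \<in> ?D. \<exists>g\<in>K. \<rho> g x \<notin> ?D} \<subseteq> {x \<in> ?D. \<exists>g\<in>K. \<rho> g x \<notin> P}"
    proof (intro Collect_mono impI, elim conjE bexE)
      fix x g assume x: "x \<in> ?D" and g: "g \<in> K" "\<rho> g x \<notin> ?D"
      have "\<rho> g x \<notin> C"
      proof
        assume "\<rho> g x \<in> C"
        then obtain \<gamma> where \<gamma>: "\<gamma> \<in> F j" "\<rho> g x = \<rho> \<gamma> c" unfolding C_def by blast
        have gx: "good_pt G \<rho> E x" using x psubset.prems(2) by blast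
        have ig: "inv\<^bsub>G\<^esub> g \<in> K" "g \<in> carrier G" using g(1) K by blast+
        have "\<rho> (inv\<^bsub>G\<^esub> g) (\<rho> g x) = \<rho> (inv\<^bsub>G\<^esub> g \<otimes>\<^bsub>G\<^esub> g) x"
          using gx ig(1) g(1) E unfolding good_pt_def by blast
        also have "\<dots> = x" using gx ig(2) unfolding good_pt_def by simp
        finally have eq: "x = \<rho> (inv\<^bsub>G\<^esub> g) (\<rho> \<gamma> c)" using \<gamma>(2) by simp
        then have "inv\<^bsub>G\<^esub> g \<otimes>\<^bsub>G\<^esub> \<gamma> \<in> F j" using closed[OF ig(1) \<gamma>(1)] x by simp
        moreover have "x = \<rho> (inv\<^bsub>G\<^esub> g \<otimes>\<^bsub>G\<^esub> \<gamma>) c" using eq mult(1)[OF ig(1) \<gamma>(1)] by simp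
        ultimately have "x \<in> C" unfolding C_def by blast
        then show False using x by blast
      qed
      then show "x \<in> ?D \<and> (\<exists>g\<in>K. \<rho> g x \<notin> P)" using x g by blast
    qed
    then have "card {x \<in> ?D. \<exists>g\<in>K. \<rho> g x \<notin> ?D} \<le> card {x \<in> ?D. \<exists>g\<in>K. \<rho> g x \<notin> P}"
      using psubset.hyps by (intro card_mono) auto
    finally have 2: "\<delta> * real (card ?D) \<le> real (card {x \<in> ?D. \<exists>g\<in>K. \<rho> g x \<notin> P})" by simp
    have "card ?BC + card {x \<in> ?D. \<exists>g\<in>K. \<rho> g x \<notin> P} = card (?BC \<union> {x \<in> ?D. \<exists>g\<in>K. \<rho> g x \<notin> P})"
      using finC psubset.hyps by (intro card_Un_disjoint[symmetric]) auto
    also have "?BC \<union> {x \<in> ?D. \<exists>g\<in>K. \<rho> g x \<notin> P} = {x \<in> P. \<exists>g\<in>K. \<rho> g x \<notin> P}" using CP by blast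
    finally have 3: "real (card ?BC) + real (card {x \<in> ?D. \<exists>g\<in>K. \<rho> g x \<notin> P})
        = real (card {x \<in> P. \<exists>g\<in>K. \<rho> g x \<notin> P})" unfolding of_nat_add[symmetric] of_nat_eq_iff .
    have "card P = card C + card ?D"
      using card_Diff_subset[OF finC CP] card_mono[OF psubset.hyps CP] by simp
    then have "\<delta> * real (card P) = \<delta> * real (card C) + \<delta> * real (card ?D)" by (simp add: distrib_left)
    then show ?thesis using 1 2 3 by linarith
  qed
qed

text \<open>The colour classes are preserved by \<open>\<rho>\<^sub>1\<close>. Carried over by
  \<open>s\<close>, they become sets of at most \<open>N\<close> points, and the good points of each
  have a boundary of proportion at least \<delta> under \<open>\<rho>\<^sub>2\<close>. Summing over
  colours bounds \<open>B\<close> from below. From above, a point of \<open>B\<close> is, for some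
  \<open>g\<close> in \<open>K\<close>, moved out of the good points, which costs a proportion
  \<open>\<eta>\<close>, or changes colour, which by almost equivariance costs
  \<open>\<theta>\<close>.\<close>

lemma small_classes_not_conjugate:
  fixes col :: "'x \<Rightarrow> 'c"
  assumes G: "group G" and K: "finite K" "K \<subseteq> carrier G" "m_inv G ` K \<subseteq> K" and \<delta>: "\<delta> > 0"
    and bd: "\<And>T. finite T \<Longrightarrow> T \<noteq> {} \<Longrightarrow> T \<subseteq> carrier G \<Longrightarrow>
        \<delta> * real (card T) < real (card {t \<in> T. \<exists>g\<in>K. g \<otimes>\<^bsub>G\<^esub> t \<notin> T})"
    and act: "approx_action G \<rho>\<^sub>2 V E \<eta>" and E: "K \<union> kpow G K (Suc N) \<subseteq> E"
    and col: "\<And>w. card {x \<in> V. col x = w} \<le> N"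
    and \<rho>1: "\<And>g x. g \<in> K \<Longrightarrow> x \<in> V \<Longrightarrow> \<rho>\<^sub>1 g x \<in> V \<and> col (\<rho>\<^sub>1 g x) = col x"
    and s: "bij_betw s V V"
    and conj: "\<And>g. g \<in> K \<Longrightarrow> real (card {x \<in> V. s (\<rho>\<^sub>1 g x) \<noteq> \<rho>\<^sub>2 g (s x)}) \<le> \<theta> * real (card V)"
  shows "\<delta> * (1 - \<eta>) * real (card V) \<le> real (card K) * (\<theta> + \<eta>) * real (card V)"
proof -
  have V: "finite V" and bij: "\<And>g. g \<in> K \<Longrightarrow> bij_betw (\<rho>\<^sub>2 g) V V"
    using act K(2) unfolding approx_action_def by blast+
  define W where "W = {x \<in> V. good_pt G \<rho>\<^sub>2 E x}"
  have WV: "W \<subseteq> V" "finite W" using V unfolding W_def by auto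
  have "V - W = {x \<in> V. \<not> good_pt G \<rho>\<^sub>2 E x}" unfolding W_def by blast
  then have bad: "real (card (V - W)) \<le> \<eta> * real (card V)"
    using act unfolding approx_action_def by simp
  define col' where "col' y = col (inv_into V s y)" for y
  have col's: "col' (s x) = col x" if "x \<in> V" for x
    using s that unfolding col'_def by (simp add: bij_betw_def)
  define P where "P w = {y \<in> W. col' y = w}" for w
  have "card (P w) \<le> card {x \<in> V. col x = w}" for w
  proof (rule card_inj_on_le[of "inv_into V s"])
    have s': "bij_betw (inv_into V s) V V" using s by (rule bij_betw_inv_into)
    show "inj_on (inv_into V s) (P w)"
      by (rule inj_on_subset[OF bij_betw_imp_inj_on[OF s']]) (use WV in \<open>auto simp: P_def\<close>)
    show "inv_into V s ` P w \<subseteq> {x \<in> V. col x = w}"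
      using bij_betwE[OF s'] WV(1) unfolding P_def col'_def by blast
  qed (use V in simp)
  then have PN: "card (P w) \<le> N" for w using col le_trans by blast
  have Pgood: "good_pt G \<rho>\<^sub>2 E x" if "x \<in> P w" for x w using that unfolding P_def W_def by blast
  have finP: "finite (P w)" for w using WV unfolding P_def by simp
  define B where "B = {y \<in> W. \<exists>g\<in>K. \<rho>\<^sub>2 g y \<notin> P (col' y)}"
  have "\<delta> * real (card W) = \<delta> * (\<Sum>w\<in>col' ` W. real (card (P w)))"
    using sum.group[of W "col' ` W" col' "\<lambda>_. 1 :: real"] WV(2) unfolding P_def by simp
  also have "\<dots> = (\<Sum>w\<in>col' ` W. \<delta> * real (card (P w)))" by (rule sum_distrib_left)
  also have "\<dots> \<le> (\<Sum>w\<in>col' ` W. real (card {y \<in> P w. \<exists>g\<in>K. \<rho>\<^sub>2 g y \<notin> P w}))"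
    by (intro sum_mono small_set_boundary[OF G K bd E finP PN Pgood])
  also have "\<dots> = (\<Sum>w\<in>col' ` W. real (card {y \<in> B. col' y = w}))"
  proof (rule sum.cong[OF refl])
    fix w
    have "{y \<in> P w. \<exists>g\<in>K. \<rho>\<^sub>2 g y \<notin> P w} = {y \<in> B. col' y = w}" unfolding B_def P_def by blast
    then show "real (card {y \<in> P w. \<exists>g\<in>K. \<rho>\<^sub>2 g y \<notin> P w}) = real (card {y \<in> B. col' y = w})" by simp
  qed
  also have "\<dots> = real (card B)"
    using sum.group[of B "col' ` W" col' "\<lambda>_. 1 :: real"] WV(2) unfolding B_def by (simp add: image_mono)
  finally have low: "\<delta> * real (card W) \<le> real (card B)" .
  let ?bad = "\<lambda>g. {y \<in> V. \<rho>\<^sub>2 g y \<notin> W} \<union> {y \<in> V. col' (\<rho>\<^sub>2 g y) \<noteq> col' y}"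
  have "card B \<le> card (\<Union>g\<in>K. ?bad g)"
    using K V WV by (intro card_mono) (auto simp: B_def P_def)
  also have "\<dots> \<le> (\<Sum>g\<in>K. card (?bad g))" using K(1) by (rule card_UN_le)
  finally have "real (card B) \<le> (\<Sum>g\<in>K. real (card (?bad g)))"
    unfolding of_nat_sum[symmetric] of_nat_le_iff .
  also have "\<dots> \<le> real (card K) * ((\<theta> + \<eta>) * real (card V))"
  proof (rule sum_bounded_above)
    fix g assume g: "g \<in> K"
    have "card {y \<in> V. \<rho>\<^sub>2 g y \<notin> W} \<le> card (V - W)"
    proof (rule card_inj_on_le[of "\<rho>\<^sub>2 g"])
      show "inj_on (\<rho>\<^sub>2 g) {y \<in> V. \<rho>\<^sub>2 g y \<notin> W}"
        by (rule inj_on_subset[OF bij_betw_imp_inj_on[OF bij[OF g]]]) blast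
      show "\<rho>\<^sub>2 g ` {y \<in> V. \<rho>\<^sub>2 g y \<notin> W} \<subseteq> V - W" using bij_betwE[OF bij[OF g]] by blast
    qed (use V in simp)
    moreover have "card {y \<in> V. col' (\<rho>\<^sub>2 g y) \<noteq> col' y} \<le> card (s ` {x \<in> V. s (\<rho>\<^sub>1 g x) \<noteq> \<rho>\<^sub>2 g (s x)})"
    proof (intro card_mono subsetI)
      fix y assume y: "y \<in> {y \<in> V. col' (\<rho>\<^sub>2 g y) \<noteq> col' y}"
      then obtain x where x: "x \<in> V" "y = s x" using s unfolding bij_betw_def by blast
      have "s (\<rho>\<^sub>1 g x) \<noteq> \<rho>\<^sub>2 g (s x)"
      proof
        assume "s (\<rho>\<^sub>1 g x) = \<rho>\<^sub>2 g (s x)"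
        then have "col' (\<rho>\<^sub>2 g y) = col x" using col's \<rho>1[OF g x(1)] x(2) by metis
        then show False using y col's[OF x(1)] x(2) by simp
      qed
      then show "y \<in> s ` {x \<in> V. s (\<rho>\<^sub>1 g x) \<noteq> \<rho>\<^sub>2 g (s x)}" using x by blast
    qed (use V in simp)
    moreover have "\<dots> \<le> card {x \<in> V. s (\<rho>\<^sub>1 g x) \<noteq> \<rho>\<^sub>2 g (s x)}" using V by (intro card_image_le) simp
    ultimately have "real (card (?bad g)) \<le> real (card (V - W)) + real (card {x \<in> V. s (\<rho>\<^sub>1 g x) \<noteq> \<rho>\<^sub>2 g (s x)})"
      using card_Un_le[of "{y \<in> V. \<rho>\<^sub>2 g y \<notin> W}" "{y \<in> V. col' (\<rho>\<^sub>2 g y) \<noteq> col' y}"] by linarith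
    then show "real (card (?bad g)) \<le> (\<theta> + \<eta>) * real (card V)"
      using bad conj[OF g] by (simp add: distrib_right)
  qed
  finally have up: "real (card B) \<le> real (card K) * (\<theta> + \<eta>) * real (card V)" by (simp add: mult.assoc)
  have "real (card (V - W)) = real (card V) - real (card W)"
    using WV V by (simp add: card_Diff_subset card_mono of_nat_diff)
  then have "(1 - \<eta>) * real (card V) \<le> real (card W)" using bad by (simp add: algebra_simps)
  then have "\<delta> * ((1 - \<eta>) * real (card V)) \<le> \<delta> * real (card W)" using \<delta> by (intro mult_left_mono) auto
  then show ?thesis using low up by (simp add: mult.assoc)
qed

subsection \<open>Amenable groups\<close>

text \<open>For each positive \<open>m\<close> some permutation works for the first \<open>m\<close>
  elements up to \<open>1 / m\<close>, at \<open>U\<close>-almost every index. At index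
  \<open>k\<close> the largest such \<open>m\<close> not exceeding \<open>k\<close> is used. As
  \<open>U\<close> is free, this value eventually exceeds any bound, so one sequence of permutations
  serves all group elements.\<close>

lemma folner_sofic_rep_conjugate:
  fixes \<Lambda> :: "('a, 'b) monoid_scheme"
  assumes U: "free_ultrafilter U" and G: "group \<Lambda>" and cnt: "countable (carrier \<Lambda>)" and fol: "folner \<Lambda>"
    and n: "\<And>k. n k > 0" and rep: "sofic_rep U n \<Lambda> \<pi>\<^sub>1" "sofic_rep U n \<Lambda> \<pi>\<^sub>2"
  shows "conjugate_homs (universal_sofic U n) \<Lambda> \<pi>\<^sub>1 \<pi>\<^sub>2"
proof -
  interpret G: group \<Lambda> by (rule G)
  obtain \<sigma>\<^sub>1 where \<sigma>1: "\<And>x. x \<in> carrier \<Lambda> \<Longrightarrow> \<sigma>\<^sub>1 x \<in> carrier (sym_product n)"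
    "\<And>x. x \<in> carrier \<Lambda> \<Longrightarrow> \<pi>\<^sub>1 x = useq_class U n (\<sigma>\<^sub>1 x)"
    and ap1: "\<And>E \<eta>. finite E \<Longrightarrow> E \<subseteq> carrier \<Lambda> \<Longrightarrow> \<eta> > 0 \<Longrightarrow>
      \<forall>\<^sub>F k in U. approx_action \<Lambda> (\<lambda>x. \<sigma>\<^sub>1 x k) {1..n k} E \<eta>"
    by (rule sofic_rep_lift[OF G n rep(1)]) (rule that, assumption+)
  obtain \<sigma>\<^sub>2 where \<sigma>2: "\<And>x. x \<in> carrier \<Lambda> \<Longrightarrow> \<sigma>\<^sub>2 x \<in> carrier (sym_product n)"
    "\<And>x. x \<in> carrier \<Lambda> \<Longrightarrow> \<pi>\<^sub>2 x = useq_class U n (\<sigma>\<^sub>2 x)"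
    and ap2: "\<And>E \<eta>. finite E \<Longrightarrow> E \<subseteq> carrier \<Lambda> \<Longrightarrow> \<eta> > 0 \<Longrightarrow>
      \<forall>\<^sub>F k in U. approx_action \<Lambda> (\<lambda>x. \<sigma>\<^sub>2 x k) {1..n k} E \<eta>"
    by (rule sofic_rep_lift[OF G n rep(2)]) (rule that, assumption+)
  define e where "e = from_nat_into (carrier \<Lambda>)"
  have ne: "carrier \<Lambda> \<noteq> {}" using G.one_closed by blast
  have e: "e i \<in> carrier \<Lambda>" for i unfolding e_def by (rule from_nat_into[OF ne])
  define P where "P m k s \<longleftrightarrow> s permutes {1..n k} \<and>
    (\<forall>i<m. real (card {j \<in> {1..n k}. s (\<sigma>\<^sub>1 (e i) k j) \<noteq> \<sigma>\<^sub>2 (e i) k (s j)}) \<le> 1 / real m * real (n k))" for m k s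
  have evP: "\<forall>\<^sub>F k in U. \<exists>s. P m k s" if m: "m > 0" for m
  proof -
    have K: "finite (e ` {..<m})" "e ` {..<m} \<subseteq> carrier \<Lambda>" and m': "0 < 1 / real m" using e m by auto
    obtain E \<eta> where E: "finite E" "E \<subseteq> carrier \<Lambda>" "\<eta> > 0"
      and conj: "\<And>(V :: nat set) \<rho>\<^sub>1 \<rho>\<^sub>2. approx_action \<Lambda> \<rho>\<^sub>1 V E \<eta> \<Longrightarrow> approx_action \<Lambda> \<rho>\<^sub>2 V E \<eta> \<Longrightarrow>
        \<exists>s. bij_betw s V V \<and> (\<forall>g\<in>e ` {..<m}. real (card {x \<in> V. s (\<rho>\<^sub>1 g x) \<noteq> \<rho>\<^sub>2 g (s x)}) \<le> 1 / real m * real (card V))"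
      by (rule folner_near_conjugate[where ?'x = nat, OF G fol K m']) (rule that, assumption+)
    from ap1[OF E] ap2[OF E] show ?thesis
    proof eventually_elim
      case (elim k)
      obtain s where s: "bij_betw s {1..n k} {1..n k}"
        and near: "\<forall>g\<in>e ` {..<m}. real (card {x \<in> {1..n k}. s (\<sigma>\<^sub>1 g k x) \<noteq> \<sigma>\<^sub>2 g k (s x)}) \<le> 1 / real m * real (card {1..n k})"
        using conj[OF elim] by blast
      \<comment> \<open>Extension by the identity outside \<open>{1..n k}\<close>, as
        \<open>permutes\<close> requires.\<close>
      define s' where "s' j = (if j \<in> {1..n k} then s j else j)" for j
      have "bij_betw s' {1..n k} {1..n k}"
        using s by (rule bij_betw_cong[THEN iffD1, rotated]) (simp add: s'_def)
      then have "s' permutes {1..n k}" by (rule bij_imp_permutes) (auto simp: s'_def)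
      moreover have "real (card {j \<in> {1..n k}. s' (\<sigma>\<^sub>1 (e i) k j) \<noteq> \<sigma>\<^sub>2 (e i) k (s' j)}) \<le> 1 / real m * real (n k)"
        if i: "i < m" for i
      proof -
        have "\<sigma>\<^sub>1 (e i) k permutes {1..n k}" using \<sigma>1(1)[OF e] by (simp add: carrier_sym_product)
        then have "\<sigma>\<^sub>1 (e i) k j \<in> {1..n k}" if "j \<in> {1..n k}" for j
          using that permutes_in_image by metis
        then have "{j \<in> {1..n k}. s' (\<sigma>\<^sub>1 (e i) k j) \<noteq> \<sigma>\<^sub>2 (e i) k (s' j)} = {j \<in> {1..n k}. s (\<sigma>\<^sub>1 (e i) k j) \<noteq> \<sigma>\<^sub>2 (e i) k (s j)}"
          unfolding s'_def by auto
        then show ?thesis using near i by simp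
      qed
      ultimately have "P m k s'" unfolding P_def by blast
      then show ?case by blast
    qed
  qed
  \<comment> \<open>The bound \<open>m \<le> k\<close> makes the maximum exist, and the alternative
    \<open>m = 0\<close> makes the set nonempty; \<open>P 0\<close> asks only for a
    permutation.\<close>
  define Mk where "Mk k = Max {m. m \<le> k \<and> (m = 0 \<or> (\<exists>s. P m k s))}" for k
  have fin: "finite {m. m \<le> k \<and> (m = 0 \<or> (\<exists>s. P m k s))}" for k
    by (rule finite_subset[of _ "{..k}"]) auto
  have Mk_in: "Mk k \<in> {m. m \<le> k \<and> (m = 0 \<or> (\<exists>s. P m k s))}" for k
    unfolding Mk_def by (rule Max_in[OF fin]) blast
  have "\<exists>s. P (Mk k) k s" for k
  proof (cases "Mk k = 0")
    case True
    have "P 0 k id" unfolding P_def by (simp add: permutes_id)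
    then show ?thesis unfolding True by blast
  next
    case False
    then show ?thesis using Mk_in[of k] by simp
  qed
  then have "\<exists>s. \<forall>k. P (Mk k) k (s k)" by (intro choice allI)
  then obtain s where s: "\<And>k. P (Mk k) k (s k)" by blast
  have sc: "s \<in> carrier (sym_product n)" using s by (simp add: carrier_sym_product P_def)
  have "almost U n (\<lambda>k j. s k (\<sigma>\<^sub>1 x k j) = \<sigma>\<^sub>2 x k (s k j))" if x: "x \<in> carrier \<Lambda>" for x
  proof (rule almostI[OF n])
    fix \<eta> :: real assume \<eta>: "\<eta> > 0"
    obtain i where i: "x = e i" using x cnt by (metis e_def from_nat_into_surj)
    obtain m0 where m0: "1 / \<eta> < real m0" using reals_Archimedean2 by blast
    define m where "m = max (Suc i) (max 1 m0)"
    have m: "m > 0" "i < m" "1 / real m \<le> \<eta>"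
    proof -
      have "1 / \<eta> \<le> real m" using m0 by (simp add: m_def)
      then show "1 / real m \<le> \<eta>" using \<eta> by (simp add: m_def field_simps)
    qed (simp_all add: m_def)
    from evP[OF m(1)] free_ultrafilter_ge[OF U, of m]
    show "\<forall>\<^sub>F k in U. real (card {j \<in> {1..n k}. \<not> s k (\<sigma>\<^sub>1 x k j) = \<sigma>\<^sub>2 x k (s k j)}) \<le> \<eta> * real (n k)"
    proof eventually_elim
      case (elim k)
      then have "m \<le> Mk k" unfolding Mk_def by (intro Max_ge[OF fin]) blast
      then have "1 / real (Mk k) \<le> 1 / real m" using m(1) by (simp add: frac_le)
      then have le: "1 / real (Mk k) * real (n k) \<le> \<eta> * real (n k)" using m(3) by (intro mult_right_mono) auto
      have "i < Mk k" using m(2) \<open>m \<le> Mk k\<close> by simp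
      then have "real (card {j \<in> {1..n k}. s k (\<sigma>\<^sub>1 (e i) k j) \<noteq> \<sigma>\<^sub>2 (e i) k (s k j)}) \<le> 1 / real (Mk k) * real (n k)"
        using s[of k] unfolding P_def by blast
      then show ?case using le unfolding i by linarith
    qed
  qed
  then show ?thesis
    using conjugate_homs_iff[where \<sigma>\<^sub>1 = \<sigma>\<^sub>1 and \<sigma>\<^sub>2 = \<sigma>\<^sub>2, OF \<sigma>1(1) \<sigma>2(1) \<sigma>1(2) \<sigma>2(2)] sc by blast
qed

subsection \<open>Non-amenable groups\<close>

text \<open>A pair is good as soon as both coordinates are, so the exceptional proportions add
  up.\<close>

lemma approx_action_prod:
  assumes act: "approx_action G \<sigma> V E \<eta>" "approx_action H \<tau> W F \<theta>"
  shows "approx_action (G \<times>\<times> H) (\<lambda>p. map_prod (\<sigma> (fst p)) (\<tau> (snd p))) (V \<times> W) (E \<times> F) (\<eta> + \<theta>)"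
proof -
  let ?\<rho> = "\<lambda>p. map_prod (\<sigma> (fst p)) (\<tau> (snd p))"
  have fin: "finite V" "finite W"
    and bij: "\<And>g. g \<in> carrier G \<Longrightarrow> bij_betw (\<sigma> g) V V" "\<And>h. h \<in> carrier H \<Longrightarrow> bij_betw (\<tau> h) W W"
    and bad: "real (card {x \<in> V. \<not> good_pt G \<sigma> E x}) \<le> \<eta> * real (card V)"
      "real (card {y \<in> W. \<not> good_pt H \<tau> F y}) \<le> \<theta> * real (card W)"
    using act unfolding approx_action_def by blast+
  have good: "good_pt (G \<times>\<times> H) ?\<rho> (E \<times> F) (x, y)" if "good_pt G \<sigma> E x" "good_pt H \<tau> F y" for x y
    using that unfolding good_pt_def inj_on_def by simp
  have "{z \<in> V \<times> W. \<not> good_pt (G \<times>\<times> H) ?\<rho> (E \<times> F) z}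
      \<subseteq> {x \<in> V. \<not> good_pt G \<sigma> E x} \<times> W \<union> V \<times> {y \<in> W. \<not> good_pt H \<tau> F y}"
    using good by blast
  then have "card {z \<in> V \<times> W. \<not> good_pt (G \<times>\<times> H) ?\<rho> (E \<times> F) z}
      \<le> card ({x \<in> V. \<not> good_pt G \<sigma> E x} \<times> W \<union> V \<times> {y \<in> W. \<not> good_pt H \<tau> F y})"
    using fin by (intro card_mono) auto
  also have "\<dots> \<le> card {x \<in> V. \<not> good_pt G \<sigma> E x} * card W + card V * card {y \<in> W. \<not> good_pt H \<tau> F y}"
    by (rule order_trans[OF card_Un_le]) (simp add: card_cartesian_product)
  finally have "real (card {z \<in> V \<times> W. \<not> good_pt (G \<times>\<times> H) ?\<rho> (E \<times> F) z})
      \<le> real (card {x \<in> V. \<not> good_pt G \<sigma> E x}) * real (card W) + real (card V) * real (card {y \<in> W. \<not> good_pt H \<tau> F y})"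
    unfolding of_nat_mult[symmetric] of_nat_add[symmetric] of_nat_le_iff .
  also have "\<dots> \<le> (\<eta> * real (card V)) * real (card W) + real (card V) * (\<theta> * real (card W))"
    using bad by (intro add_mono mult_right_mono mult_left_mono) auto
  also have "\<dots> = (\<eta> + \<theta>) * real (card (V \<times> W))" by (simp add: card_cartesian_product algebra_simps)
  finally have "real (card {z \<in> V \<times> W. \<not> good_pt (G \<times>\<times> H) ?\<rho> (E \<times> F) z}) \<le> (\<eta> + \<theta>) * real (card (V \<times> W))" .
  moreover have "bij_betw (?\<rho> p) (V \<times> W) (V \<times> W)" if "p \<in> carrier (G \<times>\<times> H)" for p
  proof (rule bij_betw_map_prod)
    show "bij_betw (\<sigma> (fst p)) V V" "bij_betw (\<tau> (snd p)) W W" using that bij by auto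
  qed
  ultimately show ?thesis unfolding approx_action_def using fin by blast
qed

text \<open>The product action lives on pairs, while \<open>sym_product\<close> consists of
  permutations of initial segments; hence the passage through a bijection and the extension by the
  identity.\<close>

lemma approx_action_transport:
  assumes act: "approx_action G \<rho> V E \<eta>" and E: "E \<subseteq> carrier G" and G: "group G" and f: "bij_betw f V V'"
  defines "\<rho>' \<equiv> \<lambda>g y. if y \<in> V' then f (\<rho> g (inv_into V f y)) else y"
  shows "approx_action G \<rho>' V' E \<eta>" and "g \<in> carrier G \<Longrightarrow> \<rho>' g permutes V'"
proof -
  interpret group G by (rule G)
  have fin: "finite V" and bij: "\<And>g. g \<in> carrier G \<Longrightarrow> bij_betw (\<rho> g) V V"
    and bad: "real (card {x \<in> V. \<not> good_pt G \<rho> E x}) \<le> \<eta> * real (card V)"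
    using act unfolding approx_action_def by blast+
  have \<rho>V: "\<rho> g x \<in> V" if "g \<in> carrier G" "x \<in> V" for g x
    using bij_betwE[OF bij[OF that(1)]] that(2) by blast
  have fV: "f x \<in> V'" if "x \<in> V" for x using bij_betwE[OF f] that by blast
  have injf: "inj_on f V" using f by (rule bij_betw_imp_inj_on)
  have \<rho>'f: "\<rho>' g (f x) = f (\<rho> g x)" if "x \<in> V" for g x
    using fV[OF that] inv_into_f_f[OF injf that] unfolding \<rho>'_def by simp
  have perm: "\<rho>' g permutes V'" if g: "g \<in> carrier G" for g
  proof (rule bij_imp_permutes)
    have "bij_betw (f \<circ> (\<rho> g \<circ> inv_into V f)) V' V'"
      by (rule bij_betw_trans[OF bij_betw_trans[OF bij_betw_inv_into[OF f] bij[OF g]] f])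
    then show "bij_betw (\<rho>' g) V' V'"
      by (rule bij_betw_cong[THEN iffD1, rotated]) (simp add: \<rho>'_def)
    show "\<rho>' g y = y" if "y \<notin> V'" for y using that unfolding \<rho>'_def by simp
  qed
  then show "g \<in> carrier G \<Longrightarrow> \<rho>' g permutes V'" .
  have good: "good_pt G \<rho>' E (f x)" if x: "x \<in> V" and gx: "good_pt G \<rho> E x" for x
    unfolding good_pt_def
  proof (intro conjI ballI inj_onI)
    show "\<rho>' \<one>\<^bsub>G\<^esub> (f x) = f x" using \<rho>'f[OF x] gx unfolding good_pt_def by simp
    show "\<rho>' g (\<rho>' h (f x)) = \<rho>' (g \<otimes>\<^bsub>G\<^esub> h) (f x)" if gh: "g \<in> E" "h \<in> E" for g h
    proof -
      have "h \<in> carrier G" using gh E by blast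
      then have "\<rho>' g (\<rho>' h (f x)) = f (\<rho> g (\<rho> h x))" using \<rho>'f[OF x] \<rho>'f[OF \<rho>V[OF _ x]] by simp
      also have "\<rho> g (\<rho> h x) = \<rho> (g \<otimes>\<^bsub>G\<^esub> h) x" using gx gh unfolding good_pt_def by blast
      finally show ?thesis using \<rho>'f[OF x] by simp
    qed
    fix g h assume gh: "g \<in> E" "h \<in> E" and eq: "\<rho>' g (f x) = \<rho>' h (f x)"
    have c: "g \<in> carrier G" "h \<in> carrier G" using gh E by blast+
    have "\<rho> g x = \<rho> h x"
      using eq inj_onD[OF injf _ \<rho>V[OF c(1) x] \<rho>V[OF c(2) x]] unfolding \<rho>'f[OF x] by blast
    then show "g = h" using gx gh unfolding good_pt_def inj_on_def by blast
  qed
  have "{y \<in> V'. \<not> good_pt G \<rho>' E y} \<subseteq> f ` {x \<in> V. \<not> good_pt G \<rho> E x}"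
  proof
    fix y assume y: "y \<in> {y \<in> V'. \<not> good_pt G \<rho>' E y}"
    then obtain x where "x \<in> V" "y = f x" using f unfolding bij_betw_def by blast
    then show "y \<in> f ` {x \<in> V. \<not> good_pt G \<rho> E x}" using y good by blast
  qed
  then have "card {y \<in> V'. \<not> good_pt G \<rho>' E y} \<le> card {x \<in> V. \<not> good_pt G \<rho> E x}"
    using fin by (intro order_trans[OF card_mono card_image_le]) auto
  moreover have "card V = card V'" using f by (rule bij_betw_same_card)
  moreover have "finite V'" using f fin bij_betw_finite by blast
  ultimately show "approx_action G \<rho>' V' E \<eta>"
    using bad perm unfolding approx_action_def by (simp add: permutes_imp_bij)
qed

lemma approx_action_snd:
  assumes act: "approx_action (G \<times>\<times> H) \<rho> V ({\<one>\<^bsub>G\<^esub>} \<times> E) \<eta>" and G: "group G"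
  shows "approx_action H (\<lambda>h. \<rho> (\<one>\<^bsub>G\<^esub>, h)) V E \<eta>"
proof -
  interpret group G by (rule G)
  have "good_pt H (\<lambda>h. \<rho> (\<one>\<^bsub>G\<^esub>, h)) E x" if "good_pt (G \<times>\<times> H) \<rho> ({\<one>\<^bsub>G\<^esub>} \<times> E) x" for x
    using that unfolding good_pt_def inj_on_def by simp
  then have "card {x \<in> V. \<not> good_pt H (\<lambda>h. \<rho> (\<one>\<^bsub>G\<^esub>, h)) E x} \<le> card {x \<in> V. \<not> good_pt (G \<times>\<times> H) \<rho> ({\<one>\<^bsub>G\<^esub>} \<times> E) x}"
    using act by (intro card_mono) (auto simp: approx_action_def)
  then show ?thesis using act unfolding approx_action_def by simp
qed

text \<open>In a sofic approximation the identity may move a few points. Making it act trivially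
  keeps the good points, and it lets the first factor of a product action preserve the second
  coordinate at every point rather than almost everywhere.\<close>

lemma approx_action_normalize:
  assumes act: "approx_action G \<rho> V E \<eta>" and E: "E \<subseteq> carrier G" and G: "group G"
  shows "approx_action G (\<lambda>g x. if g = \<one>\<^bsub>G\<^esub> then x else \<rho> g x) V E \<eta>"
proof -
  interpret group G by (rule G)
  let ?\<rho> = "\<lambda>g x. if g = \<one>\<^bsub>G\<^esub> then x else \<rho> g x"
  have V: "finite V" "\<And>g. g \<in> carrier G \<Longrightarrow> bij_betw (\<rho> g) V V"
    "real (card {x \<in> V. \<not> good_pt G \<rho> E x}) \<le> \<eta> * real (card V)"
    using act unfolding approx_action_def by blast+
  have good: "good_pt G ?\<rho> E x" if x: "good_pt G \<rho> E x" for x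
    unfolding good_pt_def
  proof (intro conjI ballI)
    have eq: "?\<rho> g x = \<rho> g x" for g using x unfolding good_pt_def by simp
    show "?\<rho> \<one>\<^bsub>G\<^esub> x = x" by simp
    show "inj_on (\<lambda>g. ?\<rho> g x) E" unfolding eq using x unfolding good_pt_def by blast
    fix g h assume gh: "g \<in> E" "h \<in> E"
    have "h \<in> carrier G" using gh(2) E by blast
    show "?\<rho> g (?\<rho> h x) = ?\<rho> (g \<otimes>\<^bsub>G\<^esub> h) x"
    proof (cases "g = \<one>\<^bsub>G\<^esub>")
      case True
      then show ?thesis using \<open>h \<in> carrier G\<close> by simp
    next
      case False
      then show ?thesis unfolding eq using x gh unfolding good_pt_def by simp
    qed
  qed
  have "card {x \<in> V. \<not> good_pt G ?\<rho> E x} \<le> card {x \<in> V. \<not> good_pt G \<rho> E x}"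
    using V(1) good by (intro card_mono) auto
  moreover have "bij_betw (?\<rho> g) V V" if "g \<in> carrier G" for g
    using V(2)[OF that] bij_betw_id[of V] by (cases "g = \<one>\<^bsub>G\<^esub>") (simp_all add: id_def)
  ultimately show ?thesis using V unfolding approx_action_def by simp
qed

lemma sofic_group_approx_action:
  assumes sof: "sofic_group U \<Gamma>" and U: "U \<noteq> bot" and E: "finite E" "E \<subseteq> carrier \<Gamma>" "\<eta> > 0"
  obtains a :: nat and \<sigma> where "a > 0" "approx_action \<Gamma> \<sigma> {1..a} E \<eta>" "\<And>x. \<sigma> \<one>\<^bsub>\<Gamma>\<^esub> x = x"
proof -
  have G: "group \<Gamma>" using sof unfolding sofic_group_def by blast
  obtain n \<pi> where n: "\<And>k. n k > (0::nat)" and rep: "sofic_rep U n \<Gamma> \<pi>" using sof unfolding sofic_group_def by blast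
  obtain \<sigma> where "\<And>E \<eta>. finite E \<Longrightarrow> E \<subseteq> carrier \<Gamma> \<Longrightarrow> \<eta> > 0 \<Longrightarrow>
      \<forall>\<^sub>F k in U. approx_action \<Gamma> (\<lambda>x. \<sigma> x k) {1..n k} E \<eta>"
    by (rule sofic_rep_lift[OF G n rep]) (rule that, assumption+)
  from this[OF E] obtain k where "approx_action \<Gamma> (\<lambda>x. \<sigma> x k) {1..n k} E \<eta>"
    using eventually_happens'[OF U] by blast
  from approx_action_normalize[OF this E(2) G] show thesis
    by (rule that[OF n]) simp
qed

lemma not_folner_not_conjugate:
  fixes \<Gamma> :: "('a, 'b) monoid_scheme"
  assumes U: "free_ultrafilter U" and G: "group \<Gamma>" and cnt: "countable (carrier \<Gamma>)"
    and sof: "sofic_group U \<Gamma>" and nf: "\<not> folner \<Gamma>"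
  obtains n \<pi> where "\<And>k. n k > 0" "sofic_rep U n (\<Gamma> \<times>\<times> \<Gamma>) \<pi>"
    "\<not> conjugate_homs (universal_sofic U n) \<Gamma> (restrict_fst \<Gamma> \<pi>) (restrict_fst \<Gamma> (\<pi> \<circ> flip))"
proof -
  interpret G: group \<Gamma> by (rule G)
  have GG: "group (\<Gamma> \<times>\<times> \<Gamma>)" using G by (intro DirProd_group)
  have Ub: "U \<noteq> bot" using U unfolding free_ultrafilter_def by blast
  obtain K \<delta> where K: "finite K" "K \<subseteq> carrier \<Gamma>" "m_inv \<Gamma> ` K \<subseteq> K" and \<delta>: "\<delta> > 0"
    and bd: "\<And>T. finite T \<Longrightarrow> T \<noteq> {} \<Longrightarrow> T \<subseteq> carrier \<Gamma> \<Longrightarrow>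
        \<delta> * real (card T) < real (card {t \<in> T. \<exists>g\<in>K. g \<otimes>\<^bsub>\<Gamma>\<^esub> t \<notin> T})"
    by (rule not_folner_symmetricE[OF G nf]) (rule that, assumption+)
  define e where "e = from_nat_into (carrier \<Gamma>)"
  have ne: "carrier \<Gamma> \<noteq> {}" using G.one_closed by blast
  have e: "e i \<in> carrier \<Gamma>" for i unfolding e_def by (rule from_nat_into[OF ne])
  \<comment> \<open>The identity is included because the second factor is later recovered from pairs
    whose first component is the identity.\<close>
  define E where "E k = insert \<one>\<^bsub>\<Gamma>\<^esub> (e ` {..k})" for k
  have E: "finite (E k)" "E k \<subseteq> carrier \<Gamma>" for k using e unfolding E_def by auto
  \<comment> \<open>The second approximation has to handle sets of \<open>a\<close> points, hence
    the radius \<open>Suc a\<close>; including \<open>E k\<close> makes these sets exhaust the group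
    as well.\<close>
  define F where "F k a = E k \<union> (K \<union> kpow \<Gamma> K (Suc a))" for k a
  have F: "finite (F k a)" "F k a \<subseteq> carrier \<Gamma>" for k a
    using E[of k] K(1,2) G.finite_kpow[OF K(1)] G.kpow_closed[OF K(2)] unfolding F_def
    by (simp_all del: kpow.simps)
  define R where "R k a b \<sigma> \<tau> \<longleftrightarrow> a > 0 \<and> b > 0 \<and>
    approx_action \<Gamma> \<sigma> {1..a} (E k) (1 / real (Suc k)) \<and>
    approx_action \<Gamma> \<tau> {1..b} (F k a) (1 / real (Suc k)) \<and> (\<forall>y. \<tau> \<one>\<^bsub>\<Gamma>\<^esub> y = y)"
    for k a b :: nat and \<sigma> \<tau> :: "'a \<Rightarrow> nat \<Rightarrow> nat"
  have "\<forall>k. \<exists>a b \<sigma> \<tau>. R k a b \<sigma> \<tau>"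
  proof
    fix k
    have pos: "1 / real (Suc k) > 0" by simp
    obtain a :: nat and \<sigma> where a: "a > 0" "approx_action \<Gamma> \<sigma> {1..a} (E k) (1 / real (Suc k))"
      by (rule sofic_group_approx_action[OF sof Ub E[of k] pos]) (rule that, assumption+)
    obtain b :: nat and \<tau> where b: "b > 0" "approx_action \<Gamma> \<tau> {1..b} (F k a) (1 / real (Suc k))" "\<And>y. \<tau> \<one>\<^bsub>\<Gamma>\<^esub> y = y"
      by (rule sofic_group_approx_action[OF sof Ub F[of k a] pos]) (rule that, assumption+)
    have "R k a b \<sigma> \<tau>" unfolding R_def using a b by blast
    then show "\<exists>a b \<sigma> \<tau>. R k a b \<sigma> \<tau>" by blast
  qed
  then have "\<exists>a b \<sigma> \<tau>. \<forall>k. R k (a k) (b k) (\<sigma> k) (\<tau> k)" unfolding choice_iff .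
  then obtain a b \<sigma> \<tau> where R: "\<And>k. R k (a k) (b k) (\<sigma> k) (\<tau> k)" by blast
  have a: "a k > 0" and b: "b k > 0"
    and \<sigma>: "approx_action \<Gamma> (\<sigma> k) {1..a k} (E k) (1 / real (Suc k))"
    and \<tau>: "approx_action \<Gamma> (\<tau> k) {1..b k} (F k (a k)) (1 / real (Suc k))"
    and \<tau>1: "\<tau> k \<one>\<^bsub>\<Gamma>\<^esub> y = y" for k y
    using R[of k] unfolding R_def by blast+
  define n where "n k = a k * b k" for k
  have n: "n k > 0" for k using a b unfolding n_def by simp
  let ?V = "\<lambda>k. {1..a k} \<times> {1..b k}"
  have "\<forall>k. \<exists>f. bij_betw f (?V k) {1..n k}"
  proof
    fix k show "\<exists>f. bij_betw f (?V k) {1..n k}"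
      by (rule finite_same_card_bij) (simp_all add: n_def card_cartesian_product)
  qed
  then have "\<exists>f. \<forall>k. bij_betw (f k) (?V k) {1..n k}" unfolding choice_iff .
  then obtain f where f: "\<And>k. bij_betw (f k) (?V k) {1..n k}" by blast
  define \<rho> where "\<rho> k p y = (if y \<in> {1..n k} then f k (map_prod (\<sigma> k (fst p)) (\<tau> k (snd p)) (inv_into (?V k) (f k) y)) else y)"
    for k p y
  have EF: "E k \<times> F k (a k) \<subseteq> carrier (\<Gamma> \<times>\<times> \<Gamma>)" for k using E(2)[of k] F(2)[of k "a k"] by auto
  note tr = approx_action_transport[OF approx_action_prod[OF \<sigma> \<tau>] EF GG f, folded \<rho>_def]
  have act: "approx_action (\<Gamma> \<times>\<times> \<Gamma>) (\<rho> k) {1..n k} (E k \<times> F k (a k)) (1 / real (Suc k) + 1 / real (Suc k))" for k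
    using tr(1)[of k] unfolding \<rho>_def .
  have perm: "\<rho> k p permutes {1..n k}" if "p \<in> carrier (\<Gamma> \<times>\<times> \<Gamma>)" for k p
    using tr(2)[OF that, of k] unfolding \<rho>_def .
  define \<sigma>' where "\<sigma>' p k = \<rho> k p" for p k
  have car: "\<sigma>' p \<in> carrier (sym_product n)" if "p \<in> carrier (\<Gamma> \<times>\<times> \<Gamma>)" for p
    unfolding carrier_sym_product \<sigma>'_def using perm[OF that] by blast
  have small: "\<forall>\<^sub>F k in U. 1 / real (Suc k) + 1 / real (Suc k) \<le> \<eta>" if \<eta>: "\<eta> > 0" for \<eta> :: real
  proof -
    obtain m where m: "2 / \<eta> < real m" using reals_Archimedean2 by blast
    show ?thesis using free_ultrafilter_ge[OF U, of m]
    proof eventually_elim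
      case (elim k)
      then have "2 / \<eta> \<le> real (Suc k)" using m by linarith
      then show ?case using \<eta> by (simp add: field_simps)
    qed
  qed
  have rep: "sofic_rep U n (\<Gamma> \<times>\<times> \<Gamma>) (\<lambda>p. useq_class U n (\<sigma>' p))"
  proof (rule sofic_repI[OF GG Ub n car])
    fix D and \<eta> :: real
    assume D: "finite D" "D \<subseteq> carrier (\<Gamma> \<times>\<times> \<Gamma>)" and \<eta>: "\<eta> > 0"
    have "\<forall>\<^sub>F k in U. \<forall>p\<in>D. p \<in> E k \<times> F k (a k)"
    proof (rule eventually_ball_finite[OF D(1)], rule ballI)
      fix p assume "p \<in> D"
      then have p: "fst p \<in> carrier \<Gamma>" "snd p \<in> carrier \<Gamma>" using D(2) by auto
      obtain i j where ij: "fst p = e i" "snd p = e j" using p cnt by (metis e_def from_nat_into_surj)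
      show "\<forall>\<^sub>F k in U. p \<in> E k \<times> F k (a k)"
        using free_ultrafilter_ge[OF U, of "max i j"]
      proof eventually_elim
        case (elim k)
        then have "fst p \<in> E k" "snd p \<in> E k" unfolding ij E_def by auto
        then show ?case unfolding F_def mem_Times_iff by blast
      qed
    qed
    then show "\<forall>\<^sub>F k in U. approx_action (\<Gamma> \<times>\<times> \<Gamma>) (\<lambda>p. \<sigma>' p k) {1..n k} D \<eta>"
      using small[OF \<eta>]
    proof eventually_elim
      case (elim k)
      have "D \<subseteq> E k \<times> F k (a k)" using elim(1) by blast
      from approx_action_mono[OF act this elim(2)] show ?case unfolding \<sigma>'_def .
    qed
  qed
  have "\<not> conjugate_homs (universal_sofic U n) \<Gamma> (\<lambda>g. useq_class U n (\<sigma>' (g, \<one>\<^bsub>\<Gamma>\<^esub>))) (\<lambda>g. useq_class U n (\<sigma>' (\<one>\<^bsub>\<Gamma>\<^esub>, g)))"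
  proof
    assume "conjugate_homs (universal_sofic U n) \<Gamma> (\<lambda>g. useq_class U n (\<sigma>' (g, \<one>\<^bsub>\<Gamma>\<^esub>))) (\<lambda>g. useq_class U n (\<sigma>' (\<one>\<^bsub>\<Gamma>\<^esub>, g)))"
    then obtain s where sc: "s \<in> carrier (sym_product n)"
      and s: "\<forall>x\<in>carrier \<Gamma>. almost U n (\<lambda>k j. s k (\<sigma>' (x, \<one>\<^bsub>\<Gamma>\<^esub>) k j) = \<sigma>' (\<one>\<^bsub>\<Gamma>\<^esub>, x) k (s k j))"
      by (subst (asm) conjugate_homs_iff[where \<sigma>\<^sub>1 = "\<lambda>g. \<sigma>' (g, \<one>\<^bsub>\<Gamma>\<^esub>)" and \<sigma>\<^sub>2 = "\<lambda>g. \<sigma>' (\<one>\<^bsub>\<Gamma>\<^esub>, g)"])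
        (auto intro!: car)
    \<comment> \<open>Chosen so that \<open>2 * \<theta> * card K\<close> is at most
      \<open>\<delta> / 4\<close>, while \<open>\<delta> * (1 - \<theta>)\<close> is at least
      \<open>\<delta> / 2\<close>. The \<open>+ 1\<close> keeps the quotient positive without
      knowing that \<open>K\<close> is nonempty.\<close>
    define \<theta> where "\<theta> = min (1 / 2) (\<delta> / (8 * (real (card K) + 1)))"
    have "\<theta> > 0" using \<delta> by (simp add: \<theta>_def)
    moreover have "\<theta> \<le> 1 / 2" unfolding \<theta>_def by (rule min.cobounded1)
    ultimately have \<theta>: "\<theta> > 0" "\<theta> \<le> 1 / 2" .
    have "\<forall>\<^sub>F k in U. \<forall>g\<in>K. real (card {j \<in> {1..n k}. \<not> s k (\<sigma>' (g, \<one>\<^bsub>\<Gamma>\<^esub>) k j) = \<sigma>' (\<one>\<^bsub>\<Gamma>\<^esub>, g) k (s k j)}) \<le> \<theta> * real (n k)"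
      by (intro eventually_ball_finite K(1) ballI almost_eventually \<theta>(1) s[rule_format] subsetD[OF K(2)])
    from eventually_happens'[OF Ub eventually_conj[OF this small[OF \<theta>(1)]]]
    obtain k where conj: "\<And>g. g \<in> K \<Longrightarrow> real (card {j \<in> {1..n k}. s k (\<rho> k (g, \<one>\<^bsub>\<Gamma>\<^esub>) j) \<noteq> \<rho> k (\<one>\<^bsub>\<Gamma>\<^esub>, g) (s k j)}) \<le> \<theta> * real (card {1..n k})"
      and k: "1 / real (Suc k) + 1 / real (Suc k) \<le> \<theta>"
      unfolding \<sigma>'_def by auto
    have inv: "bij_betw (inv_into (?V k) (f k)) {1..n k} (?V k)" using f by (rule bij_betw_inv_into)
    \<comment> \<open>The colour is the second coordinate. Its fibres have at most
      \<open>a k\<close> points, and the first factor preserves it exactly, because of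
      \<open>\<tau>1\<close>.\<close>
    define col where "col y = snd (inv_into (?V k) (f k) y)" for y
    have "approx_action (\<Gamma> \<times>\<times> \<Gamma>) (\<rho> k) {1..n k} ({\<one>\<^bsub>\<Gamma>\<^esub>} \<times> F k (a k)) \<theta>"
      by (rule approx_action_mono[OF act _ k]) (auto simp: E_def)
    from approx_action_snd[OF this G]
    have act2: "approx_action \<Gamma> (\<lambda>h. \<rho> k (\<one>\<^bsub>\<Gamma>\<^esub>, h)) {1..n k} (F k (a k)) \<theta>" .
    have "\<delta> * (1 - \<theta>) * real (card {1..n k}) \<le> real (card K) * (\<theta> + \<theta>) * real (card {1..n k})"
    proof (rule small_classes_not_conjugate[where col = col and N = "a k" and s = "s k" and \<rho>\<^sub>1 = "\<lambda>g. \<rho> k (g, \<one>\<^bsub>\<Gamma>\<^esub>)", OF G K \<delta> bd act2])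
      show "K \<union> kpow \<Gamma> K (Suc (a k)) \<subseteq> F k (a k)" unfolding F_def by blast
      show "card {y \<in> {1..n k}. col y = w} \<le> a k" for w
      proof -
        have "card {y \<in> {1..n k}. col y = w} \<le> card ({1..a k} \<times> {w})"
        proof (rule card_inj_on_le[of "inv_into (?V k) (f k)"])
          show "inj_on (inv_into (?V k) (f k)) {y \<in> {1..n k}. col y = w}"
            by (rule inj_on_subset[OF bij_betw_imp_inj_on[OF inv]]) blast
          show "inv_into (?V k) (f k) ` {y \<in> {1..n k}. col y = w} \<subseteq> {1..a k} \<times> {w}"
          proof (rule image_subsetI)
            fix y assume y: "y \<in> {y \<in> {1..n k}. col y = w}"
            then have "inv_into (?V k) (f k) y \<in> ?V k" using bij_betwE[OF inv] by blast
            then show "inv_into (?V k) (f k) y \<in> {1..a k} \<times> {w}"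
              using y unfolding mem_Times_iff col_def by blast
          qed
        qed simp
        then show ?thesis by (simp add: card_cartesian_product)
      qed
      show "\<rho> k (g, \<one>\<^bsub>\<Gamma>\<^esub>) y \<in> {1..n k} \<and> col (\<rho> k (g, \<one>\<^bsub>\<Gamma>\<^esub>) y) = col y" if g: "g \<in> K" and y: "y \<in> {1..n k}" for g y
      proof
        have gc: "g \<in> carrier \<Gamma>" using g K(2) by blast
        then have "(g, \<one>\<^bsub>\<Gamma>\<^esub>) \<in> carrier (\<Gamma> \<times>\<times> \<Gamma>)" by simp
        from permutes_in_image[OF perm[OF this]] show "\<rho> k (g, \<one>\<^bsub>\<Gamma>\<^esub>) y \<in> {1..n k}" using y by blast
        define z where "z = inv_into (?V k) (f k) y"
        have z: "z \<in> ?V k" using bij_betwE[OF inv] y unfolding z_def by blast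
        have "bij_betw (\<sigma> k g) {1..a k} {1..a k}" using \<sigma>[of k] gc unfolding approx_action_def by blast
        from bij_betwE[OF this] have z': "(\<sigma> k g (fst z), snd z) \<in> ?V k" using z unfolding mem_Times_iff by simp
        have "\<rho> k (g, \<one>\<^bsub>\<Gamma>\<^esub>) y = f k (\<sigma> k g (fst z), snd z)"
          unfolding \<rho>_def z_def[symmetric] map_prod_def using y \<tau>1 by (simp add: case_prod_beta)
        then show "col (\<rho> k (g, \<one>\<^bsub>\<Gamma>\<^esub>) y) = col y"
          unfolding col_def z_def[symmetric] using inv_into_f_f[OF bij_betw_imp_inj_on[OF f] z'] by simp
      qed
      show "bij_betw (s k) {1..n k} {1..n k}"
        using sc unfolding carrier_sym_product by (blast intro: permutes_imp_bij)
    qed (assumption | rule conj)+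
    then have le: "\<delta> * (1 - \<theta>) \<le> real (card K) * (\<theta> + \<theta>)" using n[of k] by simp
    have "real (card K) * \<theta> \<le> (real (card K) + 1) * (\<delta> / (8 * (real (card K) + 1)))"
      using \<theta>(1) by (intro mult_mono) (auto simp: \<theta>_def)
    also have "\<dots> = \<delta> / 8" by (simp add: field_simps)
    finally have "real (card K) * (\<theta> + \<theta>) \<le> \<delta> / 4" by (simp add: distrib_left)
    moreover have "\<delta> * (1 / 2) \<le> \<delta> * (1 - \<theta>)" using \<theta> \<delta> by (intro mult_left_mono) auto
    ultimately show False using le \<delta> by linarith
  qed
  then have "\<not> conjugate_homs (universal_sofic U n) \<Gamma> (restrict_fst \<Gamma> (\<lambda>p. useq_class U n (\<sigma>' p)))
      (restrict_fst \<Gamma> ((\<lambda>p. useq_class U n (\<sigma>' p)) \<circ> flip))"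
    unfolding restrict_fst_def flip_def comp_def by simp
  with n rep show thesis by (rule that)
qed

section \<open>Restriction along embeddings and the equivalences\<close>

lemma sofic_rep_compose:
  assumes rep: "sofic_rep U n \<Lambda> \<pi>" and h: "h \<in> hom G \<Lambda>" "inj_on h (carrier G)" and G: "group G" "group \<Lambda>"
  shows "sofic_rep U n G (\<pi> \<circ> h)"
proof -
  interpret h: group_hom G \<Lambda> h using h(1) G by (simp add: group_hom_def group_hom_axioms_def)
  have \<pi>: "\<pi> \<in> hom \<Lambda> (universal_sofic U n)" "inj_on \<pi> (carrier \<Lambda>)"
    and free: "\<And>y g. y \<in> carrier \<Lambda> \<Longrightarrow> y \<noteq> \<one>\<^bsub>\<Lambda>\<^esub> \<Longrightarrow> g \<in> carrier (sym_product n) \<Longrightarrow> \<pi> y = useq_class U n g \<Longrightarrow>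
      ((\<lambda>k. hamming_dist (n k) (g k) \<one>\<^bsub>sym_group (n k)\<^esub>) \<longlongrightarrow> 1) U"
    using rep unfolding sofic_rep_def by blast+
  show ?thesis
    unfolding sofic_rep_def
  proof (intro conjI ballI impI)
    show "\<pi> \<circ> h \<in> hom G (universal_sofic U n)" using h(1) \<pi>(1) by (rule hom_compose)
    have "h ` carrier G \<subseteq> carrier \<Lambda>" using h.hom_closed by blast
    then show "inj_on (\<pi> \<circ> h) (carrier G)" using h(2) \<pi>(2) by (meson comp_inj_on inj_on_subset)
    fix x g assume x: "x \<in> carrier G" "x \<noteq> \<one>\<^bsub>G\<^esub>" and g: "g \<in> carrier (sym_product n)" "(\<pi> \<circ> h) x = useq_class U n g"
    have "h x \<noteq> \<one>\<^bsub>\<Lambda>\<^esub>"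
      using inj_onD[OF h(2) _ x(1) group.is_monoid[OF G(1), THEN monoid.one_closed]] x(2) h.hom_one by metis
    then show "((\<lambda>k. hamming_dist (n k) (g k) \<one>\<^bsub>sym_group (n k)\<^esub>) \<longlongrightarrow> 1) U"
      using free[OF h.hom_closed[OF x(1)]] g by simp
  qed
qed

text \<open>The equivalences hold for each free ultrafilter separately, since the counterexample to
  (4) is built over the given one.\<close>

theorem theorem5p19:
  fixes U :: "nat filter" and \<Gamma> :: "('a, 'b) monoid_scheme"
  assumes "free_ultrafilter U"
    and "group \<Gamma>" and "countable (carrier \<Gamma>)" and "sofic_group U \<Gamma>"
  shows
    "(amenable \<Gamma> \<longleftrightarrow>
       (\<forall>n :: nat \<Rightarrow> nat. (\<forall>k. n k > 0) \<longrightarrow>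
          (\<forall>\<pi>\<^sub>1 \<pi>\<^sub>2. sofic_rep U n \<Gamma> \<pi>\<^sub>1 \<and> sofic_rep U n \<Gamma> \<pi>\<^sub>2 \<longrightarrow>
             conjugate_homs (universal_sofic U n) \<Gamma> \<pi>\<^sub>1 \<pi>\<^sub>2))) \<and>
     (amenable \<Gamma> \<longleftrightarrow>
       (\<forall>n :: nat \<Rightarrow> nat. (\<forall>k. n k > 0) \<longrightarrow>
          (\<forall>\<pi>. sofic_rep U n (\<Gamma> \<times>\<times> \<Gamma>) \<pi> \<longrightarrow>
             conjugate_homs (universal_sofic U n) (\<Gamma> \<times>\<times> \<Gamma>) \<pi> (\<pi> \<circ> flip)))) \<and>
     (amenable \<Gamma> \<longleftrightarrow>
       (\<forall>n :: nat \<Rightarrow> nat. (\<forall>k. n k > 0) \<longrightarrow>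
          (\<forall>\<pi>. sofic_rep U n (\<Gamma> \<times>\<times> \<Gamma>) \<pi> \<longrightarrow>
             conjugate_homs (universal_sofic U n) \<Gamma>
               (restrict_fst \<Gamma> \<pi>) (restrict_fst \<Gamma> (\<pi> \<circ> flip)))))"
    (is "(_ \<longleftrightarrow> ?C2) \<and> (_ \<longleftrightarrow> ?C3) \<and> (_ \<longleftrightarrow> ?C4)")
proof -
  note U = assms(1) and G = assms(2) and cnt = assms(3) and sof = assms(4)
  interpret G: group \<Gamma> by (rule G)
  have GG: "group (\<Gamma> \<times>\<times> \<Gamma>)" using G by (intro DirProd_group)
  have "?C2" if "amenable \<Gamma>"
    using folner_sofic_rep_conjugate[OF U G cnt G.amenable_imp_folner[OF that]] by blast
  \<comment> \<open>Composing with the flip gives a sofic representation again, so (3) is an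
    instance of uniqueness up to conjugacy for the square group.\<close>
  moreover have "?C3" if "amenable \<Gamma>"
  proof (intro allI impI)
    fix n :: "nat \<Rightarrow> nat" and \<pi>
    assume n: "\<forall>k. n k > 0" and rep: "sofic_rep U n (\<Gamma> \<times>\<times> \<Gamma>) \<pi>"
    have fol: "folner (\<Gamma> \<times>\<times> \<Gamma>)"
      using G.amenable_imp_folner[OF that] by (intro folner_DirProd G)
    have cnt2: "countable (carrier (\<Gamma> \<times>\<times> \<Gamma>))" using cnt by simp
    have "flip \<in> hom (\<Gamma> \<times>\<times> \<Gamma>) (\<Gamma> \<times>\<times> \<Gamma>)" "inj_on flip (carrier (\<Gamma> \<times>\<times> \<Gamma>))"
      using flip_iso[OF G] by (auto simp: iso_def bij_betw_def)
    then have "sofic_rep U n (\<Gamma> \<times>\<times> \<Gamma>) (\<pi> \<circ> flip)" using GG by (intro sofic_rep_compose[OF rep])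
    with rep show "conjugate_homs (universal_sofic U n) (\<Gamma> \<times>\<times> \<Gamma>) \<pi> (\<pi> \<circ> flip)"
      using folner_sofic_rep_conjugate[OF U GG cnt2 fol] n by blast
  qed
  \<comment> \<open>The two restrictions are sofic representations of \<Gamma> in their own right,
    so (2) compares them.\<close>
  moreover have "?C4" if C2: "?C2"
  proof (intro allI impI)
    fix n :: "nat \<Rightarrow> nat" and \<pi>
    assume n: "\<forall>k. n k > 0" and rep: "sofic_rep U n (\<Gamma> \<times>\<times> \<Gamma>) \<pi>"
    let ?i = "\<lambda>g. (g, \<one>\<^bsub>\<Gamma>\<^esub>)" and ?j = "\<lambda>g. (\<one>\<^bsub>\<Gamma>\<^esub>, g)"
    have "?i \<in> hom \<Gamma> (\<Gamma> \<times>\<times> \<Gamma>)" "?j \<in> hom \<Gamma> (\<Gamma> \<times>\<times> \<Gamma>)"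
      by (auto intro!: homI)
    moreover have "inj_on ?i (carrier \<Gamma>)" "inj_on ?j (carrier \<Gamma>)" by (auto intro: inj_onI)
    ultimately have "sofic_rep U n \<Gamma> (\<pi> \<circ> ?i)" "sofic_rep U n \<Gamma> (\<pi> \<circ> ?j)"
      using sofic_rep_compose[OF rep _ _ G GG] by blast+
    moreover have "\<pi> \<circ> ?i = restrict_fst \<Gamma> \<pi>" "\<pi> \<circ> ?j = restrict_fst \<Gamma> (\<pi> \<circ> flip)"
      by (auto simp: restrict_fst_def flip_def)
    ultimately show "conjugate_homs (universal_sofic U n) \<Gamma> (restrict_fst \<Gamma> \<pi>) (restrict_fst \<Gamma> (\<pi> \<circ> flip))"
      using C2 n by metis
  qed
  moreover have "?C4" if C3: "?C3"
  proof (intro allI impI)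
    fix n :: "nat \<Rightarrow> nat" and \<pi>
    assume n: "\<forall>k. n k > 0" and rep: "sofic_rep U n (\<Gamma> \<times>\<times> \<Gamma>) \<pi>"
    have "conjugate_homs (universal_sofic U n) (\<Gamma> \<times>\<times> \<Gamma>) \<pi> (\<pi> \<circ> flip)" using C3 n rep by blast
    then show "conjugate_homs (universal_sofic U n) \<Gamma> (restrict_fst \<Gamma> \<pi>) (restrict_fst \<Gamma> (\<pi> \<circ> flip))"
      unfolding conjugate_homs_def restrict_fst_def by auto
  qed
  moreover have "amenable \<Gamma>" if C4: "?C4"
  proof (rule G.folner_imp_amenable[OF _ cnt U], rule ccontr)
    assume nf: "\<not> folner \<Gamma>"
    show False
      by (rule not_folner_not_conjugate[OF U G cnt sof nf]) (use C4 in blast)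
  qed
  ultimately show ?thesis by argo
qed

end
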